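(* Let $(\mathbb{L},\mathbb{R})$ be the algebraic weak factorisation system on $\mathbf{Top}$ generated from $\mathcal{J}=\{S^{n-1}\hookrightarrow D^n : n\ge 0\}$ by Garner's small object argument. Then every continuous map which admits a left map structure with respect to $(\mathbb{L},\mathbb{R})$ (i.e. a coalgebra structure for the comonad $\mathbb{L}$) belongs to the class $\mathcal{J}\text{-}\mathrm{cell}$ of relative $\mathcal{J}$-cell complexes.
   Context: $\mathbf{Top}$ is the category of topological spaces and continuous maps; for a category $\mathcal{C}$, $\mathcal{C}^{\mathbf 2}$ is its arrow category, morphisms being commutative squares $(a,b)$ with domain component $a$ and codomain component $b$. $\mathcal{J}$ is the set of inclusions $S^{n-1}\hookrightarrow D^n$, $n\ge0$ (with $S^{-1}=\emptyset$ and $S^0$ the endpoints of $D^1$), regarded as a discrete category over $\mathbf{Top}^{\mathbf 2}$. $\mathcal{J}\text{-}\mathrm{cell}$ is the smallest class of maps of $\mathbf{Top}$ containing $\mathcal{J}$ and closed under coproducts, pushouts and transfinite composition. An algebraic weak factorisation system (awfs) $(L,R)$ on $\mathcal{C}$ consists of a comonad $(L,\vec\epsilon,\vec\delta)$ and a monad $(R,\vec\eta,\vec\mu)$ on $\mathcal{C}^{\mathbf 2}$ whose underlying copointed and pointed endofunctors form a functorial factorisation: each $f\colon A\to B$ factors as $A\xrightarrow{Lf}Mf\xrightarrow{Rf}B$ with $\vec\epsilon_f=(1_A,Rf)$, $\vec\eta_f=(Lf,1_B)$, where $M\colon\mathcal{C}^{\mathbf 2}\to\mathcal{C}$ is the functor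 $\mathrm{cod}\circ L=\mathrm{dom}\circ R$. Then $\vec\delta_f=(1,\delta_f)$, $\vec\mu_f=(\mu_f,1)$ with $\delta_f\colon Mf\to MLf$, $\mu_f\colon MRf\to Mf$; it is required that the transformation $LR\to RL$ with components $(\delta_f,\mu_f)$ be a distributive law of the comonad over the monad. $L\text{-}\mathrm{Map}$ denotes the category of coalgebras of the comonad $L$; a left map structure on $f\colon A\to B$ is a coalgebra structure $(1_A,\alpha)\colon f\to Lf$, written as $\alpha\colon B\to Mf$. A morphism of awfs $(L,R)\to(L',R')$ is a natural transformation $\chi\colon M\to M'$ such that $(1,\chi)\colon L\to L'$ is a comonad morphism and $(\chi,1)\colon R\to R'$ is a monad morphism; it induces a functor $\chi_*\colon L\text{-}\mathrm{Map}\to L'\text{-}\mathrm{Map}$ over $\mathcal{C}^{\mathbf 2}$, $(f,\alpha)\mapsto(f,\chi_f\circ\alpha)$. Given a small category $\mathcal{I}$ over $\mathcal{C}^{\mathbf 2}$, an awfs $(L,R)$ on $\mathcal{C}$ is free with respect to $\mathcal{I}$ if there is a functor $\eta\colon\mathcal{I}\to L\text{-}\mathrm{Map}$ over $\mathcal{C}^{\mathbf 2}$ such that for any awfs $(L',R')$ on $\mathcal{C}$ and functor $F\colon\mathcal{I}\to L'\text{-}\mathrm{Map}$ over $\mathcal{C}^{\mathbf 2}$ there is a unique awfs morphism $\chi\colon(L,R)\to(L',R')$ with $F=\chi_*\circ\eta$. The awfs $(\mathbb{L},\mathbb{R})$ generated from $\mathcal{J}$ by Garner's small object argument is free with respect to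 $\mathcal{J}$ (a theorem of Garner), and is determined up to isomorphism of awfs by this property. *)

theory Defs
  imports "HOL-Analysis.Analysis" "HOL-Library.Equipollence" "HOL-Library.FuncSet"
begin

section \<open>Categories, functors, natural transformations\<close>

text \<open>Object and arrow parts of functors and transformations are total HOL functions; only their
  values on the objects and arrows of the source category carry meaning.\<close>

record ('o, 'm) cat =
  Obj :: "'o set"
  Arr :: "'m set"
  Dom :: "'m \<Rightarrow> 'o"
  Cod :: "'m \<Rightarrow> 'o"
  Idn :: "'o \<Rightarrow> 'm"
  Comp :: "'m \<Rightarrow> 'm \<Rightarrow> 'm"  (infixl \<open>\<cdot>\<index>\<close> 70)

definition Hom :: "('o, 'm) cat \<Rightarrow> 'o \<Rightarrow> 'o \<Rightarrow> 'm set"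
  where "Hom C X Y = {f \<in> Arr C. Dom C f = X \<and> Cod C f = Y}"

locale category =
  fixes C :: "('o, 'm) cat" (structure)
  assumes Dom_Obj: "f \<in> Arr C \<Longrightarrow> Dom C f \<in> Obj C"
    and Cod_Obj: "f \<in> Arr C \<Longrightarrow> Cod C f \<in> Obj C"
    and Idn_Hom: "X \<in> Obj C \<Longrightarrow> Idn C X \<in> Hom C X X"
    and Comp_Hom: "\<lbrakk>f \<in> Hom C X Y; g \<in> Hom C Y Z\<rbrakk> \<Longrightarrow> g \<cdot> f \<in> Hom C X Z"
    and Comp_Idn: "f \<in> Hom C X Y \<Longrightarrow> f \<cdot> Idn C X = f"
    and Idn_Comp: "f \<in> Hom C X Y \<Longrightarrow> Idn C Y \<cdot> f = f"
    and Comp_assoc: "\<lbrakk>f \<in> Hom C W X; g \<in> Hom C X Y; h \<in> Hom C Y Z\<rbrakk>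
      \<Longrightarrow> (h \<cdot> g) \<cdot> f = h \<cdot> (g \<cdot> f)"

record ('o, 'm, 'p, 'n) ftor =
  FObj :: "'o \<Rightarrow> 'p"
  FArr :: "'m \<Rightarrow> 'n"

definition is_functor :: "('o, 'm) cat \<Rightarrow> ('p, 'n) cat \<Rightarrow> ('o, 'm, 'p, 'n) ftor \<Rightarrow> bool"
  where "is_functor C D F \<longleftrightarrow> category C \<and> category D \<and>
    (\<forall>X \<in> Obj C. FObj F X \<in> Obj D) \<and>
    (\<forall>f \<in> Arr C. FArr F f \<in> Hom D (FObj F (Dom C f)) (FObj F (Cod C f))) \<and>
    (\<forall>X \<in> Obj C. FArr F (Idn C X) = Idn D (FObj F X)) \<and>
    (\<forall>X Y Z f g. f \<in> Hom C X Y \<longrightarrow> g \<in> Hom C Y Z \<longrightarrow>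
       FArr F (g \<cdot>\<^bsub>C\<^esub> f) = FArr F g \<cdot>\<^bsub>D\<^esub> FArr F f)"

definition functor_eq :: "('o, 'm) cat \<Rightarrow> ('o, 'm, 'p, 'n) ftor \<Rightarrow> ('o, 'm, 'p, 'n) ftor \<Rightarrow> bool"
  where "functor_eq C F G \<longleftrightarrow>
    (\<forall>X \<in> Obj C. FObj F X = FObj G X) \<and> (\<forall>f \<in> Arr C. FArr F f = FArr G f)"

definition id_functor :: "('o, 'm, 'o, 'm) ftor"
  where "id_functor = \<lparr>FObj = (\<lambda>X. X), FArr = (\<lambda>f. f)\<rparr>"

definition functor_comp ::
    "('p, 'n, 'q, 'k) ftor \<Rightarrow> ('o, 'm, 'p, 'n) ftor \<Rightarrow> ('o, 'm, 'q, 'k) ftor"  (infixl \<open>\<circ>\<^sub>F\<close> 55)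
  where "G \<circ>\<^sub>F F = \<lparr>FObj = (\<lambda>X. FObj G (FObj F X)), FArr = (\<lambda>f. FArr G (FArr F f))\<rparr>"

definition nat_trans :: "('o, 'm) cat \<Rightarrow> ('p, 'n) cat \<Rightarrow> ('o, 'm, 'p, 'n) ftor \<Rightarrow>
    ('o, 'm, 'p, 'n) ftor \<Rightarrow> ('o \<Rightarrow> 'n) \<Rightarrow> bool"
  where "nat_trans C D F G \<tau> \<longleftrightarrow> is_functor C D F \<and> is_functor C D G \<and>
    (\<forall>X \<in> Obj C. \<tau> X \<in> Hom D (FObj F X) (FObj G X)) \<and>
    (\<forall>X Y f. f \<in> Hom C X Y \<longrightarrow> \<tau> Y \<cdot>\<^bsub>D\<^esub> FArr F f = FArr G f \<cdot>\<^bsub>D\<^esub> \<tau> X)"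

text \<open>A datatype of arrows that record their source and target.\<close>

datatype ('o, 'x) arrow = Arrow (src: 'o) (tgt: 'o) (mor: 'x)

definition discrete_cat :: "'i set \<Rightarrow> ('i, 'i) cat"
  where "discrete_cat S =
    \<lparr>Obj = S, Arr = S, Dom = (\<lambda>x. x), Cod = (\<lambda>x. x), Idn = (\<lambda>x. x), Comp = (\<lambda>g f. f)\<rparr>"


section \<open>Comonads, monads, coalgebras, distributive laws\<close>

definition comonad :: "('o, 'm) cat \<Rightarrow> ('o, 'm, 'o, 'm) ftor \<Rightarrow> ('o \<Rightarrow> 'm) \<Rightarrow> ('o \<Rightarrow> 'm) \<Rightarrow> bool"
  where "comonad C T \<epsilon> \<delta> \<longleftrightarrow>
    nat_trans C C T id_functor \<epsilon> \<and> nat_trans C C T (T \<circ>\<^sub>F T) \<delta> \<and>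
    (\<forall>X \<in> Obj C.
       \<epsilon> (FObj T X) \<cdot>\<^bsub>C\<^esub> \<delta> X = Idn C (FObj T X) \<and>
       FArr T (\<epsilon> X) \<cdot>\<^bsub>C\<^esub> \<delta> X = Idn C (FObj T X) \<and>
       \<delta> (FObj T X) \<cdot>\<^bsub>C\<^esub> \<delta> X = FArr T (\<delta> X) \<cdot>\<^bsub>C\<^esub> \<delta> X)"

definition monad :: "('o, 'm) cat \<Rightarrow> ('o, 'm, 'o, 'm) ftor \<Rightarrow> ('o \<Rightarrow> 'm) \<Rightarrow> ('o \<Rightarrow> 'm) \<Rightarrow> bool"
  where "monad C T \<eta> \<mu> \<longleftrightarrow>
    nat_trans C C id_functor T \<eta> \<and> nat_trans C C (T \<circ>\<^sub>F T) T \<mu> \<and>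
    (\<forall>X \<in> Obj C.
       \<mu> X \<cdot>\<^bsub>C\<^esub> \<eta> (FObj T X) = Idn C (FObj T X) \<and>
       \<mu> X \<cdot>\<^bsub>C\<^esub> FArr T (\<eta> X) = Idn C (FObj T X) \<and>
       \<mu> X \<cdot>\<^bsub>C\<^esub> \<mu> (FObj T X) = \<mu> X \<cdot>\<^bsub>C\<^esub> FArr T (\<mu> X))"

definition comonad_morphism :: "('o, 'm) cat \<Rightarrow>
    ('o, 'm, 'o, 'm) ftor \<Rightarrow> ('o \<Rightarrow> 'm) \<Rightarrow> ('o \<Rightarrow> 'm) \<Rightarrow>
    ('o, 'm, 'o, 'm) ftor \<Rightarrow> ('o \<Rightarrow> 'm) \<Rightarrow> ('o \<Rightarrow> 'm) \<Rightarrow> ('o \<Rightarrow> 'm) \<Rightarrow> bool"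
  where "comonad_morphism C T \<epsilon> \<delta> T' \<epsilon>' \<delta>' \<theta> \<longleftrightarrow> nat_trans C C T T' \<theta> \<and>
    (\<forall>X \<in> Obj C.
       \<epsilon>' X \<cdot>\<^bsub>C\<^esub> \<theta> X = \<epsilon> X \<and>
       \<delta>' X \<cdot>\<^bsub>C\<^esub> \<theta> X = (FArr T' (\<theta> X) \<cdot>\<^bsub>C\<^esub> \<theta> (FObj T X)) \<cdot>\<^bsub>C\<^esub> \<delta> X)"

definition monad_morphism :: "('o, 'm) cat \<Rightarrow>
    ('o, 'm, 'o, 'm) ftor \<Rightarrow> ('o \<Rightarrow> 'm) \<Rightarrow> ('o \<Rightarrow> 'm) \<Rightarrow>
    ('o, 'm, 'o, 'm) ftor \<Rightarrow> ('o \<Rightarrow> 'm) \<Rightarrow> ('o \<Rightarrow> 'm) \<Rightarrow> ('o \<Rightarrow> 'm) \<Rightarrow> bool"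
  where "monad_morphism C T \<eta> \<mu> T' \<eta>' \<mu>' \<theta> \<longleftrightarrow> nat_trans C C T T' \<theta> \<and>
    (\<forall>X \<in> Obj C.
       \<theta> X \<cdot>\<^bsub>C\<^esub> \<eta> X = \<eta>' X \<and>
       \<theta> X \<cdot>\<^bsub>C\<^esub> \<mu> X = \<mu>' X \<cdot>\<^bsub>C\<^esub> (FArr T' (\<theta> X) \<cdot>\<^bsub>C\<^esub> \<theta> (FObj T X)))"

text \<open>Distributive law of a comonad \<open>L\<close> over a monad \<open>R\<close>: a transformation \<open>L R \<rightarrow> R L\<close> compatible
  with counit, comultiplication, unit and multiplication.\<close>

definition distributive_law :: "('o, 'm) cat \<Rightarrow>
    ('o, 'm, 'o, 'm) ftor \<Rightarrow> ('o \<Rightarrow> 'm) \<Rightarrow> ('o \<Rightarrow> 'm) \<Rightarrow>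
    ('o, 'm, 'o, 'm) ftor \<Rightarrow> ('o \<Rightarrow> 'm) \<Rightarrow> ('o \<Rightarrow> 'm) \<Rightarrow> ('o \<Rightarrow> 'm) \<Rightarrow> bool"
  where "distributive_law C L \<epsilon> \<delta> R \<eta> \<mu> \<rho> \<longleftrightarrow> nat_trans C C (L \<circ>\<^sub>F R) (R \<circ>\<^sub>F L) \<rho> \<and>
    (\<forall>X \<in> Obj C.
       FArr R (\<epsilon> X) \<cdot>\<^bsub>C\<^esub> \<rho> X = \<epsilon> (FObj R X) \<and>
       FArr R (\<delta> X) \<cdot>\<^bsub>C\<^esub> \<rho> X
         = \<rho> (FObj L X) \<cdot>\<^bsub>C\<^esub> (FArr L (\<rho> X) \<cdot>\<^bsub>C\<^esub> \<delta> (FObj R X)) \<and>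
       \<rho> X \<cdot>\<^bsub>C\<^esub> FArr L (\<eta> X) = \<eta> (FObj L X) \<and>
       \<rho> X \<cdot>\<^bsub>C\<^esub> FArr L (\<mu> X)
         = (\<mu> (FObj L X) \<cdot>\<^bsub>C\<^esub> FArr R (\<rho> X)) \<cdot>\<^bsub>C\<^esub> \<rho> (FObj R X))"

definition coalg_cat :: "('o, 'm) cat \<Rightarrow> ('o, 'm, 'o, 'm) ftor \<Rightarrow> ('o \<Rightarrow> 'm) \<Rightarrow> ('o \<Rightarrow> 'm) \<Rightarrow>
    ('o \<times> 'm, ('o \<times> 'm, 'm) arrow) cat"
  where "coalg_cat C T \<epsilon> \<delta> =
    (let Coalg = {(X, s). X \<in> Obj C \<and> s \<in> Hom C X (FObj T X) \<and>
           \<epsilon> X \<cdot>\<^bsub>C\<^esub> s = Idn C X \<and> \<delta> X \<cdot>\<^bsub>C\<^esub> s = FArr T s \<cdot>\<^bsub>C\<^esub> s}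
     in \<lparr>Obj = Coalg,
         Arr = {h. src h \<in> Coalg \<and> tgt h \<in> Coalg \<and> mor h \<in> Hom C (fst (src h)) (fst (tgt h)) \<and>
           snd (tgt h) \<cdot>\<^bsub>C\<^esub> mor h = FArr T (mor h) \<cdot>\<^bsub>C\<^esub> snd (src h)},
         Dom = src,
         Cod = tgt,
         Idn = (\<lambda>X. Arrow X X (Idn C (fst X))),
         Comp = (\<lambda>k h. Arrow (src h) (tgt k) (mor k \<cdot>\<^bsub>C\<^esub> mor h))\<rparr>)"

definition coalg_forget :: "('o \<times> 'm, ('o \<times> 'm, 'm) arrow, 'o, 'm) ftor"
  where "coalg_forget = \<lparr>FObj = fst, FArr = mor\<rparr>"


section \<open>The arrow category\<close>

text \<open>A morphism \<open>f \<rightarrow> g\<close> of the arrow category is \<open>Arrow f g (a, b)\<close> for a commutative square with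
  domain component \<open>a\<close> and codomain component \<open>b\<close>.\<close>

type_synonym 'm sq = "('m, 'm \<times> 'm) arrow"

definition arrow_cat :: "('o, 'm) cat \<Rightarrow> ('m, 'm sq) cat"
  where "arrow_cat C =
    \<lparr>Obj = Arr C,
     Arr = {s. src s \<in> Arr C \<and> tgt s \<in> Arr C \<and>
       fst (mor s) \<in> Hom C (Dom C (src s)) (Dom C (tgt s)) \<and>
       snd (mor s) \<in> Hom C (Cod C (src s)) (Cod C (tgt s)) \<and>
       tgt s \<cdot>\<^bsub>C\<^esub> fst (mor s) = snd (mor s) \<cdot>\<^bsub>C\<^esub> src s},
     Dom = src,
     Cod = tgt,
     Idn = (\<lambda>f. Arrow f f (Idn C (Dom C f), Idn C (Cod C f))),
     Comp = (\<lambda>t s. Arrow (src s) (tgt t)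
       (fst (mor t) \<cdot>\<^bsub>C\<^esub> fst (mor s), snd (mor t) \<cdot>\<^bsub>C\<^esub> snd (mor s)))\<rparr>"


section \<open>Algebraic weak factorisation systems\<close>

record 'm awfs_data =
  Lf :: "('m, 'm sq, 'm, 'm sq) ftor"
  counit :: "'m \<Rightarrow> 'm sq"
  comult :: "'m \<Rightarrow> 'm sq"
  Rf :: "('m, 'm sq, 'm, 'm sq) ftor"
  unit :: "'m \<Rightarrow> 'm sq"
  mult :: "'m \<Rightarrow> 'm sq"

abbreviation Lo :: "'m awfs_data \<Rightarrow> 'm \<Rightarrow> 'm"
  where "Lo A f \<equiv> FObj (Lf A) f"

abbreviation Ro :: "'m awfs_data \<Rightarrow> 'm \<Rightarrow> 'm"
  where "Ro A f \<equiv> FObj (Rf A) f"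

definition functorial_factorisation :: "('o, 'm) cat \<Rightarrow> 'm awfs_data \<Rightarrow> bool"
  where "functorial_factorisation C A \<longleftrightarrow>
    (\<forall>f \<in> Arr C.
       Dom C (Lo A f) = Dom C f \<and> Cod C (Lo A f) = Dom C (Ro A f) \<and> Cod C (Ro A f) = Cod C f \<and>
       Ro A f \<cdot>\<^bsub>C\<^esub> Lo A f = f \<and>
       counit A f = Arrow (Lo A f) f (Idn C (Dom C f), Ro A f) \<and>
       unit A f = Arrow f (Ro A f) (Lo A f, Idn C (Cod C f))) \<and>
    (\<forall>s \<in> Arr (arrow_cat C). snd (mor (FArr (Lf A) s)) = fst (mor (FArr (Rf A) s)))"

definition Mf :: "('o, 'm) cat \<Rightarrow> 'm awfs_data \<Rightarrow> ('m, 'm sq, 'o, 'm) ftor"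
  where "Mf C A = \<lparr>FObj = (\<lambda>f. Cod C (Lo A f)), FArr = (\<lambda>s. snd (mor (FArr (Lf A) s)))\<rparr>"

text \<open>In the distributive law, \<open>snd (mor (comult A f))\<close> is \<open>\<delta>\<^sub>f : M f \<rightarrow> M L f\<close> and
  \<open>fst (mor (mult A f))\<close> is \<open>\<mu>\<^sub>f : M R f \<rightarrow> M f\<close>. The other components of \<open>comult A f\<close> and \<open>mult A f\<close>
  are identities by the (co)unit laws.\<close>

definition awfs :: "('o, 'm) cat \<Rightarrow> 'm awfs_data \<Rightarrow> bool"
  where "awfs C A \<longleftrightarrow>
    comonad (arrow_cat C) (Lf A) (counit A) (comult A) \<and>
    monad (arrow_cat C) (Rf A) (unit A) (mult A) \<and>
    functorial_factorisation C A \<and>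
    distributive_law (arrow_cat C) (Lf A) (counit A) (comult A) (Rf A) (unit A) (mult A)
      (\<lambda>f. Arrow (Lo A (Ro A f)) (Ro A (Lo A f)) (snd (mor (comult A f)), fst (mor (mult A f))))"

definition LMap :: "('o, 'm) cat \<Rightarrow> 'm awfs_data \<Rightarrow> ('m \<times> 'm sq, ('m \<times> 'm sq, 'm sq) arrow) cat"
  where "LMap C A = coalg_cat (arrow_cat C) (Lf A) (counit A) (comult A)"

definition left_map_structure :: "('o, 'm) cat \<Rightarrow> 'm awfs_data \<Rightarrow> 'm \<Rightarrow> 'm \<Rightarrow> bool"
  where "left_map_structure C A f \<alpha> \<longleftrightarrow>
    (f, Arrow f (Lo A f) (Idn C (Dom C f), \<alpha>)) \<in> Obj (LMap C A)"

definition awfs_morphism :: "('o, 'm) cat \<Rightarrow> 'm awfs_data \<Rightarrow> 'm awfs_data \<Rightarrow> ('m \<Rightarrow> 'm) \<Rightarrow> bool"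
  where "awfs_morphism C A A' \<xi> \<longleftrightarrow>
    nat_trans (arrow_cat C) C (Mf C A) (Mf C A') \<xi> \<and>
    comonad_morphism (arrow_cat C) (Lf A) (counit A) (comult A) (Lf A') (counit A') (comult A')
      (\<lambda>f. Arrow (Lo A f) (Lo A' f) (Idn C (Dom C f), \<xi> f)) \<and>
    monad_morphism (arrow_cat C) (Rf A) (unit A) (mult A) (Rf A') (unit A') (mult A')
      (\<lambda>f. Arrow (Ro A f) (Ro A' f) (\<xi> f, Idn C (Cod C f)))"

text \<open>The functor \<open>\<xi>\<^sub>*\<close> from \<open>L\<close>-coalgebras to \<open>L'\<close>-coalgebras, \<open>(f, \<alpha>) \<mapsto> (f, \<xi>\<^sub>f \<circ> \<alpha>)\<close>;
  \<open>\<alpha>\<close> is the codomain component of the structure square.\<close>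

definition push_coalg :: "('o, 'm) cat \<Rightarrow> 'm awfs_data \<Rightarrow> ('m \<Rightarrow> 'm) \<Rightarrow> 'm \<times> 'm sq \<Rightarrow> 'm \<times> 'm sq"
  where "push_coalg C A' \<xi> x =
    (let f = fst x; \<alpha> = snd (mor (snd x))
     in (f, Arrow f (Lo A' f) (Idn C (Dom C f), \<xi> f \<cdot>\<^bsub>C\<^esub> \<alpha>)))"

definition push_functor :: "('o, 'm) cat \<Rightarrow> 'm awfs_data \<Rightarrow> ('m \<Rightarrow> 'm) \<Rightarrow>
    ('m \<times> 'm sq, ('m \<times> 'm sq, 'm sq) arrow, 'm \<times> 'm sq, ('m \<times> 'm sq, 'm sq) arrow) ftor"
  where "push_functor C A' \<xi> =
    \<lparr>FObj = push_coalg C A' \<xi>,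
     FArr = (\<lambda>h. Arrow (push_coalg C A' \<xi> (src h)) (push_coalg C A' \<xi> (tgt h)) (mor h))\<rparr>"

text \<open>Functors \<open>I \<rightarrow> L-Map\<close> over the arrow category, for \<open>I\<close> lying over it by \<open>U\<close>.\<close>

definition functor_to_LMap :: "('o, 'm) cat \<Rightarrow> ('i, 'j) cat \<Rightarrow> ('i, 'j, 'm, 'm sq) ftor \<Rightarrow>
    'm awfs_data \<Rightarrow> ('i, 'j, 'm \<times> 'm sq, ('m \<times> 'm sq, 'm sq) arrow) ftor \<Rightarrow> bool"
  where "functor_to_LMap C I U A F \<longleftrightarrow>
    is_functor I (LMap C A) F \<and> functor_eq I (coalg_forget \<circ>\<^sub>F F) U"

definition free_awfs :: "('o, 'm) cat \<Rightarrow> ('i, 'j) cat \<Rightarrow> ('i, 'j, 'm, 'm sq) ftor \<Rightarrow>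
    'm awfs_data \<Rightarrow> bool"
  where "free_awfs C I U A \<longleftrightarrow>
    awfs C A \<and> is_functor I (arrow_cat C) U \<and>
    (\<exists>\<eta>. functor_to_LMap C I U A \<eta> \<and>
      (\<forall>A' F. awfs C A' \<and> functor_to_LMap C I U A' F \<longrightarrow>
        (\<exists>\<xi>. awfs_morphism C A A' \<xi> \<and> functor_eq I F (push_functor C A' \<xi> \<circ>\<^sub>F \<eta>) \<and>
          (\<forall>\<xi>'. awfs_morphism C A A' \<xi>' \<and> functor_eq I F (push_functor C A' \<xi>' \<circ>\<^sub>F \<eta>) \<longrightarrow>
             (\<forall>f \<in> Arr C. \<xi>' f = \<xi> f)))))"


section \<open>Colimits\<close>

definition is_coproduct ::
    "('o, 'm) cat \<Rightarrow> 'i set \<Rightarrow> ('i \<Rightarrow> 'o) \<Rightarrow> 'o \<Rightarrow> ('i \<Rightarrow> 'm) \<Rightarrow> bool"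
  where "is_coproduct C I X Q \<iota> \<longleftrightarrow> Q \<in> Obj C \<and> (\<forall>i \<in> I. \<iota> i \<in> Hom C (X i) Q) \<and>
    (\<forall>Y \<in> Obj C. \<forall>u. (\<forall>i \<in> I. u i \<in> Hom C (X i) Y) \<longrightarrow>
      (\<exists>!h. h \<in> Hom C Q Y \<and> (\<forall>i \<in> I. h \<cdot>\<^bsub>C\<^esub> \<iota> i = u i)))"

text \<open>\<open>g\<close> is the pushout of \<open>f\<close> along \<open>u\<close>, in the square \<open>g \<cdot> u = v \<cdot> f\<close>.\<close>

definition is_pushout :: "('o, 'm) cat \<Rightarrow> 'm \<Rightarrow> 'm \<Rightarrow> 'm \<Rightarrow> 'm \<Rightarrow> bool"
  where "is_pushout C f u v g \<longleftrightarrow>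
    f \<in> Arr C \<and> u \<in> Arr C \<and> v \<in> Arr C \<and> g \<in> Arr C \<and>
    Dom C u = Dom C f \<and> Dom C v = Cod C f \<and> Dom C g = Cod C u \<and> Cod C g = Cod C v \<and>
    g \<cdot>\<^bsub>C\<^esub> u = v \<cdot>\<^bsub>C\<^esub> f \<and>
    (\<forall>Y \<in> Obj C. \<forall>p \<in> Hom C (Cod C u) Y. \<forall>q \<in> Hom C (Cod C f) Y.
       p \<cdot>\<^bsub>C\<^esub> u = q \<cdot>\<^bsub>C\<^esub> f \<longrightarrow>
       (\<exists>!h. h \<in> Hom C (Cod C g) Y \<and> h \<cdot>\<^bsub>C\<^esub> g = p \<and> h \<cdot>\<^bsub>C\<^esub> v = q))"

text \<open>Diagrams indexed by the reflexive order \<open>r\<close> restricted to \<open>K\<close>, seen as a category.\<close>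

definition is_diagram ::
    "('o, 'm) cat \<Rightarrow> 'i set \<Rightarrow> 'i rel \<Rightarrow> ('i \<Rightarrow> 'o) \<Rightarrow> ('i \<Rightarrow> 'i \<Rightarrow> 'm) \<Rightarrow> bool"
  where "is_diagram C K r X x \<longleftrightarrow> (\<forall>i \<in> K. X i \<in> Obj C \<and> x i i = Idn C (X i)) \<and>
    (\<forall>i \<in> K. \<forall>j \<in> K. (i, j) \<in> r \<longrightarrow> x i j \<in> Hom C (X i) (X j)) \<and>
    (\<forall>i \<in> K. \<forall>j \<in> K. \<forall>k \<in> K. (i, j) \<in> r \<longrightarrow> (j, k) \<in> r \<longrightarrow> x j k \<cdot>\<^bsub>C\<^esub> x i j = x i k)"

definition is_cocone :: "('o, 'm) cat \<Rightarrow> 'i set \<Rightarrow> 'i rel \<Rightarrow> ('i \<Rightarrow> 'o) \<Rightarrow> ('i \<Rightarrow> 'i \<Rightarrow> 'm) \<Rightarrow>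
    'o \<Rightarrow> ('i \<Rightarrow> 'm) \<Rightarrow> bool"
  where "is_cocone C K r X x Q c \<longleftrightarrow> Q \<in> Obj C \<and> (\<forall>i \<in> K. c i \<in> Hom C (X i) Q) \<and>
    (\<forall>i \<in> K. \<forall>j \<in> K. (i, j) \<in> r \<longrightarrow> c j \<cdot>\<^bsub>C\<^esub> x i j = c i)"

definition is_colimit :: "('o, 'm) cat \<Rightarrow> 'i set \<Rightarrow> 'i rel \<Rightarrow> ('i \<Rightarrow> 'o) \<Rightarrow> ('i \<Rightarrow> 'i \<Rightarrow> 'm) \<Rightarrow>
    'o \<Rightarrow> ('i \<Rightarrow> 'm) \<Rightarrow> bool"
  where "is_colimit C K r X x Q c \<longleftrightarrow> is_cocone C K r X x Q c \<and>
    (\<forall>Y u. is_cocone C K r X x Y u \<longrightarrow>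
      (\<exists>!h. h \<in> Hom C Q Y \<and> (\<forall>i \<in> K. h \<cdot>\<^bsub>C\<^esub> c i = u i)))"

definition immediate_succ :: "'i rel \<Rightarrow> 'i \<Rightarrow> 'i \<Rightarrow> bool"
  where "immediate_succ r i j \<longleftrightarrow>
    (i, j) \<in> r \<and> i \<noteq> j \<and> (\<forall>k. (i, k) \<in> r \<and> k \<noteq> i \<longrightarrow> (j, k) \<in> r)"

definition limit_elem :: "'i rel \<Rightarrow> 'i \<Rightarrow> bool"
  where "limit_elem r j \<longleftrightarrow> j \<in> Field r \<and> underS r j \<noteq> {} \<and> (\<nexists>i. immediate_succ r i j)"

text \<open>A \<open>\<lambda>\<close>-sequence for the ordinal \<open>\<lambda> > 0\<close> represented by the well-order \<open>r\<close>: a diagram that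
  preserves colimits at limit elements.\<close>

definition transfinite_sequence ::
    "('o, 'm) cat \<Rightarrow> 'i rel \<Rightarrow> ('i \<Rightarrow> 'o) \<Rightarrow> ('i \<Rightarrow> 'i \<Rightarrow> 'm) \<Rightarrow> bool"
  where "transfinite_sequence C r X x \<longleftrightarrow>
    Well_order r \<and> Field r \<noteq> {} \<and> is_diagram C (Field r) r X x \<and>
    (\<forall>j. limit_elem r j \<longrightarrow> is_colimit C (underS r j) r X x (X j) (\<lambda>i. x i j))"


section \<open>Topological spaces\<close>

text \<open>HOL has no type of all sets, so the type \<open>'u\<close> plays the role of a universe: a space is a
  topology on a subset of \<open>'u\<close> of cardinality strictly below that of \<open>'u\<close>, and coproducts and
  transfinite compositions are indexed by such sets. The type \<open>'u\<close> is required to be regular and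
  closed under \<open>A \<mapsto> A\<^sup>\<real>\<close>. This holds when the cardinality of \<open>'u\<close> is strongly inaccessible
  and uncountable, so that small sets amount to a Grothendieck universe; unlike inaccessibility it is
  also satisfiable without axioms beyond HOL.
  Euclidean spaces are transported to \<open>'u\<close> along an arbitrary injection \<open>e\<close>.\<close>

definition small :: "'u set \<Rightarrow> bool"
  where "small A \<longleftrightarrow> A \<prec> (UNIV :: 'u set)"

locale universe =
  fixes e :: "(nat \<Rightarrow> real) \<Rightarrow> 'u"
  assumes inj_e: "inj e"
    and small_UN: "\<And>(A :: 'u set) (B :: 'u \<Rightarrow> 'u set).
      small A \<Longrightarrow> (\<And>a. a \<in> A \<Longrightarrow> small (B a)) \<Longrightarrow> small (\<Union>a\<in>A. B a)"
    and small_power: "\<And>A :: 'u set. small A \<Longrightarrow> (UNIV :: real set) \<rightarrow>\<^sub>E A \<prec> (UNIV :: 'u set)"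

type_synonym 'u top_map = "('u topology, 'u \<Rightarrow> 'u) arrow"

definition Top :: "('u topology, 'u top_map) cat"
  where "Top =
    \<lparr>Obj = {X. small (topspace X)},
     Arr = {f. small (topspace (src f)) \<and> small (topspace (tgt f)) \<and>
       mor f \<in> extensional (topspace (src f)) \<and> continuous_map (src f) (tgt f) (mor f)},
     Dom = src,
     Cod = tgt,
     Idn = (\<lambda>X. Arrow X X (\<lambda>x \<in> topspace X. x)),
     Comp = (\<lambda>g f. Arrow (src f) (tgt g) (compose (topspace (src f)) (mor g) (mor f)))\<rparr>"

definition transport :: "('a \<Rightarrow> 'u) \<Rightarrow> 'a topology \<Rightarrow> 'u topology"
  where "transport e X = pullback_topology (e ` topspace X) (inv e) X"

definition disc :: "nat \<Rightarrow> (nat \<Rightarrow> real) topology"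
  where "disc n = subtopology (Euclidean_space n) {x. (\<Sum>i<n. (x i)\<^sup>2) \<le> 1}"

text \<open>The sphere of dimension \<open>n - 1\<close>; empty for \<open>n = 0\<close>.\<close>

definition bdry_sphere :: "nat \<Rightarrow> (nat \<Rightarrow> real) topology"
  where "bdry_sphere n = subtopology (Euclidean_space n) {x. (\<Sum>i<n. (x i)\<^sup>2) = 1}"

definition sphere_inclusion :: "((nat \<Rightarrow> real) \<Rightarrow> 'u) \<Rightarrow> nat \<Rightarrow> 'u top_map"
  where "sphere_inclusion e n =
    Arrow (transport e (bdry_sphere n)) (transport e (disc n)) (\<lambda>x \<in> e ` topspace (bdry_sphere n). x)"

definition sphere_inclusions :: "((nat \<Rightarrow> real) \<Rightarrow> 'u) \<Rightarrow> 'u top_map set"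
  where "sphere_inclusions e = range (sphere_inclusion e)"

text \<open>A set of objects of a category regarded as a discrete category over it.\<close>

definition discrete_inclusion :: "('o, 'm) cat \<Rightarrow> ('o, 'o, 'o, 'm) ftor"
  where "discrete_inclusion C = \<lparr>FObj = (\<lambda>x. x), FArr = Idn C\<rparr>"

inductive_set cell :: "'u top_map set \<Rightarrow> 'u top_map set" for J :: "'u top_map set"
  where
    gen: "f \<in> J \<Longrightarrow> f \<in> cell J"
  | coproduct: "\<lbrakk>small (I :: 'u set); \<And>i. i \<in> I \<Longrightarrow> f i \<in> cell J;
      is_coproduct Top I (\<lambda>i. Dom Top (f i)) P \<iota>; is_coproduct Top I (\<lambda>i. Cod Top (f i)) Q \<kappa>;
      g \<in> Hom Top P Q; \<And>i. i \<in> I \<Longrightarrow> g \<cdot>\<^bsub>Top\<^esub> \<iota> i = \<kappa> i \<cdot>\<^bsub>Top\<^esub> f i\<rbrakk> \<Longrightarrow> g \<in> cell J"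
  | pushout: "\<lbrakk>f \<in> cell J; is_pushout Top f u v g\<rbrakk> \<Longrightarrow> g \<in> cell J"
  | transfinite: "\<lbrakk>small (Field (r :: 'u rel)); transfinite_sequence Top r X x;
      \<And>i j. immediate_succ r i j \<Longrightarrow> x i j \<in> cell J;
      is_colimit Top (Field r) r X x Q c;
      z \<in> Field r; \<And>i. i \<in> Field r \<Longrightarrow> (z, i) \<in> r\<rbrakk> \<Longrightarrow> c z \<in> cell J"


section \<open>Well-definedness\<close>

lemma category_arrow_cat:
  assumes "category C"
  shows "category (arrow_cat C)"
proof -
  interpret category C by fact
  have A: "x \<in> Hom C (Dom C x) (Cod C x)" if "x \<in> Arr C" for x
    using that by (simp add: Hom_def)
  show ?thesis
  proof
    fix f assume "f \<in> Arr (arrow_cat C)"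
    then show "Dom (arrow_cat C) f \<in> Obj (arrow_cat C)" "Cod (arrow_cat C) f \<in> Obj (arrow_cat C)"
      by (auto simp: arrow_cat_def)
  next
    fix X assume "X \<in> Obj (arrow_cat C)"
    then show "Idn (arrow_cat C) X \<in> Hom (arrow_cat C) X X"
      by (auto simp: arrow_cat_def Hom_def[of "\<lparr>Obj = _, Arr = _, Dom = _, Cod = _, Idn = _, Comp = _\<rparr>"]
        Idn_Hom Dom_Obj Cod_Obj Comp_Idn[OF A] Idn_Comp[OF A])
  next
    fix f g X Y Z assume f: "f \<in> Hom (arrow_cat C) X Y" and g: "g \<in> Hom (arrow_cat C) Y Z"
    have X: "X \<in> Hom C (Dom C X) (Cod C X)" and Y: "Y \<in> Hom C (Dom C Y) (Cod C Y)"
     and Z: "Z \<in> Hom C (Dom C Z) (Cod C Z)"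
     and f1: "fst (mor f) \<in> Hom C (Dom C X) (Dom C Y)" and f2: "snd (mor f) \<in> Hom C (Cod C X) (Cod C Y)"
     and g1: "fst (mor g) \<in> Hom C (Dom C Y) (Dom C Z)" and g2: "snd (mor g) \<in> Hom C (Cod C Y) (Cod C Z)"
     and fe: "Y \<cdot>\<^bsub>C\<^esub> fst (mor f) = snd (mor f) \<cdot>\<^bsub>C\<^esub> X" and ge: "Z \<cdot>\<^bsub>C\<^esub> fst (mor g) = snd (mor g) \<cdot>\<^bsub>C\<^esub> Y"
      and s: "src f = X" "tgt g = Z"
      using f g by (auto simp: arrow_cat_def Hom_def)
    have "Z \<cdot>\<^bsub>C\<^esub> (fst (mor g) \<cdot>\<^bsub>C\<^esub> fst (mor f)) = (snd (mor g) \<cdot>\<^bsub>C\<^esub> snd (mor f)) \<cdot>\<^bsub>C\<^esub> X"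
      using Comp_assoc[OF f1 g1 Z] Comp_assoc[OF f1 Y g2] Comp_assoc[OF X f2 g2] fe ge by simp
    moreover note Comp_Hom[OF f1 g1] Comp_Hom[OF f2 g2]
    ultimately show "g \<cdot>\<^bsub>arrow_cat C\<^esub> f \<in> Hom (arrow_cat C) X Z"
      using f g unfolding arrow_cat_def Hom_def by auto
  next
    fix f X Y assume f: "f \<in> Hom (arrow_cat C) X Y"
    have f1: "fst (mor f) \<in> Hom C (Dom C X) (Dom C Y)" and f2: "snd (mor f) \<in> Hom C (Cod C X) (Cod C Y)"
      and s: "src f = X" "tgt f = Y"
      using f by (auto simp: arrow_cat_def Hom_def)
    show "f \<cdot>\<^bsub>arrow_cat C\<^esub> Idn (arrow_cat C) X = f" "Idn (arrow_cat C) Y \<cdot>\<^bsub>arrow_cat C\<^esub> f = f"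
      by (simp_all add: arrow_cat_def s Comp_Idn[OF f1] Comp_Idn[OF f2] Idn_Comp[OF f1] Idn_Comp[OF f2])
        (use s in \<open>simp_all add: arrow.expand\<close>)
  next
    fix f g h W X Y Z
    assume "f \<in> Hom (arrow_cat C) W X" "g \<in> Hom (arrow_cat C) X Y" "h \<in> Hom (arrow_cat C) Y Z"
    then show "h \<cdot>\<^bsub>arrow_cat C\<^esub> g \<cdot>\<^bsub>arrow_cat C\<^esub> f = h \<cdot>\<^bsub>arrow_cat C\<^esub> (g \<cdot>\<^bsub>arrow_cat C\<^esub> f)"
      by (auto simp: arrow_cat_def Hom_def intro!: Comp_assoc)
  qed
qed

lemma category_Top: "category Top"
proof
  fix f g and X Y Z :: "'a topology" assume "f \<in> Hom Top X Y" "g \<in> Hom Top Y Z"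
  then show "g \<cdot>\<^bsub>Top\<^esub> f \<in> Hom Top X Z"
    by (auto simp: Top_def Hom_def compose_def extensional_def o_def
      intro: continuous_map_eq[OF continuous_map_compose])
next
  fix X :: "'a topology" assume "X \<in> Obj Top"
  then show "Idn Top X \<in> Hom Top X X"
    by (auto simp: Top_def Hom_def intro: continuous_map_eq[OF continuous_map_id])
next
  fix f and X Y :: "'a topology" assume "f \<in> Hom Top X Y"
  then show "f \<cdot>\<^bsub>Top\<^esub> Idn Top X = f" "Idn Top Y \<cdot>\<^bsub>Top\<^esub> f = f"
    by (auto simp: Top_def Hom_def compose_def extensional_def continuous_map_def
      intro!: arrow.expand ext)
next
  fix f g h and W X Y Z :: "'a topology" assume "f \<in> Hom Top W X" "g \<in> Hom Top X Y" "h \<in> Hom Top Y Z"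
  then show "h \<cdot>\<^bsub>Top\<^esub> g \<cdot>\<^bsub>Top\<^esub> f = h \<cdot>\<^bsub>Top\<^esub> (g \<cdot>\<^bsub>Top\<^esub> f)"
    by (auto simp: Top_def Hom_def compose_def extensional_def continuous_map_def intro!: ext)
qed (auto simp: Top_def)

lemma homeomorphic_transport:
  assumes "inj e"
  shows "homeomorphic_map X (transport e X) e"
proof -
  have i: "inv e (e x) = x" for x by (simp add: assms)
  have t: "topspace (transport e X) = e ` topspace X"
    by (auto simp: transport_def topspace_pullback_topology i)
  have "homeomorphic_maps X (transport e X) e (inv e)"
    unfolding homeomorphic_maps_def
  proof (intro conjI)
    show "continuous_map X (transport e X) e"
      unfolding transport_def
      by (rule continuous_map_pullback') (auto simp: o_def i)
    show "continuous_map (transport e X) X (inv e)"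
      unfolding transport_def
      using continuous_map_pullback[OF continuous_map_id, of _ "inv e" X] by (simp add: o_def id_def)
  qed (auto simp: t i)
  then show ?thesis using homeomorphic_maps_map by blast
qed


lemma small_transport:
  fixes e :: "(nat \<Rightarrow> real) \<Rightarrow> 'u"
  assumes "universe e"
  shows "small (topspace (transport e X))"
proof -
  interpret universe e by fact
  define a b where "a = e (\<lambda>_. 0)" and "b = e (\<lambda>_. 1)"
  then have ab: "a \<noteq> b" using inj_e by (metis injD zero_neq_one)
  have U: "infinite (UNIV ::  'u set)"
  proof
    assume "finite (UNIV ::  'u set)"
    then have "finite (range e)" by (rule finite_subset[OF subset_UNIV])
    then have "finite (UNIV :: (nat \<Rightarrow> real) set)" by (rule finite_imageD[OF _ inj_e])
    then have "finite (UNIV :: real set)" by (rule finite_fun_UNIVD2)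
    then show False by (simp add: infinite_UNIV_char_0)
  qed
  have "small {a, b}"
    unfolding small_def using U by (intro finite_lesspoll_infinite) auto
  then have p: "(UNIV :: real set) \<rightarrow>\<^sub>E {a, b} \<prec> (UNIV ::  'u set)" by (rule small_power)
  define q where "q p = real (to_nat p)" for p :: "nat \<times> rat"
  have q: "inj q" by (auto simp: q_def inj_def)
  define g where "g v = (\<lambda>t. if \<exists>n (r::rat). t = q (n, r) \<and> real_of_rat r < v n then a else b)" for v :: "nat \<Rightarrow> real"
  have "inj g"
  proof
    fix v w assume e: "g v = g w"
    have "real_of_rat r < v n \<longleftrightarrow> real_of_rat r < w n" for n r
    proof -
      have "g u (q (n, r)) = (if real_of_rat r < u n then a else b)" for u
        using injD[OF q] by (fastforce simp: g_def)
      then show ?thesis using fun_cong[OF e, of "q (n, r)"] ab by (simp split: if_splits)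
    qed
    then have "v n = w n" for n
      by (meson of_rat_dense less_asym linorder_neqE_linordered_idom)
    then show "v = w" by blast
  qed
  moreover have "range g \<subseteq> (UNIV :: real set) \<rightarrow>\<^sub>E {a, b}"
  proof -
    have "g v t \<in> {a, b}" for v t by (cases "\<exists>n (r::rat). t = q (n, r) \<and> real_of_rat r < v n") (simp_all only: g_def if_True if_False, simp_all)
    then show ?thesis by (fastforce simp only: PiE_UNIV_domain Pi_iff)
  qed
  ultimately have "(UNIV :: (nat \<Rightarrow> real) set) \<lesssim> (UNIV :: real set) \<rightarrow>\<^sub>E {a, b}"
    unfolding lepoll_def by blast
  moreover have "topspace (transport e X) \<lesssim> (UNIV :: (nat \<Rightarrow> real) set)"
  proof (rule lepoll_trans)
    show "topspace (transport e X) \<lesssim> range e"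
      by (rule subset_imp_lepoll) (auto simp: transport_def topspace_pullback_topology)
  qed (rule image_lepoll)
  ultimately show ?thesis
    unfolding small_def using p by (meson lesspoll_trans1)
qed

lemma sphere_inclusions_Arr:
  assumes "universe e"
  shows "sphere_inclusions e \<subseteq> Arr Top"
proof -
  interpret universe e by fact
  note small_transport = small_transport[OF assms]
  have "sphere_inclusion e n \<in> Arr Top" for n
  proof -
    have i: "inv e (e x) = x" for x by (simp add: inj_e)
    have t: "topspace (transport e X) = e ` topspace X" for X
      by (auto simp: transport_def topspace_pullback_topology i)
    have s: "subtopology (disc n) {x. (\<Sum>i<n. (x i)\<^sup>2) = 1} = bdry_sphere n"
      unfolding disc_def bdry_sphere_def subtopology_subtopology
      by (rule arg_cong[where f = "subtopology _"]) auto
    have "continuous_map (bdry_sphere n) (disc n) (\<lambda>x. x)"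
      unfolding s[symmetric] by (rule continuous_map_from_subtopology) (simp add: continuous_map_id[unfolded id_def])
    then have "continuous_map (transport e (bdry_sphere n)) (transport e (disc n)) (e \<circ> (\<lambda>x. x) \<circ> inv e)"
      using homeomorphic_transport[OF inj_e]
      unfolding homeomorphic_map_maps
      by (metis continuous_map_compose continuous_map_pullback continuous_map_id homeomorphic_imp_continuous_map homeomorphic_map_maps homeomorphic_transport inj_e o_assoc transport_def id_comp)
    then have "continuous_map (transport e (bdry_sphere n)) (transport e (disc n))
       (\<lambda>x \<in> e ` topspace (bdry_sphere n). x)"
      by (rule continuous_map_eq) (auto simp: t i)
    then show ?thesis by (simp add: Top_def sphere_inclusion_def small_transport t) (metis small_transport t)
  qed
  then show ?thesis by (auto simp: sphere_inclusions_def)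
qed

lemma is_functor_discrete_inclusion:
  assumes "category C" "S \<subseteq> Obj C"
  shows "is_functor (discrete_cat S) C (discrete_inclusion C)"
proof -
  interpret category C by fact
  have "category (discrete_cat S)" by standard (auto simp: discrete_cat_def Hom_def)
  then show ?thesis using assms Idn_Hom Idn_Comp[OF Idn_Hom]
    by (auto simp: is_functor_def discrete_inclusion_def) (auto simp: discrete_cat_def Hom_def)
qed

end

theory Submission
  imports Defs
begin

text \<open>The hypothesis of freeness is used once. A free system \<open>A\<close> admits a morphism to every system in
  which the sphere inclusions carry left map structures, and such a morphism pushes left map
  structures forward (\<open>free_awfs_left_map\<close>). It therefore suffices to exhibit a single algebraic
  weak factorisation system on \<open>Top\<close> for which the sphere inclusions are left maps and every left
  map is a relative cell complex.

  That system, \<open>cell_awfs\<close>, factors \<open>f : X \<rightarrow> Y\<close> through the space \<open>cell_space f\<close> obtained from \<open>X\<close>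
  by attaching a cell \<open>(n, a, b)\<close> for every continuous attaching map \<open>a\<close> of the \<open>(n - 1)\<close>-sphere
  into a subcomplex that is already present and every continuous extension \<open>b\<close>, over the \<open>n\<close>-disc,
  of the resulting map to \<open>Y\<close>. A point is either a point of \<open>X\<close> or an interior point of a cell,
  and the attaching map of a cell is in turn a function into points: points are well-founded
  trees. The closure properties of the universe give a bijection between \<open>'u\<close> and the trees
  labelled by \<open>'u\<close> (\<open>bij_tree\<close>), so that \<open>'u\<close> itself serves as the set of trees, with recursion
  and induction.

  Let \<open>L f : X \<rightarrow> cell_space f\<close> and \<open>R f : cell_space f \<rightarrow> Y\<close> be the two factors. Call a map
  \<open>F : cell_space f \<rightarrow> cell_space g\<close> cellular if it sends the cell \<open>(n, a, b)\<close> with characteristic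
  map \<open>c\<close> to the cell \<open>(n, F \<circ> a, R g \<circ> F \<circ> c)\<close>. Every commutative square from \<open>L f\<close> to \<open>R g\<close> has
  exactly one cellular filler: recursion on points constructs it, induction on points shows that
  it is unique. This property alone yields an algebraic weak factorisation system. The functor,
  the comultiplication and the multiplication are fillers, and each axiom compares two cellular
  fillers of one square (locale \<open>filler_factorisation\<close>).

  Let \<open>\<alpha> : Y \<rightarrow> cell_space f\<close> be a coalgebra structure for this system. Its coassociativity law
  compares cells: if \<open>\<alpha> y\<close> is an interior point of the cell \<open>(n, a, b)\<close>, then the characteristic
  map of this cell is \<open>\<alpha> \<circ> b\<close>, so that the whole closed cell lies in the image of \<open>\<alpha>\<close>. Hence the
  image is a subcomplex (\<open>coalgebra_subcomplex\<close>). Subcomplexes are closed and carry the subspace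
  topology (\<open>weak_top_eq_subtopology\<close>), and \<open>R f\<close> is a left inverse of \<open>\<alpha>\<close>, so \<open>f\<close> is isomorphic
  to the inclusion of \<open>X\<close> in this subcomplex.

  Finally, a subcomplex is built from \<open>X\<close> by attaching its cells one at a time in transfinite
  order (\<open>subcomplex_cell\<close>). A cell can be attached only after the cells that its boundary meets.
  Instead of a well-order that refines this dependency, the proof shows by induction on cells that
  every cell lies in a family of cells that can be attached to an arbitrary subcomplex
  (\<open>attachable_closure\<close>).\<close>

section \<open>Algebraic weak factorisation systems from unique fillers\<close>

lemma Arr_arrow_cat_iff:
  "s \<in> Arr (arrow_cat C) \<longleftrightarrow> src s \<in> Arr C \<and> tgt s \<in> Arr C \<and>
     fst (mor s) \<in> Arr C \<and> Dom C (fst (mor s)) = Dom C (src s) \<and> Cod C (fst (mor s)) = Dom C (tgt s) \<and>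
     snd (mor s) \<in> Arr C \<and> Dom C (snd (mor s)) = Cod C (src s) \<and> Cod C (snd (mor s)) = Cod C (tgt s) \<and>
     tgt s \<cdot>\<^bsub>C\<^esub> fst (mor s) = snd (mor s) \<cdot>\<^bsub>C\<^esub> src s"
  by (auto simp: arrow_cat_def Hom_def)

lemma arrow_cat_sel [simp]:
  "Obj (arrow_cat C) = Arr C" "Dom (arrow_cat C) = src" "Cod (arrow_cat C) = tgt"
  "Idn (arrow_cat C) f = Arrow f f (Idn C (Dom C f), Idn C (Cod C f))"
  "t \<cdot>\<^bsub>arrow_cat C\<^esub> s = Arrow (src s) (tgt t)
     (fst (mor t) \<cdot>\<^bsub>C\<^esub> fst (mor s), snd (mor t) \<cdot>\<^bsub>C\<^esub> snd (mor s))"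
  by (simp_all add: arrow_cat_def)

lemma is_functor_id: "category C \<Longrightarrow> is_functor C C id_functor"
  by (auto simp: is_functor_def id_functor_def Hom_def)

lemma is_functor_comp:
  assumes "is_functor C D F" "is_functor D E G"
  shows "is_functor C E (G \<circ>\<^sub>F F)"
  using assms by (simp add: is_functor_def functor_comp_def Hom_def)

context category
begin

lemma comp_closed [simp]:
  assumes "f \<in> Arr C" "g \<in> Arr C" "Cod C f = Dom C g"
  shows "g \<cdot> f \<in> Arr C" "Dom C (g \<cdot> f) = Dom C f" "Cod C (g \<cdot> f) = Cod C g"
  using assms Comp_Hom[of f "Dom C f" "Cod C f" g "Cod C g"] by (auto simp: Hom_def)

lemma idn_closed [simp]:
  assumes "X \<in> Obj C"
  shows "Idn C X \<in> Arr C" "Dom C (Idn C X) = X" "Cod C (Idn C X) = X"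
  using Idn_Hom[OF assms] by (auto simp: Hom_def)

lemma comp_idn [simp]: "f \<in> Arr C \<Longrightarrow> Dom C f = X \<Longrightarrow> f \<cdot> Idn C X = f"
  and idn_comp [simp]: "f \<in> Arr C \<Longrightarrow> Cod C f = X \<Longrightarrow> Idn C X \<cdot> f = f"
  using Comp_Idn[of f "Dom C f" "Cod C f"] Idn_Comp[of f "Dom C f" "Cod C f"] by (auto simp: Hom_def)

lemma assoc [simp]:
  assumes "f \<in> Arr C" "g \<in> Arr C" "h \<in> Arr C" "Cod C f = Dom C g" "Cod C g = Dom C h"
  shows "(h \<cdot> g) \<cdot> f = h \<cdot> (g \<cdot> f)"
  using assms Comp_assoc[of f "Dom C f" "Cod C f" g "Cod C g" h "Cod C h"] by (simp add: Hom_def)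

declare Dom_Obj [simp] Cod_Obj [simp]

lemma category_arrow: "category (arrow_cat C)"
  by (rule category_arrow_cat) (rule category_axioms)

end

text \<open>In every algebraic weak factorisation system a square \<open>(u, v)\<close> from \<open>L f\<close> to \<open>R g\<close> has the
  canonical filler \<open>\<mu> g \<cdot> M (u, v) \<cdot> \<delta> f\<close>. The sets \<open>K f g\<close> describe these fillers without
  mentioning \<open>\<mu>\<close> and \<open>\<delta>\<close>, which are then recovered from them. In the application they consist of
  the cellular maps.\<close>

locale filler_factorisation = category C for C :: "('o, 'm) cat" (structure) +
  fixes L R :: "'m \<Rightarrow> 'm" and M :: "'m \<Rightarrow> 'o" and K :: "'m \<Rightarrow> 'm \<Rightarrow> 'm set"
  assumes L_closed [simp]: "f \<in> Arr C \<Longrightarrow> L f \<in> Arr C"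
    "f \<in> Arr C \<Longrightarrow> Dom C (L f) = Dom C f" "f \<in> Arr C \<Longrightarrow> Cod C (L f) = M f"
    and R_closed [simp]: "f \<in> Arr C \<Longrightarrow> R f \<in> Arr C"
    "f \<in> Arr C \<Longrightarrow> Dom C (R f) = M f" "f \<in> Arr C \<Longrightarrow> Cod C (R f) = Cod C f"
    and R_L [simp]: "f \<in> Arr C \<Longrightarrow> R f \<cdot> L f = f"
    and K_Arr: "F \<in> K f g \<Longrightarrow> F \<in> Arr C" "F \<in> K f g \<Longrightarrow> Dom C F = M f" "F \<in> K f g \<Longrightarrow> Cod C F = M g"
    and K_idn: "f \<in> Arr C \<Longrightarrow> Idn C (M f) \<in> K f f"
    and K_comp: "\<lbrakk>f \<in> Arr C; g \<in> Arr C; h \<in> Arr C; F \<in> K f g; G \<in> K g h\<rbrakk> \<Longrightarrow> G \<cdot> F \<in> K f h"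
    and K_unique: "\<lbrakk>f \<in> Arr C; g \<in> Arr C; F \<in> K f g; G \<in> K f g; F \<cdot> L f = G \<cdot> L f; R g \<cdot> F = R g \<cdot> G\<rbrakk> \<Longrightarrow> F = G"
    and K_exists: "\<lbrakk>f \<in> Arr C; g \<in> Arr C; u \<in> Arr C; Dom C u = Dom C f; Cod C u = M g;
      v \<in> Arr C; Dom C v = M f; Cod C v = Cod C g; R g \<cdot> u = v \<cdot> L f\<rbrakk>
      \<Longrightarrow> \<exists>F \<in> K f g. F \<cdot> L f = u \<and> R g \<cdot> F = v"
begin

lemma M_Obj [simp]: "f \<in> Arr C \<Longrightarrow> M f \<in> Obj C"
  by (metis L_closed(1,3) Cod_Obj)

text \<open>Compositions are normalised by associating to the right. This rule and its analogues below
  therefore occur also in a form with a further factor on the right.\<close>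

lemma R_L' [simp]: "f \<in> Arr C \<Longrightarrow> x \<in> Arr C \<Longrightarrow> Cod C x = Dom C f \<Longrightarrow> R f \<cdot> (L f \<cdot> x) = f \<cdot> x"
  using assoc[of x "L f" "R f"] by simp

definition fill :: "'m \<Rightarrow> 'm \<Rightarrow> 'm \<Rightarrow> 'm \<Rightarrow> 'm"
  where "fill f g u v = (SOME F. F \<in> K f g \<and> F \<cdot> L f = u \<and> R g \<cdot> F = v)"

lemma fill:
  assumes "f \<in> Arr C" "g \<in> Arr C" "u \<in> Arr C" "Dom C u = Dom C f" "Cod C u = M g"
    "v \<in> Arr C" "Dom C v = M f" "Cod C v = Cod C g" "R g \<cdot> u = v \<cdot> L f"
  shows "fill f g u v \<in> K f g" "fill f g u v \<cdot> L f = u" "R g \<cdot> fill f g u v = v"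
  using someI_ex[of "\<lambda>F. F \<in> K f g \<and> F \<cdot> L f = u \<and> R g \<cdot> F = v"] K_exists[OF assms]
  unfolding fill_def by blast+

text \<open>The three definitions that follow are the fillers of the squares
  \<open>(L g \<cdot> h, k \<cdot> R f) : L f \<rightarrow> R g\<close> for a square \<open>(h, k) : f \<rightarrow> g\<close>, \<open>(L (L f), 1) : L f \<rightarrow> R (L f)\<close>,
  and \<open>(1, R (R f)) : L (R f) \<rightarrow> R f\<close>.\<close>

definition Mmap :: "'m sq \<Rightarrow> 'm"
  where "Mmap s = fill (src s) (tgt s) (L (tgt s) \<cdot> fst (mor s)) (snd (mor s) \<cdot> R (src s))"

definition \<delta> :: "'m \<Rightarrow> 'm"
  where "\<delta> f = fill f (L f) (L (L f)) (Idn C (M f))"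

definition \<mu> :: "'m \<Rightarrow> 'm"
  where "\<mu> f = fill (R f) f (Idn C (M f)) (R (R f))"

lemma Mmap:
  assumes "s \<in> Arr (arrow_cat C)"
  shows "Mmap s \<in> K (src s) (tgt s)"
    "Mmap s \<cdot> L (src s) = L (tgt s) \<cdot> fst (mor s)"
    "R (tgt s) \<cdot> Mmap s = snd (mor s) \<cdot> R (src s)"
  unfolding Mmap_def using assms
  by (intro fill; simp add: Arr_arrow_cat_iff)+

lemma \<delta>:
  assumes [simp]: "f \<in> Arr C"
  shows "\<delta> f \<in> K f (L f)" "\<delta> f \<cdot> L f = L (L f)" "R (L f) \<cdot> \<delta> f = Idn C (M f)"
  unfolding \<delta>_def by (intro fill; simp)+

lemma \<mu>:
  assumes [simp]: "f \<in> Arr C"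
  shows "\<mu> f \<in> K (R f) f" "\<mu> f \<cdot> L (R f) = Idn C (M f)" "R f \<cdot> \<mu> f = R (R f)"
  unfolding \<mu>_def by (intro fill; simp)+

lemmas Mmap_closed [simp] = K_Arr[OF Mmap(1)]
lemmas \<delta>_closed [simp] = K_Arr[OF \<delta>(1)]
lemmas \<mu>_closed [simp] = K_Arr[OF \<mu>(1)]

lemma Mmap_L [simp]:
  assumes "Arrow f g (h, k) \<in> Arr (arrow_cat C)"
  shows "Mmap (Arrow f g (h, k)) \<cdot> L f = L g \<cdot> h"
    "R g \<cdot> Mmap (Arrow f g (h, k)) = k \<cdot> R f"
    and "x \<in> Arr C \<Longrightarrow> Cod C x = Dom C f \<Longrightarrow> Mmap (Arrow f g (h, k)) \<cdot> (L f \<cdot> x) = L g \<cdot> (h \<cdot> x)"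
    and "x \<in> Arr C \<Longrightarrow> Cod C x = M f \<Longrightarrow> R g \<cdot> (Mmap (Arrow f g (h, k)) \<cdot> x) = k \<cdot> (R f \<cdot> x)"
proof -
  note A = assms[unfolded Arr_arrow_cat_iff, simplified]
  show 1: "Mmap (Arrow f g (h, k)) \<cdot> L f = L g \<cdot> h" "R g \<cdot> Mmap (Arrow f g (h, k)) = k \<cdot> R f"
    using Mmap[OF assms] by auto
  show "Mmap (Arrow f g (h, k)) \<cdot> (L f \<cdot> x) = L g \<cdot> (h \<cdot> x)" if "x \<in> Arr C" "Cod C x = Dom C f"
    using assoc[of x "L f" "Mmap (Arrow f g (h, k))"] assoc[of x h "L g"] A that assms 1 by simp
  show "R g \<cdot> (Mmap (Arrow f g (h, k)) \<cdot> x) = k \<cdot> (R f \<cdot> x)" if "x \<in> Arr C" "Cod C x = M f"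
    using assoc[of x "Mmap (Arrow f g (h, k))" "R g"] assoc[of x "R f" k] A that assms 1 by simp
qed

lemma \<delta>_L [simp]:
  assumes "f \<in> Arr C"
  shows "\<delta> f \<cdot> L f = L (L f)" "R (L f) \<cdot> \<delta> f = Idn C (M f)"
    "x \<in> Arr C \<Longrightarrow> Cod C x = Dom C f \<Longrightarrow> \<delta> f \<cdot> (L f \<cdot> x) = L (L f) \<cdot> x"
    "x \<in> Arr C \<Longrightarrow> Cod C x = M f \<Longrightarrow> R (L f) \<cdot> (\<delta> f \<cdot> x) = x"
  using \<delta>[OF assms] assms assoc[of x "L f" "\<delta> f"] assoc[of x "\<delta> f" "R (L f)"] by simp_all

lemma \<mu>_L [simp]:
  assumes "f \<in> Arr C"
  shows "\<mu> f \<cdot> L (R f) = Idn C (M f)" "R f \<cdot> \<mu> f = R (R f)"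
    "x \<in> Arr C \<Longrightarrow> Cod C x = M f \<Longrightarrow> \<mu> f \<cdot> (L (R f) \<cdot> x) = x"
    "x \<in> Arr C \<Longrightarrow> Cod C x = M (R f) \<Longrightarrow> R f \<cdot> (\<mu> f \<cdot> x) = R (R f) \<cdot> x"
  using \<mu>[OF assms] assms assoc[of x "L (R f)" "\<mu> f"] assoc[of x "\<mu> f" "R f"] by simp_all

definition awfs_of :: "'m awfs_data"
  where "awfs_of =
    \<lparr>Lf = \<lparr>FObj = L, FArr = (\<lambda>s. Arrow (L (src s)) (L (tgt s)) (fst (mor s), Mmap s))\<rparr>,
     counit = (\<lambda>f. Arrow (L f) f (Idn C (Dom C f), R f)),
     comult = (\<lambda>f. Arrow (L f) (L (L f)) (Idn C (Dom C f), \<delta> f)),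
     Rf = \<lparr>FObj = R, FArr = (\<lambda>s. Arrow (R (src s)) (R (tgt s)) (Mmap s, snd (mor s)))\<rparr>,
     unit = (\<lambda>f. Arrow f (R f) (L f, Idn C (Cod C f))),
     mult = (\<lambda>f. Arrow (R (R f)) (R f) (\<mu> f, Idn C (Cod C f)))\<rparr>"

text \<open>The identity and, in the next lemma, a composite of fillers belong to \<open>K\<close>, so uniqueness of
  fillers gives functoriality. The naturality statements and the laws below are proved in the same
  way: both sides lie in \<open>K\<close>, and the two restrictions that determine a filler are computed by
  simplification.\<close>

lemma Mmap_idn:
  assumes [simp]: "f \<in> Arr C"
  shows "Mmap (Arrow f f (Idn C (Dom C f), Idn C (Cod C f))) = Idn C (M f)"
proof -
  have [simp]: "Arrow f f (Idn C (Dom C f), Idn C (Cod C f)) \<in> Arr (arrow_cat C)"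
    by (simp add: Arr_arrow_cat_iff)
  show ?thesis
    by (rule K_unique[of f f]) (use Mmap(1)[of "Arrow f f (Idn C (Dom C f), Idn C (Cod C f))"] in \<open>auto intro: K_idn\<close>)
qed

lemma Mmap_comp:
  assumes s: "s \<in> Arr (arrow_cat C)" and t: "t \<in> Arr (arrow_cat C)" and st: "tgt s = src t"
  shows "Mmap (t \<cdot>\<^bsub>arrow_cat C\<^esub> s) = Mmap t \<cdot> Mmap s"
proof -
  obtain f g h k where seq: "s = Arrow f g (h, k)" by (metis arrow.exhaust surj_pair)
  obtain g' i h' k' where teq: "t = Arrow g' i (h', k')" by (metis arrow.exhaust surj_pair)
  have g': "g' = g" using st seq teq by simp
  note A = s[unfolded seq] t[unfolded teq g']
  note B = A[unfolded Arr_arrow_cat_iff]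
  have C: "Arrow f i (h' \<cdot> h, k' \<cdot> k) \<in> Arr (arrow_cat C)"
    using category.comp_closed(1)[OF category_arrow, of s t] s t st by (simp add: seq teq)
  have "Mmap (Arrow f i (h' \<cdot> h, k' \<cdot> k)) = Mmap (Arrow g i (h', k')) \<cdot> Mmap (Arrow f g (h, k))"
  proof (rule K_unique[of f i])
    show "Mmap (Arrow g i (h', k')) \<cdot> Mmap (Arrow f g (h, k)) \<in> K f i"
      by (rule K_comp[of f g]) (use A B Mmap(1) in force)+
  qed (use A B C Mmap(1)[OF C] in auto)
  then show ?thesis by (simp add: seq teq g')
qed

lemma is_functor_L: "is_functor (arrow_cat C) (arrow_cat C) (Lf awfs_of)"
  and is_functor_R: "is_functor (arrow_cat C) (arrow_cat C) (Rf awfs_of)"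
proof -
  have 1: "Arrow (L (src s)) (L (tgt s)) (fst (mor s), Mmap s) \<in> Arr (arrow_cat C)"
    "Arrow (R (src s)) (R (tgt s)) (Mmap s, snd (mor s)) \<in> Arr (arrow_cat C)"
    if "s \<in> Arr (arrow_cat C)" for s
    using that Mmap[OF that] by (simp_all add: Arr_arrow_cat_iff[of "Arrow _ _ _"])
      (simp_all add: Arr_arrow_cat_iff)
  show "is_functor (arrow_cat C) (arrow_cat C) (Lf awfs_of)"
    "is_functor (arrow_cat C) (arrow_cat C) (Rf awfs_of)"
    using category_arrow 1 Mmap_comp
    by (auto simp: is_functor_def awfs_of_def Hom_def Mmap_idn)
qed

lemma \<epsilon>_Arr [simp]: "f \<in> Arr C \<Longrightarrow> Arrow (L f) f (Idn C (Dom C f), R f) \<in> Arr (arrow_cat C)"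
  and \<delta>_Arr [simp]: "f \<in> Arr C \<Longrightarrow> Arrow (L f) (L (L f)) (Idn C (Dom C f), \<delta> f) \<in> Arr (arrow_cat C)"
  and \<eta>_Arr [simp]: "f \<in> Arr C \<Longrightarrow> Arrow f (R f) (L f, Idn C (Cod C f)) \<in> Arr (arrow_cat C)"
  and \<mu>_Arr [simp]: "f \<in> Arr C \<Longrightarrow> Arrow (R (R f)) (R f) (\<mu> f, Idn C (Cod C f)) \<in> Arr (arrow_cat C)"
  and \<rho>_Arr [simp]: "f \<in> Arr C \<Longrightarrow> Arrow (L (R f)) (R (L f)) (\<delta> f, \<mu> f) \<in> Arr (arrow_cat C)"
  by (simp_all add: Arr_arrow_cat_iff)

lemma LR_Arr [simp]:
  assumes "Arrow f g (h, k) \<in> Arr (arrow_cat C)"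
  shows "Arrow (L f) (L g) (h, Mmap (Arrow f g (h, k))) \<in> Arr (arrow_cat C)"
    "Arrow (R f) (R g) (Mmap (Arrow f g (h, k)), k) \<in> Arr (arrow_cat C)"
  using assms Mmap_L[OF assms] Mmap_closed[OF assms] by (simp_all add: Arr_arrow_cat_iff)

lemma \<delta>_nat:
  assumes s: "Arrow f g (h, k) \<in> Arr (arrow_cat C)"
  shows "\<delta> g \<cdot> Mmap (Arrow f g (h, k)) = Mmap (Arrow (L f) (L g) (h, Mmap (Arrow f g (h, k)))) \<cdot> \<delta> f"
proof -
  note [simp] = s[unfolded Arr_arrow_cat_iff, simplified] s
  note [simp] = LR_Arr[OF s]
  show ?thesis
  proof (rule K_unique[of f "L g"])
    show "\<delta> g \<cdot> Mmap (Arrow f g (h, k)) \<in> K f (L g)"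
      by (rule K_comp[of f g]) (use Mmap(1)[OF s] \<delta>(1) in auto)
    show "Mmap (Arrow (L f) (L g) (h, Mmap (Arrow f g (h, k)))) \<cdot> \<delta> f \<in> K f (L g)"
      by (rule K_comp[of f "L f"]) (use Mmap(1)[OF LR_Arr(1)[OF s]] \<delta>(1) in auto)
  qed simp_all
qed

lemma \<mu>_nat:
  assumes s: "Arrow f g (h, k) \<in> Arr (arrow_cat C)"
  shows "\<mu> g \<cdot> Mmap (Arrow (R f) (R g) (Mmap (Arrow f g (h, k)), k)) = Mmap (Arrow f g (h, k)) \<cdot> \<mu> f"
proof -
  note [simp] = s[unfolded Arr_arrow_cat_iff, simplified] s
  note [simp] = LR_Arr[OF s]
  show ?thesis
  proof (rule K_unique[of "R f" g])
    show "\<mu> g \<cdot> Mmap (Arrow (R f) (R g) (Mmap (Arrow f g (h, k)), k)) \<in> K (R f) g"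
      by (rule K_comp[of "R f" "R g"]) (use Mmap(1)[OF LR_Arr(2)[OF s]] \<mu>(1) in auto)
    show "Mmap (Arrow f g (h, k)) \<cdot> \<mu> f \<in> K (R f) g"
      by (rule K_comp[of "R f" f]) (use Mmap(1)[OF s] \<mu>(1) in auto)
  qed simp_all
qed

lemma comonad_laws:
  assumes [simp]: "f \<in> Arr C"
  shows "Mmap (Arrow (L f) f (Idn C (Dom C f), R f)) \<cdot> \<delta> f = Idn C (M f)"
    "\<delta> (L f) \<cdot> \<delta> f = Mmap (Arrow (L f) (L (L f)) (Idn C (Dom C f), \<delta> f)) \<cdot> \<delta> f"
proof -
  have \<epsilon>: "Mmap (Arrow (L f) f (Idn C (Dom C f), R f)) \<in> K (L f) f"
    and \<delta>': "Mmap (Arrow (L f) (L (L f)) (Idn C (Dom C f), \<delta> f)) \<in> K (L f) (L (L f))"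
    using Mmap(1)[OF \<epsilon>_Arr[of f]] Mmap(1)[OF \<delta>_Arr[of f]] by simp_all
  show "Mmap (Arrow (L f) f (Idn C (Dom C f), R f)) \<cdot> \<delta> f = Idn C (M f)"
    using K_comp[OF _ _ _ \<delta>(1) \<epsilon>] by - (rule K_unique[of f f], auto intro: K_idn)
  show "\<delta> (L f) \<cdot> \<delta> f = Mmap (Arrow (L f) (L (L f)) (Idn C (Dom C f), \<delta> f)) \<cdot> \<delta> f"
    using K_comp[OF _ _ _ \<delta>(1) \<delta>'] K_comp[OF _ _ _ \<delta>(1) \<delta>(1), of f]
    by - (rule K_unique[of f "L (L f)"], auto)
qed

lemma monad_laws:
  assumes [simp]: "f \<in> Arr C"
  shows "\<mu> f \<cdot> Mmap (Arrow f (R f) (L f, Idn C (Cod C f))) = Idn C (M f)"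
    "\<mu> f \<cdot> \<mu> (R f) = \<mu> f \<cdot> Mmap (Arrow (R (R f)) (R f) (\<mu> f, Idn C (Cod C f)))"
proof -
  have \<eta>: "Mmap (Arrow f (R f) (L f, Idn C (Cod C f))) \<in> K f (R f)"
    and \<mu>': "Mmap (Arrow (R (R f)) (R f) (\<mu> f, Idn C (Cod C f))) \<in> K (R (R f)) (R f)"
    using Mmap(1)[OF \<eta>_Arr[of f]] Mmap(1)[OF \<mu>_Arr[of f]] by simp_all
  show "\<mu> f \<cdot> Mmap (Arrow f (R f) (L f, Idn C (Cod C f))) = Idn C (M f)"
    using K_comp[OF _ _ _ \<eta> \<mu>(1)] by - (rule K_unique[of f f], auto intro: K_idn)
  show "\<mu> f \<cdot> \<mu> (R f) = \<mu> f \<cdot> Mmap (Arrow (R (R f)) (R f) (\<mu> f, Idn C (Cod C f)))"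
    using K_comp[OF _ _ _ \<mu>' \<mu>(1)] K_comp[OF _ _ _ \<mu>(1) \<mu>(1), of f]
    by - (rule K_unique[of "R (R f)" f], auto)
qed

text \<open>The only law that mixes comultiplication and multiplication. The remaining parts of the
  distributive law reduce to the comonad and monad laws.\<close>

lemma \<delta>_\<mu>:
  assumes [simp]: "f \<in> Arr C"
  shows "\<delta> f \<cdot> \<mu> f = \<mu> (L f) \<cdot> (Mmap (Arrow (L (R f)) (R (L f)) (\<delta> f, \<mu> f)) \<cdot> \<delta> (R f))"
proof (rule K_unique[of "R f" "L f"])
  show "\<delta> f \<cdot> \<mu> f \<in> K (R f) (L f)"
    by (rule K_comp[of _ f]) (auto intro: \<delta>(1) \<mu>(1))
  show "\<mu> (L f) \<cdot> (Mmap (Arrow (L (R f)) (R (L f)) (\<delta> f, \<mu> f)) \<cdot> \<delta> (R f)) \<in> K (R f) (L f)"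
    by (rule K_comp[of _ "R (L f)"], simp, simp, simp, rule K_comp[of _ "L (R f)"])
      (auto intro: \<delta>(1) \<mu>(1) Mmap(1)[OF \<rho>_Arr, simplified])
qed simp_all

lemma nat_trans_arrow_catI:
  assumes "is_functor (arrow_cat C) (arrow_cat C) F" "is_functor (arrow_cat C) (arrow_cat C) G"
    and "\<And>f. f \<in> Arr C \<Longrightarrow> \<tau> f \<in> Arr (arrow_cat C) \<and> src (\<tau> f) = FObj F f \<and> tgt (\<tau> f) = FObj G f"
    and "\<And>f g h k. \<lbrakk>Arrow f g (h, k) \<in> Arr (arrow_cat C); f \<in> Arr C; g \<in> Arr C;
        h \<in> Arr C; Dom C h = Dom C f; Cod C h = Dom C g;
        k \<in> Arr C; Dom C k = Cod C f; Cod C k = Cod C g; g \<cdot> h = k \<cdot> f\<rbrakk> \<Longrightarrow>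
      \<tau> g \<cdot>\<^bsub>arrow_cat C\<^esub> FArr F (Arrow f g (h, k)) = FArr G (Arrow f g (h, k)) \<cdot>\<^bsub>arrow_cat C\<^esub> \<tau> f"
  shows "nat_trans (arrow_cat C) (arrow_cat C) F G \<tau>"
proof -
  have "\<tau> Y \<cdot>\<^bsub>arrow_cat C\<^esub> FArr F s = FArr G s \<cdot>\<^bsub>arrow_cat C\<^esub> \<tau> X" if "s \<in> Hom (arrow_cat C) X Y" for X Y s
  proof -
    obtain f g h k where s: "s = Arrow f g (h, k)" by (metis arrow.exhaust surj_pair)
    show ?thesis
      using that assms(4)[of f g h k] by (auto simp: s Hom_def Arr_arrow_cat_iff simp del: arrow_cat_sel(5))
  qed
  then show ?thesis using assms(1-3) by (simp add: nat_trans_def Hom_def)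
qed

lemma awfs_awfs_of: "awfs C awfs_of"
proof -
  let ?A = awfs_of
  let ?\<rho> = "\<lambda>f. Arrow (Lo ?A (Ro ?A f)) (Ro ?A (Lo ?A f)) (snd (mor (comult ?A f)), fst (mor (mult ?A f)))"
  note F = is_functor_id[OF category_arrow] is_functor_L is_functor_R
    is_functor_comp[OF is_functor_L is_functor_L] is_functor_comp[OF is_functor_R is_functor_R]
    is_functor_comp[OF is_functor_L is_functor_R] is_functor_comp[OF is_functor_R is_functor_L]
  note data = awfs_of_def id_functor_def functor_comp_def
  have 1: "nat_trans (arrow_cat C) (arrow_cat C) (Lf ?A) id_functor (counit ?A)"
    and 2: "nat_trans (arrow_cat C) (arrow_cat C) (Lf ?A) (Lf ?A \<circ>\<^sub>F Lf ?A) (comult ?A)"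
    and 3: "nat_trans (arrow_cat C) (arrow_cat C) id_functor (Rf ?A) (unit ?A)"
    and 4: "nat_trans (arrow_cat C) (arrow_cat C) (Rf ?A \<circ>\<^sub>F Rf ?A) (Rf ?A) (mult ?A)"
    and 5: "nat_trans (arrow_cat C) (arrow_cat C) (Lf ?A \<circ>\<^sub>F Rf ?A) (Rf ?A \<circ>\<^sub>F Lf ?A) ?\<rho>"
    by (rule nat_trans_arrow_catI, rule F, rule F, simp add: data, simp add: data \<delta>_nat \<mu>_nat)+
  have "comonad (arrow_cat C) (Lf ?A) (counit ?A) (comult ?A)"
    unfolding comonad_def using 1 2 by (simp add: data comonad_laws)
  moreover have "monad (arrow_cat C) (Rf ?A) (unit ?A) (mult ?A)"
    unfolding monad_def using 3 4 by (simp add: data monad_laws)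
  moreover have "functorial_factorisation C ?A"
    by (simp add: functorial_factorisation_def data)
  moreover have "distributive_law (arrow_cat C) (Lf ?A) (counit ?A) (comult ?A) (Rf ?A) (unit ?A) (mult ?A) ?\<rho>"
    unfolding distributive_law_def using 5 by (simp add: data comonad_laws monad_laws \<delta>_\<mu>)
  ultimately show ?thesis by (simp add: awfs_def)
qed

end

context filler_factorisation
begin

lemma left_map_structure_iff:
  "left_map_structure C awfs_of f \<alpha> \<longleftrightarrow>
     f \<in> Arr C \<and> \<alpha> \<in> Arr C \<and> Dom C \<alpha> = Cod C f \<and> Cod C \<alpha> = M f \<and>
     \<alpha> \<cdot> f = L f \<and> R f \<cdot> \<alpha> = Idn C (Cod C f) \<and>
     \<delta> f \<cdot> \<alpha> = Mmap (Arrow f (L f) (Idn C (Dom C f), \<alpha>)) \<cdot> \<alpha>"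
proof -
  have "Arrow f (L f) (Idn C (Dom C f), \<alpha>) \<in> Hom (arrow_cat C) f (L f) \<longleftrightarrow>
      f \<in> Arr C \<and> \<alpha> \<in> Arr C \<and> Dom C \<alpha> = Cod C f \<and> Cod C \<alpha> = M f \<and> \<alpha> \<cdot> f = L f"
    by (auto simp: Hom_def Arr_arrow_cat_iff)
  then show ?thesis
    unfolding left_map_structure_def LMap_def coalg_cat_def Let_def by (auto simp: awfs_of_def)
qed

end

section \<open>Pushing coalgebras forward\<close>

text \<open>A comonad morphism \<open>\<theta> : T \<rightarrow> T'\<close> turns a \<open>T\<close>-coalgebra \<open>s\<close> into the \<open>T'\<close>-coalgebra \<open>\<theta> \<cdot> s\<close>:
  coassociativity follows from compatibility of \<open>\<theta>\<close> with the comultiplications and naturality of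
  \<open>\<theta>\<close> at \<open>s\<close>.\<close>

lemma coalgebra_push:
  assumes mor: "comonad_morphism C T \<epsilon> \<delta> T' \<epsilon>' \<delta>' \<theta>"
    and co: "(X, s) \<in> Obj (coalg_cat C T \<epsilon> \<delta>)" and "comonad C T \<epsilon> \<delta>" "comonad C T' \<epsilon>' \<delta>'"
  shows "(X, \<theta> X \<cdot>\<^bsub>C\<^esub> s) \<in> Obj (coalg_cat C T' \<epsilon>' \<delta>')"
proof -
  have F: "is_functor C C T" "is_functor C C T'" "category C"
    and \<theta>: "\<theta> Y \<in> Hom C (FObj T Y) (FObj T' Y)" if "Y \<in> Obj C" for Y
    using mor that by (auto simp: comonad_morphism_def nat_trans_def is_functor_def)
  have \<theta>nat: "\<theta> Z \<cdot>\<^bsub>C\<^esub> FArr T f = FArr T' f \<cdot>\<^bsub>C\<^esub> \<theta> Y" if "f \<in> Hom C Y Z" for Y Z f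
    using mor that by (auto simp: comonad_morphism_def nat_trans_def)
  have X: "X \<in> Obj C" and s: "s \<in> Hom C X (FObj T X)" and e: "\<epsilon> X \<cdot>\<^bsub>C\<^esub> s = Idn C X"
    and d: "\<delta> X \<cdot>\<^bsub>C\<^esub> s = FArr T s \<cdot>\<^bsub>C\<^esub> s"
    using co by (auto simp: coalg_cat_def)
  interpret category C by (rule F(3)[OF X])
  have TX: "FObj T X \<in> Obj C" "FObj T' X \<in> Obj C"
    using F(1,2)[OF X] X by (auto simp: is_functor_def)
  have arr: "\<epsilon>' X \<in> Hom C (FObj T' X) X" "\<delta>' X \<in> Hom C (FObj T' X) (FObj T' (FObj T' X))"
    "\<delta> X \<in> Hom C (FObj T X) (FObj T (FObj T X))"
    using assms(3,4) X by (auto simp: comonad_def nat_trans_def id_functor_def functor_comp_def)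
  have T': "FArr T' f \<in> Hom C (FObj T' Y) (FObj T' Z)" and T: "FArr T f \<in> Hom C (FObj T Y) (FObj T Z)"
    if "f \<in> Hom C Y Z" for f Y Z
    using F(1,2)[OF X] that unfolding is_functor_def by (fastforce simp: Hom_def)+
  have T'comp: "FArr T' (g \<cdot>\<^bsub>C\<^esub> f) = FArr T' g \<cdot>\<^bsub>C\<^esub> FArr T' f"
    if "f \<in> Hom C W Y" "g \<in> Hom C Y Z" for f g W Y Z
    using F(2)[OF X] that unfolding is_functor_def by blast
  have \<theta>s: "\<theta> X \<cdot>\<^bsub>C\<^esub> s \<in> Hom C X (FObj T' X)"
    by (rule Comp_Hom[OF s \<theta>[OF X]])
  have m: "\<epsilon>' X \<cdot>\<^bsub>C\<^esub> \<theta> X = \<epsilon> X"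
    "\<delta>' X \<cdot>\<^bsub>C\<^esub> \<theta> X = (FArr T' (\<theta> X) \<cdot>\<^bsub>C\<^esub> \<theta> (FObj T X)) \<cdot>\<^bsub>C\<^esub> \<delta> X"
    using mor X by (auto simp: comonad_morphism_def)
  have "\<epsilon>' X \<cdot>\<^bsub>C\<^esub> (\<theta> X \<cdot>\<^bsub>C\<^esub> s) = Idn C X"
    using Comp_assoc[OF s \<theta>[OF X] arr(1)] m(1) e by simp
  moreover have "\<delta>' X \<cdot>\<^bsub>C\<^esub> (\<theta> X \<cdot>\<^bsub>C\<^esub> s) = FArr T' (\<theta> X \<cdot>\<^bsub>C\<^esub> s) \<cdot>\<^bsub>C\<^esub> (\<theta> X \<cdot>\<^bsub>C\<^esub> s)"
  proof -
    note T\<theta> = T'[OF \<theta>[OF X]]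
    note T\<theta>\<theta> = Comp_Hom[OF \<theta>[OF TX(1)] T\<theta>]
    have "\<delta>' X \<cdot>\<^bsub>C\<^esub> (\<theta> X \<cdot>\<^bsub>C\<^esub> s) = ((FArr T' (\<theta> X) \<cdot>\<^bsub>C\<^esub> \<theta> (FObj T X)) \<cdot>\<^bsub>C\<^esub> \<delta> X) \<cdot>\<^bsub>C\<^esub> s"
      using Comp_assoc[OF s \<theta>[OF X] arr(2)] m(2) by simp
    also have "\<dots> = (FArr T' (\<theta> X) \<cdot>\<^bsub>C\<^esub> \<theta> (FObj T X)) \<cdot>\<^bsub>C\<^esub> (FArr T s \<cdot>\<^bsub>C\<^esub> s)"
      using Comp_assoc[OF s arr(3) T\<theta>\<theta>] d by simp
    also have "\<dots> = FArr T' (\<theta> X) \<cdot>\<^bsub>C\<^esub> ((\<theta> (FObj T X) \<cdot>\<^bsub>C\<^esub> FArr T s) \<cdot>\<^bsub>C\<^esub> s)"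
      using Comp_assoc[OF Comp_Hom[OF s T[OF s]] \<theta>[OF TX(1)] T\<theta>] Comp_assoc[OF s T[OF s] \<theta>[OF TX(1)]] by simp
    also have "\<dots> = FArr T' (\<theta> X) \<cdot>\<^bsub>C\<^esub> (FArr T' s \<cdot>\<^bsub>C\<^esub> (\<theta> X \<cdot>\<^bsub>C\<^esub> s))"
      using Comp_assoc[OF s \<theta>[OF X] T'[OF s]] \<theta>nat[OF s] by simp
    also have "\<dots> = FArr T' (\<theta> X \<cdot>\<^bsub>C\<^esub> s) \<cdot>\<^bsub>C\<^esub> (\<theta> X \<cdot>\<^bsub>C\<^esub> s)"
      using Comp_assoc[OF \<theta>s T'[OF s] T\<theta>] T'comp[OF s \<theta>[OF X]] by simp
    finally show ?thesis .
  qed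
  ultimately show ?thesis using \<theta>s X by (simp add: coalg_cat_def)
qed

lemma left_map_structure_push:
  assumes "category C" and A: "awfs C A" and A': "awfs C A'" and \<xi>: "awfs_morphism C A A' \<xi>"
    and f: "left_map_structure C A f \<alpha>"
  shows "left_map_structure C A' f (\<xi> f \<cdot>\<^bsub>C\<^esub> \<alpha>)"
proof -
  interpret category C by fact
  have "f \<in> Arr C" using f by (simp add: left_map_structure_def LMap_def coalg_cat_def)
  moreover have "(f, Arrow (Lo A f) (Lo A' f) (Idn C (Dom C f), \<xi> f) \<cdot>\<^bsub>arrow_cat C\<^esub>
      Arrow f (Lo A f) (Idn C (Dom C f), \<alpha>)) \<in> Obj (LMap C A')"
    unfolding LMap_def
    by (rule coalgebra_push)
      (use \<xi> f A A' in \<open>auto simp: awfs_morphism_def awfs_def LMap_def left_map_structure_def\<close>)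
  ultimately show ?thesis by (simp add: left_map_structure_def)
qed

lemma category_coalg_cat:
  assumes T: "is_functor C C T"
  shows "category (coalg_cat C T \<epsilon> \<delta>)"
proof -
  interpret category C using T by (simp add: is_functor_def)
  have T': "FArr T f \<in> Hom C (FObj T X) (FObj T Y)" if "f \<in> Hom C X Y" for f X Y
    using T that unfolding is_functor_def by (fastforce simp: Hom_def)
  let ?K = "coalg_cat C T \<epsilon> \<delta>"
  have arr: "h \<in> Hom ?K X Y \<longleftrightarrow> X \<in> Obj ?K \<and> Y \<in> Obj ?K \<and> src h = X \<and> tgt h = Y \<and>
      mor h \<in> Hom C (fst X) (fst Y) \<and> snd Y \<cdot>\<^bsub>C\<^esub> mor h = FArr T (mor h) \<cdot>\<^bsub>C\<^esub> snd X" for h X Y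
    by (auto simp: coalg_cat_def Hom_def)
  have obj: "fst X \<in> Obj C" "snd X \<in> Hom C (fst X) (FObj T (fst X))" if "X \<in> Obj ?K" for X
    using that by (auto simp: coalg_cat_def)
  have sel: "Idn ?K X = Arrow X X (Idn C (fst X))"
    "k \<cdot>\<^bsub>?K\<^esub> h = Arrow (src h) (tgt k) (mor k \<cdot>\<^bsub>C\<^esub> mor h)" for X h k
    by (simp_all add: coalg_cat_def)
  show ?thesis
  proof
    fix h assume "h \<in> Arr ?K"
    then show "Dom ?K h \<in> Obj ?K" "Cod ?K h \<in> Obj ?K"
      by (auto simp: coalg_cat_def)
  next
    fix X assume X: "X \<in> Obj ?K"
    then have "FArr T (Idn C (fst X)) = Idn C (FObj T (fst X))"
      using obj T by (auto simp: is_functor_def)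
    then show "Idn ?K X \<in> Hom ?K X X"
      using X obj[OF X] Idn_Hom by (auto simp: arr sel Comp_Idn Idn_Comp)
  next
    fix h k X Y Z assume h: "h \<in> Hom ?K X Y" and k: "k \<in> Hom ?K Y Z"
    have X: "snd X \<in> Hom C (fst X) (FObj T (fst X))" and Y: "snd Y \<in> Hom C (fst Y) (FObj T (fst Y))"
      and Z: "snd Z \<in> Hom C (fst Z) (FObj T (fst Z))"
      and mh: "mor h \<in> Hom C (fst X) (fst Y)" and mk: "mor k \<in> Hom C (fst Y) (fst Z)"
      and eh: "snd Y \<cdot>\<^bsub>C\<^esub> mor h = FArr T (mor h) \<cdot>\<^bsub>C\<^esub> snd X" and ek: "snd Z \<cdot>\<^bsub>C\<^esub> mor k = FArr T (mor k) \<cdot>\<^bsub>C\<^esub> snd Y"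
      using h k obj by (auto simp: arr)
    have "snd Z \<cdot>\<^bsub>C\<^esub> (mor k \<cdot>\<^bsub>C\<^esub> mor h) = (FArr T (mor k) \<cdot>\<^bsub>C\<^esub> FArr T (mor h)) \<cdot>\<^bsub>C\<^esub> snd X"
      using Comp_assoc[OF mh mk Z] Comp_assoc[OF mh Y T'[OF mk]] Comp_assoc[OF X T'[OF mh] T'[OF mk]] eh ek
      by simp
    moreover have "FArr T (mor k \<cdot>\<^bsub>C\<^esub> mor h) = FArr T (mor k) \<cdot>\<^bsub>C\<^esub> FArr T (mor h)"
      using T mh mk unfolding is_functor_def by blast
    ultimately show "k \<cdot>\<^bsub>?K\<^esub> h \<in> Hom ?K X Z"
      using h k Comp_Hom[OF mh mk] by (simp add: arr sel)
  next
    fix h X Y assume "h \<in> Hom ?K X Y"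
    then show "h \<cdot>\<^bsub>?K\<^esub> Idn ?K X = h" "Idn ?K Y \<cdot>\<^bsub>?K\<^esub> h = h"
      by (auto simp: arr sel Comp_Idn Idn_Comp intro: arrow.expand)
  next
    fix h k l W X Y Z assume "h \<in> Hom ?K W X" "k \<in> Hom ?K X Y" "l \<in> Hom ?K Y Z"
    then show "l \<cdot>\<^bsub>?K\<^esub> k \<cdot>\<^bsub>?K\<^esub> h = l \<cdot>\<^bsub>?K\<^esub> (k \<cdot>\<^bsub>?K\<^esub> h)"
      by (auto simp: arr sel intro: Comp_assoc)
  qed
qed

text \<open>Left map structures on the generators form a functor from the discrete category, since a functor
  on a discrete category is determined by its values on objects. Freeness turns it into a morphism
  of systems, along which the structure on \<open>f\<close> is pushed.\<close>

lemma free_awfs_left_map: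
  assumes C: "category C" and free: "free_awfs C (discrete_cat S) (discrete_inclusion (arrow_cat C)) A"
    and A': "awfs C A'" and S: "\<And>j. j \<in> S \<Longrightarrow> left_map_structure C A' j (\<beta> j)"
    and f: "left_map_structure C A f \<alpha>"
  shows "\<exists>\<gamma>. left_map_structure C A' f \<gamma>"
proof -
  let ?s = "\<lambda>j. Arrow j (Lo A' j) (Idn C (Dom C j), \<beta> j)"
  let ?F = "\<lparr>FObj = (\<lambda>j. (j, ?s j)), FArr = (\<lambda>j. Idn (LMap C A') (j, ?s j))\<rparr>"
  have L: "is_functor (arrow_cat C) (arrow_cat C) (Lf A')"
    using A' by (auto simp: awfs_def comonad_def nat_trans_def)
  have S_cat: "category (discrete_cat S)" using free by (auto simp: free_awfs_def is_functor_def)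
  have K_cat: "category (LMap C A')" unfolding LMap_def by (rule category_coalg_cat[OF L])
  interpret K: category "LMap C A'" by (rule K_cat)
  have obj: "(j, ?s j) \<in> Obj (LMap C A')" "j \<in> Arr C" if "j \<in> S" for j
    using S[OF that] by (auto simp: left_map_structure_def LMap_def coalg_cat_def)
  have "is_functor (discrete_cat S) (LMap C A') ?F"
    using S_cat K_cat obj K.Idn_Hom K.Idn_Comp[OF K.Idn_Hom]
    by (simp add: is_functor_def) (auto simp: discrete_cat_def Hom_def)
  moreover have "functor_eq (discrete_cat S) (coalg_forget \<circ>\<^sub>F ?F) (discrete_inclusion (arrow_cat C))"
    by (simp add: functor_eq_def coalg_forget_def functor_comp_def discrete_inclusion_def)
      (simp add: LMap_def coalg_cat_def Let_def)
  ultimately have "functor_to_LMap C (discrete_cat S) (discrete_inclusion (arrow_cat C)) A' ?F"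
    by (simp add: functor_to_LMap_def)
  then obtain \<xi> where "awfs_morphism C A A' \<xi>"
    using free A' unfolding free_awfs_def by blast
  moreover have "awfs C A" using free by (simp add: free_awfs_def)
  ultimately show ?thesis using left_map_structure_push[OF C _ A' _ f] by blast
qed

section \<open>Trees over a universe\<close>

type_synonym point = "nat \<Rightarrow> real"

text \<open>\<open>Leaf x\<close> stands for the point \<open>x\<close> of the base space, and \<open>Node n a b d\<close> for the interior point
  \<open>d\<close> of the \<open>n\<close>-cell with attaching map \<open>a\<close> that lies over \<open>b\<close>. Restrictions on \<open>n\<close>, \<open>a\<close>, \<open>b\<close> and
  \<open>d\<close> are imposed later, by the inductive set of cells.\<close>

datatype 'u tree = Leaf 'u | Node nat "point \<Rightarrow> 'u tree" "point \<Rightarrow> 'u" point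

text \<open>A tree is coded by the family of its node labels. An address consists of a path from the root,
  the number of a field of the node that it leads to, and an argument, which matters only for the
  field \<open>b\<close>. Points are turned into labels by \<open>e\<close>, and field \<open>1\<close> separates leaves from other
  nodes.\<close>

primrec tree_code :: "(point \<Rightarrow> 'u) \<Rightarrow> 'u tree \<Rightarrow> point list \<times> nat \<times> point \<Rightarrow> 'u"
  where "tree_code e (Leaf x) = (\<lambda>(zs, i, y). if i = 0 then x else e (\<lambda>_. 0))"
  | "tree_code e (Node n a b d) = (\<lambda>(zs, i, y). case zs of
        [] \<Rightarrow> (if i = 0 then b y else if i = 1 then e (\<lambda>_. 1) else if i = 2 then e (\<lambda>_. real n) else e d)
      | z # zs \<Rightarrow> tree_code e (a z) (zs, i, y))"

lemma inj_tree_code: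
  assumes e: "inj e"
  shows "inj (tree_code e)"
proof -
  have 01: "e (\<lambda>_. 0) \<noteq> e (\<lambda>_. 1)" using e by (metis injD zero_neq_one)
  have "s = t" if "tree_code e s = tree_code e t" for s t
    using that
  proof (induction s arbitrary: t)
    case (Leaf x)
    show ?case
    proof (cases t)
      case (Leaf y)
      then show ?thesis using fun_cong[OF Leaf.prems, of "([], 0, \<lambda>_. 0)"] by simp
    next
      case (Node n a b d)
      then show ?thesis using fun_cong[OF Leaf.prems, of "([], 1, \<lambda>_. 0)"] 01 by simp
    qed
  next
    case (Node n a b d)
    show ?case
    proof (cases t)
      case (Leaf y)
      then show ?thesis using fun_cong[OF Node.prems, of "([], 1, \<lambda>_. 0)"] 01 by simp
    next
      case t: (Node n' a' b' d')
      have "b y = b' y" for y using fun_cong[OF Node.prems, of "([], 0, y)"] t by simp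
      moreover have "n = n'" using fun_cong[OF Node.prems, of "([], 2, \<lambda>_. 0)"] t e
        by (simp add: inj_eq fun_eq_iff)
      moreover have "d = d'" using fun_cong[OF Node.prems, of "([], 3, \<lambda>_. 0)"] t e
        by (simp add: inj_eq)
      moreover have "a z = a' z" for z
      proof (rule Node.IH)
        show "tree_code e (a z) = tree_code e (a' z)"
        proof
          fix q
          show "tree_code e (a z) q = tree_code e (a' z) q"
            using fun_cong[OF Node.prems, of "(z # fst q, snd q)"] t by (cases q) simp
        qed
      qed simp
      ultimately show ?thesis using t by auto
    qed
  qed
  then show ?thesis by (rule injI)
qed

lemma point_lepoll_real: "(UNIV :: point set) \<lesssim> (UNIV :: real set)"
proof -
  obtain g :: "real \<Rightarrow> nat set" where g: "inj g"
    using eqpoll_imp_lepoll[OF eqpoll_sym[OF nat_sets_eqpoll_reals]] by (auto simp: lepoll_def)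
  define h where "h v = {prod_encode (i, m) | i m. m \<in> g (v i)}" for v :: point
  have "inj h"
  proof
    fix v w assume "h v = h w"
    then have "prod_encode (i, m) \<in> h v \<longleftrightarrow> prod_encode (i, m) \<in> h w" for i m by simp
    then have "g (v i) = g (w i)" for i by (auto simp: h_def prod_encode_eq)
    then show "v = w" using g by (auto simp: inj_eq)
  qed
  then have "(UNIV :: point set) \<lesssim> (UNIV :: nat set set)" by (auto simp: lepoll_def)
  then show ?thesis using nat_sets_eqpoll_reals by (rule lepoll_trans2)
qed

text \<open>An address is a finite sequence of points together with a number and a further point, hence a
  doubly indexed family of reals.\<close>

lemma address_lepoll_real: "(UNIV :: (point list \<times> nat \<times> point) set) \<lesssim> (UNIV :: real set)"
proof -
  define h where "h = (\<lambda>(zs, i, y) p. case prod_decode p of (m, j) \<Rightarrow>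
    if m = 0 then real (length zs) else if m = 1 then real i else if m = 2 then y j
    else if m - 3 < length zs then (zs ! (m - 3)) j else 0)"
  have h: "h (zs, i, y) (prod_encode (m, j)) = (if m = 0 then real (length zs) else if m = 1 then real i
    else if m = 2 then y j else if m - 3 < length zs then (zs ! (m - 3)) j else 0)" for zs i y m j
    by (simp add: h_def)
  have "inj h"
  proof (rule injI)
    fix p p' assume hp: "h p = h p'"
    obtain zs i y zs' i' y' where p: "p = (zs, i, y)" "p' = (zs', i', y')" by (metis surj_pair)
    have "h (zs, i, y) = h (zs', i', y')" using hp p by simp
    then have e: "h (zs, i, y) (prod_encode (m, j)) = h (zs', i', y') (prod_encode (m, j))" for m j by simp
    have len: "length zs = length zs'" using e[of 0] by (simp add: h)
    have "zs ! m = zs' ! m" if "m < length zs" for m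
      using e[of "m + 3"] that len by (auto simp: h fun_eq_iff)
    moreover have "i = i'" using e[of 1] by (simp add: h)
    moreover have "y = y'" using e[of 2] by (simp add: h fun_eq_iff)
    ultimately show "p = p'" using len by (simp add: p list_eq_iff_nth_eq)
  qed
  then have "(UNIV :: (point list \<times> nat \<times> point) set) \<lesssim> (UNIV :: point set)" by (auto simp: lepoll_def)
  then show ?thesis using point_lepoll_real by (rule lepoll_trans)
qed

context universe
begin

lemma infinite_universe: "infinite (UNIV :: 'u set)"
proof
  assume "finite (UNIV :: 'u set)"
  then have "finite (range e)" by (rule finite_subset[OF subset_UNIV])
  then have "finite (UNIV :: point set)" by (rule finite_imageD[OF _ inj_e])
  then have "finite (UNIV :: real set)" by (rule finite_fun_UNIVD2)
  then show False by (simp add: infinite_UNIV_char_0)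
qed

lemma small_subset: "small (B :: 'u set) \<Longrightarrow> A \<subseteq> B \<Longrightarrow> small A"
  unfolding small_def by (metis subset_imp_lepoll lesspoll_trans1)

lemma small_finite: "finite (A :: 'u set) \<Longrightarrow> small A"
  unfolding small_def using infinite_universe by (rule finite_lesspoll_infinite)

lemma small_Un: "small (A :: 'u set) \<Longrightarrow> small B \<Longrightarrow> small (A \<union> B)"
proof -
  assume AB: "small A" "small B"
  obtain a b :: 'u where ab: "a \<noteq> b"
    using infinite_universe by (metis UNIV_eq_I finite.simps insertI1 singletonD)
  have "small (\<Union>c\<in>{a, b}. if c = a then A else B)"
    by (rule small_UN) (use AB small_finite in auto)
  then show "small (A \<union> B)" using ab by (simp add: insert_commute)
qed

lemma small_lepoll_real:
  assumes "(A :: 'u set) \<lesssim> (UNIV :: real set)"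
  shows "small A"
proof -
  have "small (topspace (transport e (Euclidean_space 1 :: point topology)))"
    by (rule small_transport) (rule universe_axioms)
  moreover have "(UNIV :: real set) \<lesssim> topspace (transport e (Euclidean_space 1 :: point topology))"
    unfolding lepoll_def
  proof (intro exI conjI)
    show "inj (\<lambda>t. e (\<lambda>i. if i = 0 then t else 0))"
    proof (rule injI)
      fix s t assume "e (\<lambda>i. if i = 0 then s else 0) = e (\<lambda>i. if i = 0 then t else 0)"
      then show "s = t" using injD[OF inj_e] fun_cong[where x = 0] by fastforce
    qed
    show "range (\<lambda>t. e (\<lambda>i. if i = 0 then t else 0)) \<subseteq> topspace (transport e (Euclidean_space 1))"
      using inj_e by (auto simp: transport_def topspace_pullback_topology topspace_Euclidean_space)
  qed
  ultimately show ?thesis using assms unfolding small_def by (meson lesspoll_trans1)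
qed

text \<open>Well-order the universe in its cardinal order, so that initial segments are small. By regularity
  the range of a function \<open>\<phi> : \<real> \<rightarrow> 'u\<close> lies below some \<open>x\<close>, and by closure under powers the
  functions into this initial segment can be coded by elements of \<open>'u\<close>. Thus \<open>\<phi>\<close> is determined by
  a pair of elements of \<open>'u\<close>.\<close>

lemma real_functions_lepoll: "(UNIV :: (real \<Rightarrow> 'u) set) \<lesssim> (UNIV :: 'u set)"
proof -
  define r where "r = card_of (UNIV :: 'u set)"
  have co: "Card_order r" "Field r = UNIV"
    unfolding r_def by (rule card_of_Card_order, rule Field_card_of)
  interpret wo: wo_rel r unfolding wo_rel_def r_def by (rule card_of_Well_order)
  have small: "small (underS r x)" for x
  proof -
    have "\<not> (UNIV :: 'u set) \<lesssim> underS r x"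
    proof
      assume "(UNIV :: 'u set) \<lesssim> underS r x"
      then have "(r, card_of (underS r x)) \<in> ordLeq"
        unfolding r_def lepoll_def by (rule iffD1[OF card_of_ordLeq])
      then show False
        using card_of_underS[OF co(1), of x] co(2) not_ordLess_ordLeq by (metis UNIV_I)
    qed
    then show ?thesis
      unfolding small_def lesspoll_def by (metis eqpoll_sym eqpoll_imp_lepoll subset_imp_lepoll subset_UNIV)
  qed
  \<comment> \<open>Regularity: the union of the initial segments up to the values of \<open>\<phi>\<close> is small, so it omits some \<open>x\<close>.\<close>
  have bdd: "\<exists>x. range \<phi> \<subseteq> underS r x" for \<phi> :: "real \<Rightarrow> 'u"
  proof -
    have "small (\<Union>y\<in>range \<phi>. underS r y \<union> {y})"
    proof (rule small_UN)
      show "small (range \<phi>)" by (rule small_lepoll_real) (rule image_lepoll)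
      show "small (underS r y \<union> {y})" for y by (intro small_Un small small_finite) simp
    qed
    then obtain x where x: "x \<notin> (\<Union>y\<in>range \<phi>. underS r y \<union> {y})"
      unfolding small_def lesspoll_def by (metis UNIV_eq_I eqpoll_refl)
    have "range \<phi> \<subseteq> underS r x"
    proof
      fix y assume y: "y \<in> range \<phi>"
      then have "(x, y) \<notin> r \<or> x = y" "x \<noteq> y" using x by (auto simp: underS_def)
      then show "y \<in> underS r x" using wo.TOTALS co(2) by (auto simp: underS_def)
    qed
    then show ?thesis by blast
  qed
  have "\<exists>i. inj_on i ((UNIV :: real set) \<rightarrow>\<^sub>E underS r x) \<and> i ` ((UNIV :: real set) \<rightarrow>\<^sub>E underS r x) \<subseteq> (UNIV :: 'u set)" for x
    using lesspoll_imp_lepoll[OF small_power[OF small[of x]]] unfolding lepoll_def by blast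
  then obtain i :: "'u \<Rightarrow> (real \<Rightarrow> 'u) \<Rightarrow> 'u" where i: "inj_on (i x) ((UNIV :: real set) \<rightarrow>\<^sub>E underS r x)" for x by metis
  obtain b :: "(real \<Rightarrow> 'u) \<Rightarrow> 'u" where b: "range \<phi> \<subseteq> underS r (b \<phi>)" for \<phi> using bdd by metis
  have "inj (\<lambda>\<phi>. (b \<phi>, i (b \<phi>) \<phi>))"
  proof (rule injI)
    fix \<phi> \<psi> assume "(b \<phi>, i (b \<phi>) \<phi>) = (b \<psi>, i (b \<psi>) \<psi>)"
    moreover have "\<phi> \<in> (UNIV :: real set) \<rightarrow>\<^sub>E underS r (b \<phi>)" for \<phi> using b[of \<phi>] by auto
    ultimately show "\<phi> = \<psi>" using inj_onD[OF i[of "b \<phi>"], of \<phi> \<psi>] by (metis prod.inject)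
  qed
  then have "(UNIV :: (real \<Rightarrow> 'u) set) \<lesssim> (UNIV :: ('u \<times> 'u) set)" by (auto simp: lepoll_def)
  also have "(UNIV :: ('u \<times> 'u) set) \<approx> (UNIV :: 'u set)"
    using card_of_Times_same_infinite[OF infinite_universe] by (simp add: eqpoll_iff_card_of_ordIso)
  finally show ?thesis .
qed

lemma tree_lepoll: "(UNIV :: 'u tree set) \<lesssim> (UNIV :: (real \<Rightarrow> 'u) set)"
proof -
  obtain k :: "point list \<times> nat \<times> point \<Rightarrow> real" where k: "inj k"
    using address_lepoll_real by (auto simp: lepoll_def)
  have "inj (\<lambda>t. tree_code e t \<circ> inv k)"
  proof (rule injI)
    fix s t assume "tree_code e s \<circ> inv k = tree_code e t \<circ> inv k"
    then have "tree_code e s \<circ> inv k \<circ> k = tree_code e t \<circ> inv k \<circ> k" by simp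
    then show "s = t" using inj_tree_code[OF inj_e] k by (simp add: o_assoc[symmetric] inj_eq)
  qed
  then show ?thesis by (auto simp: lepoll_def)
qed

lemma bij_tree: "\<exists>h :: 'u tree \<Rightarrow> 'u. bij h"
proof -
  have "(UNIV :: 'u tree set) \<lesssim> (UNIV :: 'u set)"
    using tree_lepoll real_functions_lepoll by (rule lepoll_trans)
  moreover have "inj (Leaf :: 'u \<Rightarrow> 'u tree)" by (simp add: inj_def)
  then have "(UNIV :: 'u set) \<lesssim> (UNIV :: 'u tree set)" by (auto simp: lepoll_def)
  ultimately have "(UNIV :: 'u tree set) \<approx> (UNIV :: 'u set)" by (rule lepoll_antisym)
  then show ?thesis by (simp add: eqpoll_def)
qed

text \<open>A bound on the labels of a set of trees bounds its cardinality; this makes \<open>cell_space\<close> an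
  object of \<open>Top\<close>.\<close>

lemma small_tree_image:
  assumes B: "small B" and P: "\<And>t q. t \<in> P \<Longrightarrow> tree_code e t q \<in> B"
  shows "small ((h :: 'u tree \<Rightarrow> 'u) ` P)"
proof -
  obtain k :: "point list \<times> nat \<times> point \<Rightarrow> real" where k: "inj k"
    using address_lepoll_real by (auto simp: lepoll_def)
  have "P \<lesssim> (UNIV :: real set) \<rightarrow>\<^sub>E B"
    unfolding lepoll_def
  proof (intro exI conjI)
    show "inj_on (\<lambda>t. tree_code e t \<circ> inv k) P"
    proof (rule inj_onI)
      fix s t assume "tree_code e s \<circ> inv k = tree_code e t \<circ> inv k"
      then have "tree_code e s \<circ> inv k \<circ> k = tree_code e t \<circ> inv k \<circ> k" by simp
      then show "s = t" using inj_tree_code[OF inj_e] k by (simp add: o_assoc[symmetric] inj_eq)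
    qed
    show "(\<lambda>t. tree_code e t \<circ> inv k) ` P \<subseteq> (UNIV :: real set) \<rightarrow>\<^sub>E B" using P 
      by (simp only: image_subset_iff PiE_UNIV_domain Pi_iff o_apply) (intro ballI P)
  qed
  then show ?thesis
    unfolding small_def using small_power[OF B] by (meson image_lepoll lepoll_trans lesspoll_trans1)
qed

end

section \<open>Points, cells and the weak topology\<close>

definition disk :: "nat \<Rightarrow> point set" where "disk n = topspace (disc n)"
definition rim :: "nat \<Rightarrow> point set" where "rim n = topspace (bdry_sphere n)"

text \<open>Of the geometry of discs and spheres the proof uses that the sphere is a closed subspace of the
  disc and that the disc has an interior point.\<close>

lemma bdry_sphere_eq: "bdry_sphere n = subtopology (disc n) (rim n)"
proof -
  have "rim n = {x. (\<Sum>i<n. (x i)\<^sup>2) = 1} \<inter> topspace (Euclidean_space n)"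
    by (auto simp: rim_def bdry_sphere_def)
  then have "subtopology (disc n) (rim n) = subtopology (Euclidean_space n)
      ({x. (\<Sum>i<n. (x i)\<^sup>2) \<le> 1} \<inter> ({x. (\<Sum>i<n. (x i)\<^sup>2) = 1} \<inter> topspace (Euclidean_space n)))"
    by (simp add: disc_def subtopology_subtopology)
  also have "{x. (\<Sum>i<n. (x i)\<^sup>2) \<le> 1} \<inter> ({x. (\<Sum>i<n. (x i)\<^sup>2) = 1} \<inter> topspace (Euclidean_space n))
      = topspace (Euclidean_space n) \<inter> {x. (\<Sum>i<n. (x i)\<^sup>2) = 1}"
    by auto
  finally show ?thesis
    by (simp add: bdry_sphere_def subtopology_restrict)
qed

lemma rim_subset: "rim n \<subseteq> disk n"
  by (auto simp: rim_def disk_def bdry_sphere_def disc_def)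

lemma rim_disk [simp, intro]: "x \<in> rim n \<Longrightarrow> x \<in> disk n"
  using rim_subset by blast

lemma closedin_rim: "closedin (disc n) (rim n)"
proof -
  have "continuous_map (disc n) euclideanreal (\<lambda>x. \<Sum>i<n. (x i)\<^sup>2)"
    unfolding disc_def Euclidean_space_def subtopology_subtopology
    by (intro continuous_map_from_subtopology continuous_intros continuous_map_product_projection) auto
  then have "closedin (disc n) {x \<in> topspace (disc n). (\<Sum>i<n. (x i)\<^sup>2) \<in> {1}}"
    by (rule closedin_continuous_map_preimage) auto
  also have "{x \<in> topspace (disc n). (\<Sum>i<n. (x i)\<^sup>2) \<in> {1}} = rim n"
    by (auto simp: rim_def bdry_sphere_def disc_def)
  finally show ?thesis .
qed

lemma origin: "(\<lambda>_. 0) \<in> disk n - rim n"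
  by (simp add: disk_def rim_def disc_def bdry_sphere_def topspace_Euclidean_space)

text \<open>A bijection in every universe, by \<open>bij_tree\<close>. The constructors of trees become functions
  \<open>base_pt\<close> and \<open>cell_pt\<close> on \<open>'u\<close>, so that spaces whose points are trees are objects of \<open>Top\<close>
  without further coding.\<close>

definition tree_pt :: "'u tree \<Rightarrow> 'u" where "tree_pt = (SOME h. bij h)"

definition base_pt :: "'u \<Rightarrow> 'u" where "base_pt x = tree_pt (Leaf x)"

definition cell_pt :: "nat \<Rightarrow> (point \<Rightarrow> 'u) \<Rightarrow> (point \<Rightarrow> 'u) \<Rightarrow> point \<Rightarrow> 'u"
  where "cell_pt n a b d = tree_pt (Node n (inv tree_pt \<circ> a) b d)"

text \<open>For the function \<open>\<phi>\<close> underlying a map \<open>f\<close>, this is the right factor of \<open>f\<close>.\<close>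

definition proj :: "('u \<Rightarrow> 'u) \<Rightarrow> 'u \<Rightarrow> 'u"
  where "proj \<phi> p = (case inv tree_pt p of Leaf x \<Rightarrow> \<phi> x | Node n a b d \<Rightarrow> b d)"

text \<open>The characteristic map of a cell; its values outside the disc carry no meaning.\<close>

definition char_map :: "nat \<Rightarrow> (point \<Rightarrow> 'u) \<Rightarrow> (point \<Rightarrow> 'u) \<Rightarrow> point \<Rightarrow> 'u"
  where "char_map n a b x = (if x \<in> rim n then a x else cell_pt n a b x)"

text \<open>The cellular map that extends \<open>g\<close> on the base and lies over \<open>H\<close>, that is, the filler of the
  square \<open>(g, H)\<close>.\<close>

primrec tree_fold :: "('u \<Rightarrow> 'u) \<Rightarrow> ('u \<Rightarrow> 'u) \<Rightarrow> 'u tree \<Rightarrow> 'u"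
  where "tree_fold g H (Leaf x) = g x"
  | "tree_fold g H (Node n a b d) = cell_pt n (\<lambda>x. if x \<in> rim n then tree_fold g H (a x) else undefined)
       (restrict (H \<circ> char_map n (tree_pt \<circ> a) b) (disk n)) d"

definition fold_points :: "('u \<Rightarrow> 'u) \<Rightarrow> ('u \<Rightarrow> 'u) \<Rightarrow> 'u \<Rightarrow> 'u"
  where "fold_points g H p = tree_fold g H (inv tree_pt p)"

text \<open>The dimension, the attaching map and the map to the codomain. Functions are extensional on the
  sphere and the disc, respectively, so that a cell is determined by its actual data.\<close>

type_synonym 'u cell_data = "nat \<times> (point \<Rightarrow> 'u) \<times> (point \<Rightarrow> 'u)"

definition points :: "'u topology \<Rightarrow> 'u cell_data set \<Rightarrow> 'u set"
  where "points X Q = base_pt ` topspace X \<union> {cell_pt n a b d | n a b d. (n, a, b) \<in> Q \<and> d \<in> disk n - rim n}"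

definition subcomplex :: "'u topology \<Rightarrow> 'u cell_data set \<Rightarrow> bool"
  where "subcomplex X Q \<longleftrightarrow> (\<forall>n a b x. (n, a, b) \<in> Q \<longrightarrow> x \<in> rim n \<longrightarrow> a x \<in> points X Q)"

text \<open>The final topology for \<open>base_pt\<close> and the characteristic maps of the cells in \<open>Q\<close>. If \<open>Q\<close> is not
  closed under boundaries, \<open>points X Q\<close> need not be open in it.\<close>

definition weak_top :: "'u topology \<Rightarrow> 'u cell_data set \<Rightarrow> 'u topology"
  where "weak_top X Q = topology (\<lambda>U. U \<subseteq> points X Q \<and> openin X {x \<in> topspace X. base_pt x \<in> U} \<and>
    (\<forall>n a b. (n, a, b) \<in> Q \<longrightarrow> openin (disc n) {x \<in> disk n. char_map n a b x \<in> U}))"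

text \<open>A cell may be attached along any map that is continuous into a subcomplex formed by cells
  generated before. As \<open>cells f\<close> is itself such a subcomplex, every continuous map from a sphere
  into \<open>cell_space f\<close>, together with a compatible \<open>b\<close>, finally gives a cell (\<open>attach_cell_space\<close>).
  Inducting over this definition replaces an induction over stages of a construction.\<close>

inductive_set cells :: "'u top_map \<Rightarrow> 'u cell_data set" for f :: "'u top_map"
  where attach: "\<lbrakk>\<And>c. c \<in> Q \<Longrightarrow> c \<in> cells f; subcomplex (src f) Q;
      continuous_map (bdry_sphere n) (weak_top (src f) Q) a; a \<in> extensional (rim n);
      continuous_map (disc n) (tgt f) b; b \<in> extensional (disk n);
      \<And>x. x \<in> rim n \<Longrightarrow> proj (mor f) (a x) = b x\<rbrakk> \<Longrightarrow> (n, a, b) \<in> cells f"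

abbreviation cell_space :: "'u top_map \<Rightarrow> 'u topology"
  where "cell_space f \<equiv> weak_top (src f) (cells f)"

lemma openin_weak_top:
  "openin (weak_top X Q) U \<longleftrightarrow> U \<subseteq> points X Q \<and> openin X {x \<in> topspace X. base_pt x \<in> U} \<and>
    (\<forall>n a b. (n, a, b) \<in> Q \<longrightarrow> openin (disc n) {x \<in> disk n. char_map n a b x \<in> U})"
proof -
  have "istopology (\<lambda>U. U \<subseteq> points X Q \<and> openin X {x \<in> topspace X. base_pt x \<in> U} \<and>
    (\<forall>n a b. (n, a, b) \<in> Q \<longrightarrow> openin (disc n) {x \<in> disk n. char_map n a b x \<in> U}))"
    unfolding istopology_def
  proof (intro conjI allI impI; (elim conjE)?)
    fix S T
    assume "openin X {x \<in> topspace X. base_pt x \<in> S}" "openin X {x \<in> topspace X. base_pt x \<in> T}"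
    then have "openin X ({x \<in> topspace X. base_pt x \<in> S} \<inter> {x \<in> topspace X. base_pt x \<in> T})" by blast
    then show "openin X {x \<in> topspace X. base_pt x \<in> S \<inter> T}"
      by (rule back_subst[of "openin X"]) auto
  next
    fix S T n a b
    assume "\<forall>n a b. (n, a, b) \<in> Q \<longrightarrow> openin (disc n) {x \<in> disk n. char_map n a b x \<in> S}"
      "\<forall>n a b. (n, a, b) \<in> Q \<longrightarrow> openin (disc n) {x \<in> disk n. char_map n a b x \<in> T}" "(n, a, b) \<in> Q"
    then have "openin (disc n) ({x \<in> disk n. char_map n a b x \<in> S} \<inter> {x \<in> disk n. char_map n a b x \<in> T})" by blast
    then show "openin (disc n) {x \<in> disk n. char_map n a b x \<in> S \<inter> T}"
      by (rule back_subst[of "openin (disc n)"]) auto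
  next
    fix \<U> assume *: "\<forall>U\<in>\<U>. U \<subseteq> points X Q \<and> openin X {x \<in> topspace X. base_pt x \<in> U} \<and>
      (\<forall>n a b. (n, a, b) \<in> Q \<longrightarrow> openin (disc n) {x \<in> disk n. char_map n a b x \<in> U})"
    have "openin X (\<Union>U\<in>\<U>. {x \<in> topspace X. base_pt x \<in> U})" using * by blast
    then show "openin X {x \<in> topspace X. base_pt x \<in> \<Union>\<U>}"
      by (rule back_subst[of "openin X"]) auto
    fix n a b assume "(n, a, b) \<in> Q"
    then have "openin (disc n) (\<Union>U\<in>\<U>. {x \<in> disk n. char_map n a b x \<in> U})" using * by blast
    then show "openin (disc n) {x \<in> disk n. char_map n a b x \<in> \<Union>\<U>}"
      by (rule back_subst[of "openin (disc n)"]) auto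
  qed auto
  then show ?thesis by (simp add: weak_top_def topology_inverse')
qed

lemma char_map_rim [simp]: "x \<in> rim n \<Longrightarrow> char_map n a b x = a x"
  and char_map_int [simp]: "x \<notin> rim n \<Longrightarrow> char_map n a b x = cell_pt n a b x"
  by (simp_all add: char_map_def)

lemma points_base_pt [simp]: "x \<in> topspace X \<Longrightarrow> base_pt x \<in> points X Q"
  by (simp add: points_def)

lemma char_map_points:
  "subcomplex X Q \<Longrightarrow> (n, a, b) \<in> Q \<Longrightarrow> x \<in> disk n \<Longrightarrow> char_map n a b x \<in> points X Q"
  unfolding subcomplex_def by (cases "x \<in> rim n") (auto simp: points_def)

lemma points_cases:
  assumes "p \<in> points X Q"
  obtains x where "x \<in> topspace X" "p = base_pt x"
  | n a b d where "(n, a, b) \<in> Q" "d \<in> disk n" "d \<notin> rim n" "p = cell_pt n a b d"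
  using assms by (auto simp: points_def)

lemma points_mono: "Q \<subseteq> Q' \<Longrightarrow> points X Q \<subseteq> points X Q'"
  unfolding points_def by blast

lemma topspace_weak_top [simp]:
  assumes "subcomplex X Q"
  shows "topspace (weak_top X Q) = points X Q"
proof -
  have "{x \<in> topspace X. base_pt x \<in> points X Q} = topspace X" by auto
  moreover have "{x \<in> disk n. char_map n a b x \<in> points X Q} = topspace (disc n)" if "(n, a, b) \<in> Q" for n a b
    using char_map_points[OF assms that] by (auto simp: disk_def)
  ultimately have "openin (weak_top X Q) (points X Q)"
    by (simp add: openin_weak_top)
  then show ?thesis
    by (metis openin_weak_top openin_subset openin_topspace subset_antisym)
qed

lemma closedin_weak_top:
  assumes Q: "subcomplex X Q"
  shows "closedin (weak_top X Q) K \<longleftrightarrow> K \<subseteq> points X Q \<and> closedin X {x \<in> topspace X. base_pt x \<in> K} \<and>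
    (\<forall>n a b. (n, a, b) \<in> Q \<longrightarrow> closedin (disc n) {x \<in> disk n. char_map n a b x \<in> K})"
proof -
  have 1: "{x \<in> topspace X. base_pt x \<in> points X Q - K} = topspace X - {x \<in> topspace X. base_pt x \<in> K}"
    by auto
  have 2: "{x \<in> disk n. char_map n a b x \<in> points X Q - K} = topspace (disc n) - {x \<in> disk n. char_map n a b x \<in> K}"
    if "(n, a, b) \<in> Q" for n a b
    using char_map_points[OF Q that] by (auto simp: disk_def)
  have "{x \<in> topspace X. base_pt x \<in> K} \<subseteq> topspace X" "{x \<in> disk n. char_map n a b x \<in> K} \<subseteq> topspace (disc n)" for n a b
    by (auto simp: disk_def)
  moreover have "(\<forall>n a b. (n, a, b) \<in> Q \<longrightarrow> openin (disc n) {x \<in> disk n. char_map n a b x \<in> points X Q - K}) \<longleftrightarrow>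
    (\<forall>n a b. (n, a, b) \<in> Q \<longrightarrow> openin (disc n) (topspace (disc n) - {x \<in> disk n. char_map n a b x \<in> K}))"
    by (simp add: 2 del: Diff_iff)
  ultimately show ?thesis
    unfolding closedin_def topspace_weak_top[OF Q] openin_weak_top 1 by (simp del: Diff_iff)
qed

lemma continuous_base_pt: "subcomplex X Q \<Longrightarrow> continuous_map X (weak_top X Q) base_pt"
  by (auto simp: continuous_map_def openin_weak_top)

lemma continuous_char_map:
  assumes "subcomplex X Q" "(n, a, b) \<in> Q"
  shows "continuous_map (disc n) (weak_top X Q) (char_map n a b)"
  using char_map_points[OF assms] assms unfolding continuous_map_def topspace_weak_top[OF assms(1)] openin_weak_top disk_def
  by blast

text \<open>The universal property of the final topology.\<close>

lemma continuous_weak_topI: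
  assumes Q: "subcomplex X Q" and X: "continuous_map X Z (\<lambda>x. F (base_pt x))"
    and c: "\<And>n a b. (n, a, b) \<in> Q \<Longrightarrow> continuous_map (disc n) Z (\<lambda>x. F (char_map n a b x))"
  shows "continuous_map (weak_top X Q) Z F"
  unfolding continuous_map_def topspace_weak_top[OF Q]
proof (intro conjI allI impI)
  show "F \<in> points X Q \<rightarrow> topspace Z"
  proof
    fix p assume "p \<in> points X Q"
    then show "F p \<in> topspace Z"
    proof (cases rule: points_cases)
      case (1 x)
      then show ?thesis using X by (auto simp: continuous_map_def)
    next
      case (2 n a b d)
      then show ?thesis using c[OF 2(1)] by (force simp: continuous_map_def disk_def)
    qed
  qed
  fix U assume U: "openin Z U"
  have "{x \<in> topspace X. base_pt x \<in> {p \<in> points X Q. F p \<in> U}} = {x \<in> topspace X. F (base_pt x) \<in> U}" by auto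
  moreover have "{x \<in> disk n. char_map n a b x \<in> {p \<in> points X Q. F p \<in> U}} = {x \<in> topspace (disc n). F (char_map n a b x) \<in> U}"
    if "(n, a, b) \<in> Q" for n a b
    using char_map_points[OF Q that] by (auto simp: disk_def)
  ultimately show "openin (weak_top X Q) {p \<in> points X Q. F p \<in> U}"
    using X c U by (auto simp: openin_weak_top continuous_map_def)
qed

lemma cellsE:
  assumes "(n, a, b) \<in> cells f"
  obtains Q where "Q \<subseteq> cells f" "subcomplex (src f) Q"
    "continuous_map (bdry_sphere n) (weak_top (src f) Q) a" "a \<in> extensional (rim n)"
    "continuous_map (disc n) (tgt f) b" "b \<in> extensional (disk n)"
    "\<And>x. x \<in> rim n \<Longrightarrow> proj (mor f) (a x) = b x"
  using assms
proof (cases rule: cells.cases)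
  case (attach Q)
  show ?thesis by (rule that[of Q]) (use attach in blast)+
qed

lemma cellsD:
  assumes "(n, a, b) \<in> cells f"
  shows "a \<in> extensional (rim n)" "continuous_map (disc n) (tgt f) b" "b \<in> extensional (disk n)"
    "x \<in> rim n \<Longrightarrow> proj (mor f) (a x) = b x"
  by (rule cellsE[OF assms]; assumption)+

lemma subcomplex_cells [simp]: "subcomplex (src f) (cells f)"
  unfolding subcomplex_def
proof (intro allI impI)
  fix n a b x assume "(n, a, b) \<in> cells f" and x: "x \<in> rim n"
  then obtain Q where Q: "Q \<subseteq> cells f" "subcomplex (src f) Q"
    and a: "continuous_map (bdry_sphere n) (weak_top (src f) Q) a"
    using cellsE by metis
  have "a x \<in> points (src f) Q"
    using a x Q(2) by (auto simp: continuous_map_def rim_def)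
  then show "a x \<in> points (src f) (cells f)" using points_mono[OF Q(1)] by blast
qed

lemma continuous_attaching:
  assumes "(n, a, b) \<in> cells f"
  shows "continuous_map (bdry_sphere n) (cell_space f) a"
proof (rule continuous_map_eq)
  show "continuous_map (bdry_sphere n) (cell_space f) (char_map n a b)"
    unfolding bdry_sphere_eq
    by (rule continuous_map_from_subtopology[OF continuous_char_map[OF subcomplex_cells assms]])
qed (simp add: rim_def[symmetric])

lemma attach_cell_space:
  "\<lbrakk>continuous_map (bdry_sphere n) (cell_space f) a; a \<in> extensional (rim n);
    continuous_map (disc n) (tgt f) b; b \<in> extensional (disk n);
    \<And>x. x \<in> rim n \<Longrightarrow> proj (mor f) (a x) = b x\<rbrakk> \<Longrightarrow> (n, a, b) \<in> cells f"
  using attach[of "cells f" f n a b] by simp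

context universe
begin

lemma bij_tree_pt: "bij (tree_pt :: 'u tree \<Rightarrow> 'u)"
  unfolding tree_pt_def using bij_tree by (rule someI_ex)

lemma inv_tree_pt [simp]: "inv tree_pt (tree_pt t :: 'u) = t" "tree_pt (inv tree_pt p) = (p :: 'u)"
  by (rule inv_f_f[OF bij_is_inj[OF bij_tree_pt]], rule surj_f_inv_f[OF bij_is_surj[OF bij_tree_pt]])

lemma tree_pt_eq [simp]:
  "tree_pt s = (tree_pt t :: 'u) \<longleftrightarrow> s = t"
  "inv tree_pt p = inv tree_pt q \<longleftrightarrow> p = (q :: 'u)"
  by (rule inj_eq[OF bij_is_inj[OF bij_tree_pt]], rule inj_eq[OF bij_is_inj[OF bij_imp_bij_inv[OF bij_tree_pt]]])

lemma base_pt_cell_pt [simp]: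
  "base_pt x = (base_pt y :: 'u) \<longleftrightarrow> x = y"
  "base_pt x \<noteq> (cell_pt n a b d :: 'u)"
  "(cell_pt n a b d :: 'u) \<noteq> base_pt x"
  "cell_pt n a b d = (cell_pt n' a' b' d' :: 'u) \<longleftrightarrow> n = n' \<and> a = a' \<and> b = b' \<and> d = d'"
proof -
  have "inv tree_pt \<circ> a = inv tree_pt \<circ> a' \<longleftrightarrow> a = a'" for a a' :: "point \<Rightarrow> 'u"
    by (simp add: fun_eq_iff)
  then show "base_pt x = (base_pt y :: 'u) \<longleftrightarrow> x = y" "base_pt x \<noteq> (cell_pt n a b d :: 'u)" "(cell_pt n a b d :: 'u) \<noteq> base_pt x"
    "cell_pt n a b d = (cell_pt n' a' b' d' :: 'u) \<longleftrightarrow> n = n' \<and> a = a' \<and> b = b' \<and> d = d'"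
    by (simp_all add: base_pt_def cell_pt_def)
qed

lemma proj_simps [simp]: "proj \<phi> (base_pt x :: 'u) = \<phi> x" "proj \<phi> (cell_pt n a b d :: 'u) = b d"
  by (simp_all add: proj_def base_pt_def cell_pt_def)

text \<open>Every element of \<open>'u\<close> is a tree, including the values of attaching maps outside the sphere.\<close>

lemma point_induct:
  assumes "\<And>x :: 'u. P (base_pt x)" "\<And>n a b d. (\<And>x. P (a x)) \<Longrightarrow> P (cell_pt n a b d)"
  shows "P (p :: 'u)"
proof -
  have "P (tree_pt t)" for t :: "'u tree"
  proof (induction t)
    case (Leaf x)
    then show ?case using assms(1)[of x] by (simp add: base_pt_def)
  next
    case (Node n a b d)
    have "inv tree_pt \<circ> (tree_pt \<circ> a) = a" by (simp add: fun_eq_iff)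
    then show ?case using assms(2)[of "tree_pt \<circ> a" n b d] Node.IH by (simp add: cell_pt_def)
  qed
  from this[of "inv tree_pt p"] show ?thesis by simp
qed

lemma fold_points_simps:
  fixes a :: "point \<Rightarrow> 'u"
  shows "fold_points g H (base_pt x :: 'u) = g x"
    "fold_points g H (cell_pt n a b d) =
      cell_pt n (restrict (fold_points g H \<circ> a) (rim n)) (restrict (H \<circ> char_map n a b) (disk n)) d"
proof -
  show "fold_points g H (base_pt x :: 'u) = g x" by (simp add: fold_points_def base_pt_def)
  have "tree_pt \<circ> (inv tree_pt \<circ> a) = a" by (simp add: fun_eq_iff)
  then show "fold_points g H (cell_pt n a b d) =
      cell_pt n (restrict (fold_points g H \<circ> a) (rim n)) (restrict (H \<circ> char_map n a b) (disk n)) d"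
    by (simp add: fold_points_def cell_pt_def[of n a b d] restrict_def cong: if_cong)
qed

lemma points_iff [simp]:
  "(base_pt x :: 'u) \<in> points X Q \<longleftrightarrow> x \<in> topspace X"
  "(cell_pt n a b d :: 'u) \<in> points X Q \<longleftrightarrow> (n, a, b) \<in> Q \<and> d \<in> disk n \<and> d \<notin> rim n"
  by (auto simp: points_def)

lemma proj_char_map:
  "(n, a, b) \<in> cells f \<Longrightarrow> proj (mor f) (char_map n a b x :: 'u) = b x"
  using cellsD(4)[of n a b f x] by (cases "x \<in> rim n") auto

lemma continuous_proj:
  assumes "Q \<subseteq> cells f" "subcomplex (src f) Q" "continuous_map (src f) (tgt f) (mor f :: 'u \<Rightarrow> 'u)"
  shows "continuous_map (weak_top (src f) Q) (tgt f) (proj (mor f))"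
proof (rule continuous_weak_topI)
  show "continuous_map (disc n) (tgt f) (\<lambda>x. proj (mor f) (char_map n a b x))" if "(n, a, b) \<in> Q" for n a b
    using cellsD(2)[of n a b f] proj_char_map[of n a b f] assms(1) that by (auto simp: subset_iff)
qed (use assms in simp_all)

text \<open>A commutative square \<open>(g, H)\<close> from the left factor of \<open>f\<close> to the right factor of \<open>f'\<close> induces a
  cellular map. That cells go to cells and that the map is continuous have to be shown together:
  by induction the map is continuous on the subcomplex into which a cell is attached, so the image
  of the attaching map is again an attaching map.\<close>

lemma fold_points_cells:
  fixes f f' :: "'u top_map"
  assumes g: "continuous_map (src f) (cell_space f') g" and H: "continuous_map (cell_space f) (tgt f') H"
    and gH: "\<And>x. x \<in> topspace (src f) \<Longrightarrow> proj (mor f') (g x) = H (base_pt x)"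
  shows "c \<in> cells f \<Longrightarrow> case c of (n, a, b) \<Rightarrow>
      (n, restrict (fold_points g H \<circ> a) (rim n), restrict (H \<circ> char_map n a b) (disk n)) \<in> cells f'"
    and "p \<in> topspace (cell_space f) \<Longrightarrow> proj (mor f') (fold_points g H p) = H p"
    and "continuous_map (cell_space f) (cell_space f') (fold_points g H)"
proof -
  let ?F = "fold_points g H"
  have proj: "proj (mor f') (?F p) = H p" if p: "p \<in> points (src f) (cells f)" for p
    using p
  proof (cases rule: points_cases)
    case (1 x)
    then show ?thesis by (simp add: fold_points_simps gH)
  next
    case (2 n a b d)
    then show ?thesis by (simp add: fold_points_simps)
  qed
  then show "p \<in> topspace (cell_space f) \<Longrightarrow> proj (mor f') (?F p) = H p" by simp
  have char_map: "?F (char_map n a b x) = char_map n (restrict (?F \<circ> a) (rim n)) (restrict (H \<circ> char_map n a b) (disk n)) x"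
    for n a b x
    by (cases "x \<in> rim n") (simp_all add: fold_points_simps)
  have cont: "continuous_map (weak_top (src f) Q) (cell_space f') ?F" if Q: "subcomplex (src f) Q"
    and c: "\<And>n a b. (n, a, b) \<in> Q \<Longrightarrow>
      (n, restrict (?F \<circ> a) (rim n), restrict (H \<circ> char_map n a b) (disk n)) \<in> cells f'" for Q
  proof (rule continuous_weak_topI[OF Q])
    show "continuous_map (src f) (cell_space f') (\<lambda>x. ?F (base_pt x))"
      using g by (simp add: fold_points_simps)
    show "continuous_map (disc n) (cell_space f') (\<lambda>x. ?F (char_map n a b x))" if "(n, a, b) \<in> Q" for n a b
      unfolding char_map by (rule continuous_char_map[OF subcomplex_cells c[OF that]])
  qed
  show cells: "c \<in> cells f \<Longrightarrow> case c of (n, a, b) \<Rightarrow>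
      (n, restrict (?F \<circ> a) (rim n), restrict (H \<circ> char_map n a b) (disk n)) \<in> cells f'" for c
  proof (induction rule: cells.induct)
    case (attach Q n a b)
    have nab: "(n, a, b) \<in> cells f" by (rule cells.attach[of Q]) (use attach in auto)
    have "continuous_map (weak_top (src f) Q) (cell_space f') ?F"
    proof (rule cont)
      fix n a b assume "(n, a, b) \<in> Q"
      from attach.IH[OF this] show "(n, restrict (?F \<circ> a) (rim n), restrict (H \<circ> char_map n a b) (disk n)) \<in> cells f'"
        by (simp only: prod.case)
    qed (rule attach)
    then have "continuous_map (bdry_sphere n) (cell_space f') (?F \<circ> a)"
      using attach continuous_map_compose by blast
    then have a: "continuous_map (bdry_sphere n) (cell_space f') (restrict (?F \<circ> a) (rim n))"
      by (rule continuous_map_eq) (simp add: rim_def)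
    have b: "continuous_map (disc n) (tgt f') (restrict (H \<circ> char_map n a b) (disk n))"
      by (rule continuous_map_eq[OF continuous_map_compose[OF continuous_char_map[OF subcomplex_cells nab] H]])
        (simp add: disk_def)
    have "proj (mor f') (?F (a x)) = H (a x)" if "x \<in> rim n" for x
      using proj subcomplex_cells[of f] that nab unfolding subcomplex_def by blast
    then show ?case
      unfolding prod.case by (intro attach_cell_space a b restrict_extensional) simp
  qed
  show "continuous_map (cell_space f) (cell_space f') ?F"
  proof (rule cont[OF subcomplex_cells])
    fix n a b assume "(n, a, b) \<in> cells f"
    from cells[OF this] show "(n, restrict (?F \<circ> a) (rim n), restrict (H \<circ> char_map n a b) (disk n)) \<in> cells f'"
      by (simp only: prod.case)
  qed
qed

text \<open>The labels of the trees in \<open>cell_space f\<close> are points of the domain, points of the codomain, or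
  codes of points of discs. The default value \<open>undefined\<close> occurs outside the disc, and as a tree
  outside the sphere, which accounts for the labels of this one tree.\<close>

lemma small_cell_space:
  fixes f :: "'u top_map"
  assumes "small (topspace (src f))" "small (topspace (tgt f))"
  shows "small (topspace (cell_space f))"
proof -
  define B where "B = topspace (src f) \<union> topspace (tgt f) \<union> {undefined} \<union> range e \<union> range (tree_code e (inv tree_pt (undefined :: 'u)))"
  have sm: "small B"
    unfolding B_def by (intro small_Un assms small_finite small_lepoll_real
        lepoll_trans[OF image_lepoll point_lepoll_real] lepoll_trans[OF image_lepoll address_lepoll_real]) simp
  have "p \<in> points (src f) (cells f) \<longrightarrow> (\<forall>q. tree_code e (inv tree_pt p) q \<in> B)" for p
  proof (induction p rule: point_induct)
    case (1 x)
    have "tree_code e (inv tree_pt (base_pt x)) q \<in> B" if "x \<in> topspace (src f)" for q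
      using that unfolding base_pt_def B_def by (cases q) simp
    then show ?case by simp
  next
    case (2 n a b d)
    show ?case
    proof (intro impI allI)
      fix q :: "point list \<times> nat \<times> point"
      assume "cell_pt n a b d \<in> points (src f) (cells f)"
      then have c: "(n, a, b) \<in> cells f" by simp
      have b: "b y \<in> B" for y
      proof (cases "y \<in> disk n")
        case True
        then show ?thesis
          using continuous_map_image_subset_topspace[OF cellsD(2)[OF c]] by (auto simp: disk_def B_def)
      next
        case False
        then show ?thesis using extensional_arb[OF cellsD(3)[OF c]] by (simp add: B_def)
      qed
      have a: "tree_code e (inv tree_pt (a z)) q \<in> B" for z q
      proof (cases "z \<in> rim n")
        case True
        then have "a z \<in> points (src f) (cells f)" using subcomplex_cells[of f] c by (simp only: subcomplex_def)
        then show ?thesis using 2[of z] by blast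
      next
        case False
        then show ?thesis using extensional_arb[OF cellsD(1)[OF c]] by (simp add: B_def)
      qed
      obtain zs :: "point list" and i :: nat and y :: point where q: "q = (zs, i, y)" by (metis surj_pair)
      show "tree_code e (inv tree_pt (cell_pt n a b d)) q \<in> B"
      proof (cases zs)
        case Nil
        then show ?thesis using b[of y] unfolding q cell_pt_def by (simp add: B_def)
      next
        case (Cons z zs')
        then show ?thesis using a[of z "(zs', i, y)"] unfolding q cell_pt_def by simp
      qed
    qed
  qed
  then have "small (tree_pt ` (inv tree_pt ` points (src f) (cells f)))"
    by (intro small_tree_image[OF sm]) blast
  then show ?thesis by (simp add: image_image)
qed

end

section \<open>The cellular factorisation of a continuous map\<close>

lemma Top_sel [simp]:
  "Obj Top = {X. small (topspace X)}" "Dom Top = src" "Cod Top = tgt"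
  "Idn Top X = Arrow X X (\<lambda>x \<in> topspace X. x)"
  by (simp_all add: Top_def)

lemma Arr_Top_iff:
  "f \<in> Arr Top \<longleftrightarrow> small (topspace (src f)) \<and> small (topspace (tgt f)) \<and>
     mor f \<in> extensional (topspace (src f)) \<and> continuous_map (src f) (tgt f) (mor f)"
  by (simp add: Top_def)

lemma Top_comp_sel [simp]:
  "src (g \<cdot>\<^bsub>Top\<^esub> f) = src f" "tgt (g \<cdot>\<^bsub>Top\<^esub> f) = tgt g"
  "x \<in> topspace (src f) \<Longrightarrow> mor (g \<cdot>\<^bsub>Top\<^esub> f) x = mor g (mor f x)"
  by (simp_all add: Top_def compose_def)

lemma mor_in:
  "f \<in> Arr Top \<Longrightarrow> x \<in> topspace (src f) \<Longrightarrow> mor f x \<in> topspace (tgt f)"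
  by (auto simp: Arr_Top_iff continuous_map_def)

lemma restrict_Arr_Top:
  assumes "continuous_map X Y h" "small (topspace X)" "small (topspace Y)"
  shows "Arrow X Y (restrict h (topspace X)) \<in> Arr Top"
  using assms continuous_map_eq[OF assms(1), of "restrict h (topspace X)"] by (simp add: Arr_Top_iff)

lemma Top_eqI:
  assumes "f \<in> Arr Top" "g \<in> Arr Top" "src f = src g" "tgt f = tgt g"
    and "\<And>x. x \<in> topspace (src f) \<Longrightarrow> mor f x = mor g x"
  shows "f = g"
proof (rule arrow.expand, intro conjI)
  show "mor f = mor g"
    using assms by (intro extensionalityI[of _ "topspace (src f)"]) (auto simp: Arr_Top_iff)
qed (use assms in auto)

lemma Top_Arr_comp: "f \<in> Arr Top \<Longrightarrow> g \<in> Arr Top \<Longrightarrow> tgt f = src g \<Longrightarrow> g \<cdot>\<^bsub>Top\<^esub> f \<in> Arr Top"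
  using category.comp_closed(1)[OF category_Top, of f g] by simp

definition cell_left :: "'u top_map \<Rightarrow> 'u top_map"
  where "cell_left f = Arrow (src f) (cell_space f) (restrict base_pt (topspace (src f)))"

definition cell_right :: "'u top_map \<Rightarrow> 'u top_map"
  where "cell_right f = Arrow (cell_space f) (tgt f) (restrict (proj (mor f)) (topspace (cell_space f)))"

definition cellular :: "'u top_map \<Rightarrow> 'u top_map \<Rightarrow> 'u top_map set"
  where "cellular f g = {F \<in> Arr Top. src F = cell_space f \<and> tgt F = cell_space g \<and>
    (\<forall>n a b d. (n, a, b) \<in> cells f \<longrightarrow> d \<in> disk n - rim n \<longrightarrow> mor F (cell_pt n a b d) =
      cell_pt n (restrict (mor F \<circ> a) (rim n)) (restrict (proj (mor g) \<circ> mor F \<circ> char_map n a b) (disk n)) d)}"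

lemma cell_left_sel [simp]: "src (cell_left f) = src f" "tgt (cell_left f) = cell_space f"
    "x \<in> topspace (src f) \<Longrightarrow> mor (cell_left f) x = base_pt x"
  and cell_right_sel [simp]: "src (cell_right f) = cell_space f" "tgt (cell_right f) = tgt f"
    "p \<in> points (src f) (cells f) \<Longrightarrow> mor (cell_right f) p = proj (mor f) p"
  by (simp_all add: cell_left_def cell_right_def)

lemma cellular_D:
  assumes "F \<in> cellular f g"
  shows "F \<in> Arr Top" "src F = cell_space f" "tgt F = cell_space g"
    "(n, a, b) \<in> cells f \<Longrightarrow> d \<in> disk n \<Longrightarrow> d \<notin> rim n \<Longrightarrow> mor F (cell_pt n a b d) =
      cell_pt n (restrict (mor F \<circ> a) (rim n)) (restrict (proj (mor g) \<circ> mor F \<circ> char_map n a b) (disk n)) d"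
  using assms by (auto simp: cellular_def)

lemma cells_rim: "(n, a, b) \<in> cells f \<Longrightarrow> x \<in> rim n \<Longrightarrow> a x \<in> points (src f) (cells f)"
  using subcomplex_cells[of f] unfolding subcomplex_def by blast

lemma cells_char_map: "(n, a, b) \<in> cells f \<Longrightarrow> x \<in> disk n \<Longrightarrow> char_map n a b x \<in> points (src f) (cells f)"
  by (rule char_map_points[OF subcomplex_cells])

context universe
begin

lemma cell_left_Arr: "(f :: 'u top_map) \<in> Arr Top \<Longrightarrow> cell_left f \<in> Arr Top"
  unfolding cell_left_def by (intro restrict_Arr_Top continuous_base_pt subcomplex_cells small_cell_space) (auto simp: Arr_Top_iff)

lemma cell_right_Arr: "(f :: 'u top_map) \<in> Arr Top \<Longrightarrow> cell_right f \<in> Arr Top"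
  unfolding cell_right_def by (intro restrict_Arr_Top continuous_proj subcomplex_cells small_cell_space) (auto simp: Arr_Top_iff)

lemma cellular_char_map:
  assumes F: "F \<in> cellular f g" and c: "(n, a, b) \<in> cells (f :: 'u top_map)" and x: "x \<in> disk n"
  shows "mor F (char_map n a b x) =
    char_map n (restrict (mor F \<circ> a) (rim n)) (restrict (proj (mor g) \<circ> mor F \<circ> char_map n a b) (disk n)) x"
  using cellular_D(4)[OF F c x] by (cases "x \<in> rim n") simp_all

text \<open>The image of the centre of a cell is a point of \<open>cell_space g\<close>, and a point of the form
  \<open>cell_pt n a b d\<close> belongs to \<open>cell_space g\<close> only if \<open>(n, a, b)\<close> is a cell.\<close>

lemma cellular_cells:
  assumes F: "F \<in> cellular f g" and c: "(n, a, b) \<in> cells (f :: 'u top_map)"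
  shows "(n, restrict (mor F \<circ> a) (rim n), restrict (proj (mor g) \<circ> mor F \<circ> char_map n a b) (disk n)) \<in> cells g"
proof -
  let ?d = "\<lambda>_. 0 :: real"
  have d: "?d \<in> disk n" "?d \<notin> rim n" using origin by auto
  have "mor F (cell_pt n a b ?d) \<in> points (src g) (cells g)"
    using mor_in[OF cellular_D(1)[OF F], of "cell_pt n a b ?d"] c d cellular_D(2,3)[OF F] by simp
  then show ?thesis using cellular_D(4)[OF F c d] by simp
qed

lemma cellular_comp:
  assumes F: "F \<in> cellular f g" and G: "G \<in> cellular g (h :: 'u top_map)"
  shows "G \<cdot>\<^bsub>Top\<^esub> F \<in> cellular f h"
  unfolding cellular_def
proof (intro CollectI conjI allI impI)
  show "G \<cdot>\<^bsub>Top\<^esub> F \<in> Arr Top"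
    using cellular_D[OF F] cellular_D[OF G] by (simp add: Top_Arr_comp)
  fix n a b d assume c: "(n, a, b) \<in> cells f" and d: "d \<in> disk n - rim n"
  let ?a = "restrict (mor F \<circ> a) (rim n)" and ?b = "restrict (proj (mor g) \<circ> mor F \<circ> char_map n a b) (disk n)"
  have 1: "mor (G \<cdot>\<^bsub>Top\<^esub> F) p = mor G (mor F p)" if "p \<in> points (src f) (cells f)" for p
    using that cellular_D[OF F] by simp
  have "mor (G \<cdot>\<^bsub>Top\<^esub> F) (cell_pt n a b d) = mor G (mor F (cell_pt n a b d))"
    using c d by (intro 1) simp
  also have "\<dots> = mor G (cell_pt n ?a ?b d)" using cellular_D(4)[OF F c] d by simp
  also have "\<dots> = cell_pt n (restrict (mor G \<circ> ?a) (rim n)) (restrict (proj (mor h) \<circ> mor G \<circ> char_map n ?a ?b) (disk n)) d"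
    using cellular_D(4)[OF G cellular_cells[OF F c]] d by simp
  also have "restrict (mor G \<circ> ?a) (rim n) = restrict (mor (G \<cdot>\<^bsub>Top\<^esub> F) \<circ> a) (rim n)"
    by (rule restrict_ext) (use 1 cells_rim[OF c] in simp)
  also have "restrict (proj (mor h) \<circ> mor G \<circ> char_map n ?a ?b) (disk n)
      = restrict (proj (mor h) \<circ> mor (G \<cdot>\<^bsub>Top\<^esub> F) \<circ> char_map n a b) (disk n)"
    by (rule restrict_ext) (use 1 cells_char_map[OF c] cellular_char_map[OF F c] in \<open>simp del: char_map_rim char_map_int\<close>)
  finally show "mor (G \<cdot>\<^bsub>Top\<^esub> F) (cell_pt n a b d) = cell_pt n (restrict (mor (G \<cdot>\<^bsub>Top\<^esub> F) \<circ> a) (rim n))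
      (restrict (proj (mor h) \<circ> mor (G \<cdot>\<^bsub>Top\<^esub> F) \<circ> char_map n a b) (disk n)) d" .
qed (use cellular_D[OF F] cellular_D[OF G] in simp_all)

lemma cellular_idn:
  assumes f: "(f :: 'u top_map) \<in> Arr Top"
  shows "Idn Top (cell_space f) \<in> cellular f f"
  unfolding cellular_def
proof (intro CollectI conjI allI impI)
  show "Idn Top (cell_space f) \<in> Arr Top"
    using restrict_Arr_Top[OF continuous_map_id, of "cell_space f"] small_cell_space[of f] f by (simp add: Arr_Top_iff id_def)
  fix n a b d assume c: "(n, a, b) \<in> cells f" and d: "d \<in> disk n - rim n"
  have "restrict (mor (Idn Top (cell_space f)) \<circ> a) (rim n) = a"
    by (rule extensionalityI[of _ "rim n"]) (use cellsD(1)[OF c] cells_rim[OF c] in auto)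
  moreover have "restrict (proj (mor f) \<circ> mor (Idn Top (cell_space f)) \<circ> char_map n a b) (disk n) = b"
    by (rule extensionalityI[of _ "disk n"])
      (use cellsD(3)[OF c] cells_char_map[OF c] proj_char_map[OF c] in \<open>auto simp del: char_map_rim char_map_int\<close>)
  ultimately show "mor (Idn Top (cell_space f)) (cell_pt n a b d) = cell_pt n (restrict (mor (Idn Top (cell_space f)) \<circ> a) (rim n))
      (restrict (proj (mor f) \<circ> mor (Idn Top (cell_space f)) \<circ> char_map n a b) (disk n)) d"
    using c d by simp
qed simp_all

text \<open>The image of a cell under a cellular map is determined by the image of its attaching map and by
  the map over which it lies.\<close>

lemma cellular_eq_char_map:
  assumes F: "F \<in> cellular f g" and G: "G \<in> cellular f g" and c: "(n, a, b) \<in> cells (f :: 'u top_map)"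
    and a: "\<And>x. x \<in> rim n \<Longrightarrow> mor F (a x) = mor G (a x)"
    and b: "\<And>x. x \<in> disk n \<Longrightarrow> proj (mor g) (mor F (char_map n a b x)) = proj (mor g) (mor G (char_map n a b x))"
    and x: "x \<in> disk n"
  shows "mor F (char_map n a b x) = mor G (char_map n a b x)"
proof -
  have "restrict (mor F \<circ> a) (rim n) = restrict (mor G \<circ> a) (rim n)"
    by (rule restrict_ext) (simp add: a)
  moreover have "restrict (proj (mor g) \<circ> mor F \<circ> char_map n a b) (disk n) = restrict (proj (mor g) \<circ> mor G \<circ> char_map n a b) (disk n)"
    by (rule restrict_ext) (simp add: b del: char_map_rim char_map_int)
  ultimately show ?thesis using cellular_char_map[OF F c x] cellular_char_map[OF G c x] by simp
qed

lemma cellular_unique: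
  assumes f: "(f :: 'u top_map) \<in> Arr Top" and F: "F \<in> cellular f g" and G: "G \<in> cellular f g"
    and L: "F \<cdot>\<^bsub>Top\<^esub> cell_left f = G \<cdot>\<^bsub>Top\<^esub> cell_left f" and R: "cell_right g \<cdot>\<^bsub>Top\<^esub> F = cell_right g \<cdot>\<^bsub>Top\<^esub> G"
  shows "F = G"
proof -
  note F' = cellular_D[OF F] and G' = cellular_D[OF G]
  have R': "proj (mor g) (mor F p) = proj (mor g) (mor G p)" if p: "p \<in> points (src f) (cells f)" for p
  proof -
    have "mor F p \<in> points (src g) (cells g)" "mor G p \<in> points (src g) (cells g)"
      using mor_in[OF F'(1), of p] mor_in[OF G'(1), of p] F'(2,3) G'(2,3) p by simp_all
    then show ?thesis
      using arg_cong[OF R, of "\<lambda>h. mor h p"] p F'(2) G'(2) by simp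
  qed
  have "p \<in> points (src f) (cells f) \<longrightarrow> mor F p = mor G p" for p
  proof (induction p rule: point_induct)
    case (1 x)
    show ?case
    proof
      assume "base_pt x \<in> points (src f) (cells f)"
      then show "mor F (base_pt x) = mor G (base_pt x)"
        using arg_cong[OF L, of "\<lambda>h. mor h x"] by simp
    qed
  next
    case (2 n a b d)
    show ?case
    proof
      assume "cell_pt n a b d \<in> points (src f) (cells f)"
      then have c: "(n, a, b) \<in> cells f" and d: "d \<in> disk n" "d \<notin> rim n" by simp_all
      have "mor F (char_map n a b d) = mor G (char_map n a b d)"
        by (rule cellular_eq_char_map[OF F G c _ _ d(1)]) (use 2 cells_rim[OF c] R' cells_char_map[OF c] in blast)+
      then show "mor F (cell_pt n a b d) = mor G (cell_pt n a b d)" using d by simp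
    qed
  qed
  then show ?thesis using F' G' by (intro Top_eqI) simp_all
qed

lemma cellular_exists:
  assumes f: "(f :: 'u top_map) \<in> Arr Top" and g: "g \<in> Arr Top"
    and u: "u \<in> Arr Top" "src u = src f" "tgt u = cell_space g"
    and v: "v \<in> Arr Top" "src v = cell_space f" "tgt v = tgt g"
    and uv: "cell_right g \<cdot>\<^bsub>Top\<^esub> u = v \<cdot>\<^bsub>Top\<^esub> cell_left f"
  shows "\<exists>F \<in> cellular f g. F \<cdot>\<^bsub>Top\<^esub> cell_left f = u \<and> cell_right g \<cdot>\<^bsub>Top\<^esub> F = v"
proof -
  let ?h = "fold_points (mor u) (mor v)"
  let ?F = "Arrow (cell_space f) (cell_space g) (restrict ?h (topspace (cell_space f)))"
  have cu: "continuous_map (src f) (cell_space g) (mor u)" and cv: "continuous_map (cell_space f) (tgt g) (mor v)"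
    using u v by (auto simp: Arr_Top_iff)
  have c: "proj (mor g) (mor u x) = mor v (base_pt x)" if x: "x \<in> topspace (src f)" for x
  proof -
    have "mor u x \<in> points (src g) (cells g)" using mor_in[OF u(1), of x] u x by simp
    then show ?thesis using arg_cong[OF uv, of "\<lambda>h. mor h x"] u x by simp
  qed
  note F = fold_points_cells[OF cu cv c]
  have h: "?h p \<in> points (src g) (cells g)" if "p \<in> points (src f) (cells f)" for p
    using F(3) that by (auto simp: continuous_map_def)
  have proj: "proj (mor g) (?h p) = mor v p" if "p \<in> points (src f) (cells f)" for p
    using F(2)[of p] that by simp
  have FA: "?F \<in> Arr Top"
    using f g by (intro restrict_Arr_Top F(3) small_cell_space) (auto simp: Arr_Top_iff)
  have "?F \<in> cellular f g"
    unfolding cellular_def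
  proof (intro CollectI conjI allI impI)
    fix n a b d assume c: "(n, a, b) \<in> cells f" and d: "d \<in> disk n - rim n"
    have "restrict (mor ?F \<circ> a) (rim n) = restrict (?h \<circ> a) (rim n)"
      by (rule restrict_ext) (use cells_rim[OF c] in simp)
    moreover have "restrict (proj (mor g) \<circ> mor ?F \<circ> char_map n a b) (disk n) = restrict (mor v \<circ> char_map n a b) (disk n)"
      by (rule restrict_ext) (use cells_char_map[OF c] proj in \<open>simp del: char_map_rim char_map_int\<close>)
    ultimately show "mor ?F (cell_pt n a b d) = cell_pt n (restrict (mor ?F \<circ> a) (rim n))
      (restrict (proj (mor g) \<circ> mor ?F \<circ> char_map n a b) (disk n)) d"
      using c d by (simp add: fold_points_simps)
  qed (simp_all add: FA del: topspace_weak_top)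
  moreover have "?F \<cdot>\<^bsub>Top\<^esub> cell_left f = u"
    by (rule Top_eqI) (use u cell_left_Arr[OF f] FA in \<open>simp_all add: Top_Arr_comp fold_points_simps\<close>)
  moreover have "cell_right g \<cdot>\<^bsub>Top\<^esub> ?F = v"
    by (rule Top_eqI) (use v cell_right_Arr[OF g] FA h proj in \<open>simp_all add: Top_Arr_comp\<close>)
  ultimately show ?thesis by blast
qed

lemma filler_factorisation_Top:
  "filler_factorisation (Top :: ('u topology, 'u top_map) cat) cell_left cell_right cell_space cellular"
proof (intro filler_factorisation.intro category_Top filler_factorisation_axioms.intro)
  fix f :: "'u top_map" assume f: "f \<in> Arr Top"
  show "cell_right f \<cdot>\<^bsub>Top\<^esub> cell_left f = f"
    by (rule Top_eqI) (use f cell_left_Arr[OF f] cell_right_Arr[OF f] in \<open>simp_all add: Top_Arr_comp\<close>)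
  show "cell_left f \<in> Arr Top" "cell_right f \<in> Arr Top" by (rule cell_left_Arr[OF f], rule cell_right_Arr[OF f])
qed (auto simp: cellular_D intro: cellular_comp cellular_idn cellular_unique cellular_exists simp del: Top_sel(4))

end

section \<open>Coalgebras are subcomplexes\<close>

lemma subcomplex_cells_cell_left [simp]: "subcomplex (src f) (cells (cell_left f))"
  using subcomplex_cells[of "cell_left f"] by simp

context universe
begin

interpretation T: filler_factorisation "Top :: ('u topology, 'u top_map) cat" cell_left cell_right cell_space cellular
  by (rule filler_factorisation_Top)

definition cell_awfs :: "'u top_map awfs_data"
  where "cell_awfs = T.awfs_of"

lemma awfs_cell_awfs: "awfs Top cell_awfs"
  unfolding cell_awfs_def by (rule T.awfs_awfs_of)

text \<open>Here \<open>D\<close> is the comultiplication \<open>M f \<rightarrow> M (L f)\<close> and \<open>E\<close> is the value of the functor \<open>M\<close> at the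
  square \<open>(1, \<alpha>) : f \<rightarrow> L f\<close>. The properties listed are those that determine them as cellular
  fillers.\<close>

lemma left_map_structure_pointwise:
  assumes f: "f \<in> Arr Top" and \<alpha>: "\<alpha> \<in> Arr Top" "src \<alpha> = tgt f" "tgt \<alpha> = cell_space f"
    and \<alpha>f: "\<alpha> \<cdot>\<^bsub>Top\<^esub> f = cell_left f" and R\<alpha>: "cell_right f \<cdot>\<^bsub>Top\<^esub> \<alpha> = Idn Top (tgt f)"
  obtains D E where "D \<in> cellular f (cell_left f)" "E \<in> cellular f (cell_left f)"
    "\<And>x. x \<in> topspace (src f) \<Longrightarrow> mor D (base_pt x) = base_pt x"
    "\<And>p. p \<in> points (src f) (cells f) \<Longrightarrow> proj (mor (cell_left f)) (mor D p) = p"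
    "\<And>x. x \<in> topspace (src f) \<Longrightarrow> mor E (base_pt x) = base_pt x"
    "\<And>p. p \<in> points (src f) (cells f) \<Longrightarrow> proj (mor (cell_left f)) (mor E p) = mor \<alpha> (proj (mor f) p)"
    "left_map_structure Top cell_awfs f \<alpha> \<longleftrightarrow>
      (\<forall>y \<in> topspace (tgt f). mor D (mor \<alpha> y) = mor E (mor \<alpha> y))"
proof -
  let ?s = "Arrow f (cell_left f) (Idn Top (src f), \<alpha>)"
  let ?D = "T.\<delta> f" and ?E = "T.Mmap ?s"
  have s: "?s \<in> Arr (arrow_cat Top)"
    using f \<alpha> \<alpha>f T.idn_closed[of "src f"] T.L_closed[OF f] T.comp_idn[of "cell_left f" "src f"]
    by (simp add: Arr_arrow_cat_iff Arr_Top_iff[of f] del: Top_sel(4))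
  have D: "?D \<in> cellular f (cell_left f)" "?D \<cdot>\<^bsub>Top\<^esub> cell_left f = cell_left (cell_left f)" "cell_right (cell_left f) \<cdot>\<^bsub>Top\<^esub> ?D = Idn Top (cell_space f)"
    by (rule T.\<delta>[OF f])+
  have E: "?E \<in> cellular f (cell_left f)" "?E \<cdot>\<^bsub>Top\<^esub> cell_left f = cell_left (cell_left f) \<cdot>\<^bsub>Top\<^esub> Idn Top (src f)"
    "cell_right (cell_left f) \<cdot>\<^bsub>Top\<^esub> ?E = \<alpha> \<cdot>\<^bsub>Top\<^esub> cell_right f"
    using T.Mmap[OF s] by (simp_all del: Top_sel(4))
  note D' = cellular_D[OF D(1)] and E' = cellular_D[OF E(1)]
  have in_points: "mor F p \<in> points (src f) (cells (cell_left f))" if "F \<in> cellular f (cell_left f)" "p \<in> points (src f) (cells f)" for F p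
    using mor_in[OF cellular_D(1)[OF that(1)], of p] cellular_D(2,3)[OF that(1)] that(2) by simp
  show ?thesis
  proof (rule that[of ?D ?E, OF D(1) E(1)])
    show "mor ?D (base_pt x) = base_pt x" "mor ?E (base_pt x) = base_pt x" if "x \<in> topspace (src f)" for x
      using arg_cong[OF D(2), of "\<lambda>h. mor h x"] arg_cong[OF E(2), of "\<lambda>h. mor h x"] that by simp_all
    show "proj (mor (cell_left f)) (mor ?D p) = p" "proj (mor (cell_left f)) (mor ?E p) = mor \<alpha> (proj (mor f) p)"
      if "p \<in> points (src f) (cells f)" for p
      using arg_cong[OF D(3), of "\<lambda>h. mor h p"] arg_cong[OF E(3), of "\<lambda>h. mor h p"] that
        in_points[OF D(1) that] in_points[OF E(1) that] D'(2) E'(2) by simp_all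
    have "?D \<cdot>\<^bsub>Top\<^esub> \<alpha> = ?E \<cdot>\<^bsub>Top\<^esub> \<alpha> \<longleftrightarrow> (\<forall>y \<in> topspace (tgt f). mor ?D (mor \<alpha> y) = mor ?E (mor \<alpha> y))"
    proof (intro iffI ballI)
      fix y assume eq: "?D \<cdot>\<^bsub>Top\<^esub> \<alpha> = ?E \<cdot>\<^bsub>Top\<^esub> \<alpha>" and y: "y \<in> topspace (tgt f)"
      have "mor ?D (mor \<alpha> y) = mor (?D \<cdot>\<^bsub>Top\<^esub> \<alpha>) y"
        using y \<alpha>(2) by (intro Top_comp_sel(3)[symmetric]) simp
      also have "\<dots> = mor ?E (mor \<alpha> y)"
        unfolding eq using y \<alpha>(2) by (intro Top_comp_sel(3)) simp
      finally show "mor ?D (mor \<alpha> y) = mor ?E (mor \<alpha> y)" .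
    next
      assume "\<forall>y \<in> topspace (tgt f). mor ?D (mor \<alpha> y) = mor ?E (mor \<alpha> y)"
      then show "?D \<cdot>\<^bsub>Top\<^esub> \<alpha> = ?E \<cdot>\<^bsub>Top\<^esub> \<alpha>"
        using \<alpha> D' E' by (intro Top_eqI) (simp_all add: Top_Arr_comp)
    qed
    then show "left_map_structure Top cell_awfs f \<alpha> \<longleftrightarrow>
        (\<forall>y \<in> topspace (tgt f). mor ?D (mor \<alpha> y) = mor ?E (mor \<alpha> y))"
      unfolding cell_awfs_def T.left_map_structure_iff using assms by (simp del: Top_sel(4))
  qed
qed

lemma left_map_structureD:
  assumes "left_map_structure Top cell_awfs f \<alpha>"
  shows "f \<in> Arr Top" "\<alpha> \<in> Arr Top" "src \<alpha> = tgt f" "tgt \<alpha> = cell_space f"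
    "\<alpha> \<cdot>\<^bsub>Top\<^esub> f = cell_left f" "cell_right f \<cdot>\<^bsub>Top\<^esub> \<alpha> = Idn Top (tgt f)"
  using assms unfolding cell_awfs_def T.left_map_structure_iff by (simp_all del: Top_sel(4))

lemma topspace_transport: "topspace (transport e X) = e ` topspace X"
  using inj_e by (auto simp: transport_def topspace_pullback_topology)

lemma inv_e [simp]: "inv e (e x) = x"
  using inj_e by simp

lemma continuous_transport_iff:
  "continuous_map (transport e X) Z h \<longleftrightarrow> continuous_map X Z (h \<circ> e)"
  using homeomorphic_transport[OF inj_e, of X] continuous_compose_quotient_map_eq[of X "transport e X" e Z h]
  unfolding homeomorphic_map_def by simp

lemma continuous_into_transport: "continuous_map X (transport e X) e"
  by (rule homeomorphic_imp_continuous_map[OF homeomorphic_transport[OF inj_e]])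

lemma small_disc: "small (e ` disk n)" "small (e ` rim n)"
  using small_transport[OF universe_axioms, of "disc n"] small_transport[OF universe_axioms, of "bdry_sphere n"]
  by (simp_all add: topspace_transport disk_def rim_def)

lemma sphere_inclusion_sel [simp]:
  "src (sphere_inclusion e n) = transport e (bdry_sphere n)" "tgt (sphere_inclusion e n) = transport e (disc n)"
  "x \<in> rim n \<Longrightarrow> mor (sphere_inclusion e n) (e x) = e x"
  by (auto simp: sphere_inclusion_def rim_def)

text \<open>The structure is the characteristic map of the cell attached to the sphere along its identity
  and lying over the identity of the disc. Comultiplication and the functor \<open>M\<close> agree on this
  cell, as both fix its boundary and lie over its characteristic map.\<close>

lemma sphere_inclusion_left_map:
  "\<exists>\<alpha>. left_map_structure Top cell_awfs (sphere_inclusion e n) \<alpha>"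
proof -
  let ?j = "sphere_inclusion e n"
  have j: "?j \<in> Arr Top" using sphere_inclusions_Arr[OF universe_axioms] by (auto simp: sphere_inclusions_def)
  have top: "topspace (src ?j) = e ` rim n" "topspace (tgt ?j) = e ` disk n"
    by (simp_all add: topspace_transport disk_def rim_def)
  let ?a = "restrict (base_pt \<circ> e) (rim n)" and ?b = "restrict e (disk n)"
  have c: "(n, ?a, ?b) \<in> cells ?j"
  proof (rule attach_cell_space)
    have "continuous_map (bdry_sphere n) (cell_space ?j) (base_pt \<circ> e)"
      using continuous_into_transport[of "bdry_sphere n"] continuous_base_pt[OF subcomplex_cells[of ?j]]
      by (intro continuous_map_compose[of _ "src ?j"]) simp_all
    then show "continuous_map (bdry_sphere n) (cell_space ?j) ?a"
      by (rule continuous_map_eq) (simp add: rim_def)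
    show "continuous_map (disc n) (tgt ?j) ?b"
      by (rule continuous_map_eq[of _ _ e]) (simp_all add: disk_def continuous_into_transport)
  qed simp_all
  define \<alpha> where "\<alpha> = Arrow (tgt ?j) (cell_space ?j) (restrict (char_map n ?a ?b \<circ> inv e) (topspace (tgt ?j)))"
  have "char_map n ?a ?b \<circ> inv e \<circ> e = char_map n ?a ?b" by (simp add: fun_eq_iff)
  then have "continuous_map (tgt ?j) (cell_space ?j) (char_map n ?a ?b \<circ> inv e)"
    using continuous_char_map[OF subcomplex_cells c] by (simp add: continuous_transport_iff del: sphere_inclusion_sel(1))
  then have \<alpha>_Arr: "\<alpha> \<in> Arr Top"
    unfolding \<alpha>_def using j small_cell_space[of ?j] by (intro restrict_Arr_Top) (simp_all only: Arr_Top_iff)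
  have \<alpha>_sel: "src \<alpha> = tgt ?j" "tgt \<alpha> = cell_space ?j" by (simp_all add: \<alpha>_def)
  have \<alpha>: "mor \<alpha> (e x) = char_map n ?a ?b x" if "x \<in> disk n" for x
    using that top by (simp add: \<alpha>_def char_map_def)
  have \<alpha>j: "\<alpha> \<cdot>\<^bsub>Top\<^esub> ?j = cell_left ?j"
  proof (rule Top_eqI)
    fix y assume "y \<in> topspace (src (\<alpha> \<cdot>\<^bsub>Top\<^esub> ?j))"
    then obtain x where x: "x \<in> rim n" "y = e x" using top \<alpha>_sel by auto
    have "mor (\<alpha> \<cdot>\<^bsub>Top\<^esub> ?j) y = mor \<alpha> (mor ?j y)"
      by (rule Top_comp_sel(3)) (use x top \<alpha>_sel in simp)
    then show "mor (\<alpha> \<cdot>\<^bsub>Top\<^esub> ?j) y = mor (cell_left ?j) y"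
      using x \<alpha>[of x] top by simp
  qed (use j cell_left_Arr[OF j] \<alpha>_Arr \<alpha>_sel in \<open>simp_all add: Top_Arr_comp\<close>)
  have R\<alpha>: "cell_right ?j \<cdot>\<^bsub>Top\<^esub> \<alpha> = Idn Top (tgt ?j)"
  proof (rule Top_eqI)
    fix y assume "y \<in> topspace (src (cell_right ?j \<cdot>\<^bsub>Top\<^esub> \<alpha>))"
    then obtain x where x: "x \<in> disk n" "y = e x" using top \<alpha>_sel by auto
    have "mor (cell_right ?j \<cdot>\<^bsub>Top\<^esub> \<alpha>) y = mor (cell_right ?j) (mor \<alpha> y)"
      by (rule Top_comp_sel(3)) (use x top \<alpha>_sel in simp)
    also have "\<dots> = e x"
      using x \<alpha>[of x] cells_char_map[OF c x(1)] proj_char_map[OF c, of x] by (simp del: char_map_rim char_map_int)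
    finally show "mor (cell_right ?j \<cdot>\<^bsub>Top\<^esub> \<alpha>) y = mor (Idn Top (tgt ?j)) y"
      using x top by simp
  qed (use j cell_right_Arr[OF j] T.idn_closed(1)[of "tgt ?j"] \<alpha>_Arr \<alpha>_sel in \<open>simp_all add: Top_Arr_comp Arr_Top_iff[of ?j]\<close>)
  obtain D E where DE: "D \<in> cellular ?j (cell_left ?j)" "E \<in> cellular ?j (cell_left ?j)"
    "\<And>x. x \<in> topspace (src ?j) \<Longrightarrow> mor D (base_pt x) = base_pt x"
    "\<And>p. p \<in> points (src ?j) (cells ?j) \<Longrightarrow> proj (mor (cell_left ?j)) (mor D p) = p"
    "\<And>x. x \<in> topspace (src ?j) \<Longrightarrow> mor E (base_pt x) = base_pt x"
    "\<And>p. p \<in> points (src ?j) (cells ?j) \<Longrightarrow> proj (mor (cell_left ?j)) (mor E p) = mor \<alpha> (proj (mor ?j) p)"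
    "left_map_structure Top cell_awfs ?j \<alpha> \<longleftrightarrow>
      (\<forall>y \<in> topspace (tgt ?j). mor D (mor \<alpha> y) = mor E (mor \<alpha> y))"
    by (rule left_map_structure_pointwise[OF j \<alpha>_Arr \<alpha>_sel \<alpha>j R\<alpha>], rule that, assumption+)
  have "mor D (char_map n ?a ?b x) = mor E (char_map n ?a ?b x)" if x: "x \<in> disk n" for x
  proof (rule cellular_eq_char_map[OF DE(1,2) c _ _ x])
    show "mor D (?a x) = mor E (?a x)" if "x \<in> rim n" for x
      using that top DE(3,5)[of "e x"] by simp
    show "proj (mor (cell_left ?j)) (mor D (char_map n ?a ?b x)) = proj (mor (cell_left ?j)) (mor E (char_map n ?a ?b x))"
      if x: "x \<in> disk n" for x
      using DE(4,6)[OF cells_char_map[OF c x]] proj_char_map[OF c, of x] x \<alpha>[OF x] by (simp del: char_map_rim char_map_int)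
  qed
  then have "left_map_structure Top cell_awfs ?j \<alpha>"
    unfolding DE(7) top using \<alpha> by (auto simp del: char_map_rim char_map_int)
  then show ?thesis by blast
qed

text \<open>The preimage of \<open>K\<close> in a cell outside \<open>Q\<close> is contained in the boundary sphere. It is the
  preimage of \<open>K\<close> under the attaching map, which is continuous into a subcomplex where \<open>K\<close> is
  closed by induction.\<close>

lemma closedin_subcomplex:
  assumes Q: "Q \<subseteq> cells (f :: 'u top_map)" "subcomplex (src f) Q" and K: "closedin (weak_top (src f) Q) K"
  shows "closedin (cell_space f) K"
proof -
  have K': "K \<subseteq> points (src f) Q" "closedin (src f) {x \<in> topspace (src f). base_pt x \<in> K}"
    "\<And>n a b. (n, a, b) \<in> Q \<Longrightarrow> closedin (disc n) {x \<in> disk n. char_map n a b x \<in> K}"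
    using K closedin_weak_top[OF Q(2)] by auto
  have "case c of (n, a, b) \<Rightarrow> closedin (disc n) {x \<in> disk n. char_map n a b x \<in> K}" if "c \<in> cells f" for c
    using that
  proof (induction rule: cells.induct)
    case (attach Q' n a b)
    show ?case
    proof (cases "(n, a, b) \<in> Q")
      case True
      then show ?thesis using K'(3) by simp
    next
      case False
      \<comment> \<open>An interior point of a cell outside \<open>Q\<close> is not a point of \<open>K\<close>, by injectivity of \<open>cell_pt\<close>.\<close>
      then have eq: "{x \<in> disk n. char_map n a b x \<in> K} = {x \<in> rim n. a x \<in> K}"
        using K'(1) by (auto simp: char_map_def split: if_splits)
      have a: "a x \<in> points (src f) Q'" if "x \<in> rim n" for x
        using attach(3,2) that by (auto simp: continuous_map_def rim_def)
      have "closedin (weak_top (src f) Q') (K \<inter> points (src f) Q')"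
        unfolding closedin_weak_top[OF attach(2)]
      proof (intro conjI allI impI)
        show "closedin (src f) {x \<in> topspace (src f). base_pt x \<in> K \<inter> points (src f) Q'}"
          using K'(2) by (rule back_subst[of "closedin (src f)"]) auto
        fix n a b assume c: "(n, a, b) \<in> Q'"
        have "closedin (disc n) {x \<in> disk n. char_map n a b x \<in> K}"
          using attach.IH[OF c] by (simp only: prod.case)
        then show "closedin (disc n) {x \<in> disk n. char_map n a b x \<in> K \<inter> points (src f) Q'}"
          by (rule back_subst[of "closedin (disc n)"]) (use char_map_points[OF attach(2) c] in auto)
      qed auto
      then have "closedin (bdry_sphere n) {x \<in> topspace (bdry_sphere n). a x \<in> K \<inter> points (src f) Q'}"
        by (rule closedin_continuous_map_preimage[OF attach(3)])
      then have "closedin (bdry_sphere n) {x \<in> rim n. a x \<in> K}"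
        by (rule back_subst[of "closedin (bdry_sphere n)"]) (use a in \<open>auto simp: rim_def\<close>)
      then show ?thesis
        unfolding prod.case eq using closedin_rim[of n] by (simp add: bdry_sphere_eq closedin_closed_subtopology)
    qed
  qed
  then have "closedin (disc n) {x \<in> disk n. char_map n a b x \<in> K}" if "(n, a, b) \<in> cells f" for n a b
    using that by fastforce
  then show ?thesis
    using K'(2) subset_trans[OF K'(1) points_mono[OF Q(1)]] by (simp add: closedin_weak_top)
qed

lemma weak_top_eq_subtopology:
  assumes Q: "Q \<subseteq> cells (f :: 'u top_map)" "subcomplex (src f) Q"
  shows "weak_top (src f) Q = subtopology (cell_space f) (points (src f) Q)"
proof -
  have "closedin (weak_top (src f) Q) K \<longleftrightarrow> closedin (subtopology (cell_space f) (points (src f) Q)) K" for K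
  proof
    assume K: "closedin (weak_top (src f) Q) K"
    then have "K \<subseteq> points (src f) Q" using closedin_subset Q(2) by fastforce
    then show "closedin (subtopology (cell_space f) (points (src f) Q)) K"
      using closedin_subcomplex[OF Q K] by (auto simp: closedin_subtopology)
  next
    assume "closedin (subtopology (cell_space f) (points (src f) Q)) K"
    then obtain T where T: "closedin (cell_space f) T" "K = T \<inter> points (src f) Q"
      by (auto simp: closedin_subtopology)
    note T' = T(1)[unfolded closedin_weak_top[OF subcomplex_cells]]
    show "closedin (weak_top (src f) Q) K"
      unfolding closedin_weak_top[OF Q(2)]
    proof (intro conjI allI impI)
      show "closedin (src f) {x \<in> topspace (src f). base_pt x \<in> K}"
        using conjunct1[OF conjunct2[OF T']] by (rule back_subst[of "closedin (src f)"]) (use T(2) in auto)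
      fix n a b assume c: "(n, a, b) \<in> Q"
      then have "closedin (disc n) {x \<in> disk n. char_map n a b x \<in> T}" using T' Q(1) by blast
      then show "closedin (disc n) {x \<in> disk n. char_map n a b x \<in> K}"
        by (rule back_subst[of "closedin (disc n)"]) (use T(2) char_map_points[OF Q(2) c] in auto)
    qed (use T(2) in auto)
  qed
  moreover have "topspace (weak_top (src f) Q) = topspace (subtopology (cell_space f) (points (src f) Q))"
    using Q points_mono[OF Q(1)] by auto
  ultimately show ?thesis unfolding topology_eq openin_closedin_eq by simp
qed


text \<open>Suppose that \<open>\<alpha> y\<close> lies in the cell \<open>(n, a, b)\<close>. Comultiplication maps it into the cell over the
  characteristic map of \<open>(n, a, b)\<close>, and \<open>M (1, \<alpha>)\<close> maps it into the cell over \<open>\<alpha> \<circ> b\<close>. The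
  coalgebra law identifies the two.\<close>

lemma coalgebra_subcomplex:
  assumes lm: "left_map_structure Top cell_awfs f \<alpha>"
  obtains Q where "Q \<subseteq> cells f" "subcomplex (src f) Q" "points (src f) Q = mor \<alpha> ` topspace (tgt f)"
proof -
  note LM = left_map_structureD[OF lm]
  obtain D E where DE: "D \<in> cellular f (cell_left f)" "E \<in> cellular f (cell_left f)"
    "\<And>x. x \<in> topspace (src f) \<Longrightarrow> mor D (base_pt x) = base_pt x"
    "\<And>p. p \<in> points (src f) (cells f) \<Longrightarrow> proj (mor (cell_left f)) (mor D p) = p"
    "\<And>x. x \<in> topspace (src f) \<Longrightarrow> mor E (base_pt x) = base_pt x"
    "\<And>p. p \<in> points (src f) (cells f) \<Longrightarrow> proj (mor (cell_left f)) (mor E p) = mor \<alpha> (proj (mor f) p)"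
    "left_map_structure Top cell_awfs f \<alpha> \<longleftrightarrow>
      (\<forall>y \<in> topspace (tgt f). mor D (mor \<alpha> y) = mor E (mor \<alpha> y))"
    by (rule left_map_structure_pointwise[OF LM], rule that, assumption+)
  have \<alpha>_points: "mor \<alpha> y \<in> points (src f) (cells f)" if "y \<in> topspace (tgt f)" for y
    using mor_in[OF LM(2), of y] LM(3,4) that by simp
  have \<alpha>_f: "mor \<alpha> (mor f x) = base_pt x" if "x \<in> topspace (src f)" for x
    using arg_cong[OF LM(5), of "\<lambda>h. mor h x"] that by simp
  have char_map_\<alpha>: "char_map n a b x = mor \<alpha> (b x)"
    if y: "y \<in> topspace (tgt f)" "mor \<alpha> y = cell_pt n a b d" and x: "x \<in> disk n" for n a b d x y
  proof -
    have c: "(n, a, b) \<in> cells f" and d: "d \<in> disk n" "d \<notin> rim n"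
      using \<alpha>_points[OF y(1)] y(2) by simp_all
    have "mor D (cell_pt n a b d) = mor E (cell_pt n a b d)"
      using lm y unfolding DE(7) by metis
    then have "restrict (proj (mor (cell_left f)) \<circ> mor D \<circ> char_map n a b) (disk n) =
        restrict (proj (mor (cell_left f)) \<circ> mor E \<circ> char_map n a b) (disk n)"
      using cellular_D(4)[OF DE(1) c d] cellular_D(4)[OF DE(2) c d] by simp
    from fun_cong[OF this, of x] show ?thesis
      using x DE(4,6)[OF cells_char_map[OF c x]] proj_char_map[OF c] by (simp del: char_map_rim char_map_int)
  qed
  define Q where "Q = {(n, a, b). \<exists>y \<in> topspace (tgt f). \<exists>d. mor \<alpha> y = cell_pt n a b d}"
  have Q: "Q \<subseteq> cells f"
    using \<alpha>_points by (fastforce simp: Q_def)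
  have char_map_Q: "char_map n a b x \<in> mor \<alpha> ` topspace (tgt f)" if c: "(n, a, b) \<in> Q" and x: "x \<in> disk n" for n a b x
  proof -
    have "b x \<in> topspace (tgt f)"
      using cellsD(2)[of n a b f] Q c x by (auto simp: continuous_map_def disk_def)
    then show ?thesis using c x char_map_\<alpha> by (auto simp: Q_def)
  qed
  have P: "mor \<alpha> ` topspace (tgt f) \<subseteq> points (src f) Q"
  proof
    fix p assume "p \<in> mor \<alpha> ` topspace (tgt f)"
    then obtain y where y: "y \<in> topspace (tgt f)" "p = mor \<alpha> y" by blast
    show "p \<in> points (src f) Q"
      using \<alpha>_points[OF y(1)]
    proof (cases rule: points_cases)
      case (1 x)
      then show ?thesis by (simp add: y(2))
    next
      case (2 n a b d)
      then show ?thesis using y by (auto simp: Q_def)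
    qed
  qed
  have "subcomplex (src f) Q"
    unfolding subcomplex_def
  proof (intro allI impI)
    fix n a b x assume c: "(n, a, b) \<in> Q" and x: "x \<in> rim n"
    have "a x \<in> mor \<alpha> ` topspace (tgt f)" using char_map_Q[OF c, of x] x by simp
    then show "a x \<in> points (src f) Q" using P by blast
  qed
  moreover have "points (src f) Q \<subseteq> mor \<alpha> ` topspace (tgt f)"
  proof
    fix p assume "p \<in> points (src f) Q"
    then show "p \<in> mor \<alpha> ` topspace (tgt f)"
    proof (cases rule: points_cases)
      case (1 x)
      then show ?thesis using \<alpha>_f[of x] mor_in[OF LM(1), of x] by (metis imageI)
    next
      case (2 n a b d)
      then show ?thesis using char_map_Q[OF 2(1,2)] by simp
    qed
  qed
  ultimately show ?thesis using that[of Q] Q P by blast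
qed

end

section \<open>Attaching a single cell\<close>

lemma (in category) is_pushout_isomorphism:
  assumes g: "g \<in> Hom C A B" and f: "f \<in> Hom C X Y"
    and u: "u \<in> Hom C A X" "u' \<in> Hom C X A" "u' \<cdot> u = Idn C A" "u \<cdot> u' = Idn C X"
    and v: "v \<in> Hom C B Y" "v' \<in> Hom C Y B" "v' \<cdot> v = Idn C B" "v \<cdot> v' = Idn C Y"
    and sq: "f \<cdot> u = v \<cdot> g"
  shows "is_pushout C g u v f"
  unfolding is_pushout_def
proof (intro conjI ballI impI)
  note H = g f u(1,2) v(1,2)
  have v'f: "v' \<cdot> f = g \<cdot> u'"
  proof -
    have "v' \<cdot> f = v' \<cdot> (f \<cdot> (u \<cdot> u'))" using H u(4) by (simp add: Hom_def)
    also have "\<dots> = v' \<cdot> ((v \<cdot> g) \<cdot> u')" using H sq by (simp add: Hom_def flip: sq)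
    also have "\<dots> = (v' \<cdot> v) \<cdot> (g \<cdot> u')" using H by (simp add: Hom_def)
    also have "\<dots> = g \<cdot> u'" using H v(3) by (simp add: Hom_def del: assoc)
    finally show ?thesis .
  qed
  fix Z p q assume "p \<in> Hom C (Cod C u) Z" and "q \<in> Hom C (Cod C g) Z" and pq: "p \<cdot> u = q \<cdot> g"
  then have p: "p \<in> Hom C X Z" and q: "q \<in> Hom C B Z" using H by (auto simp: Hom_def)
  show "\<exists>!h. h \<in> Hom C (Cod C f) Z \<and> h \<cdot> f = p \<and> h \<cdot> v = q"
  proof (rule ex1I[of _ "q \<cdot> v'"], intro conjI)
    have "(q \<cdot> v') \<cdot> f = q \<cdot> (g \<cdot> u')" using H p q v'f by (simp add: Hom_def)
    also have "\<dots> = (p \<cdot> u) \<cdot> u'" using H p q pq by (simp add: Hom_def flip: assoc)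
    also have "\<dots> = p" using H p u(4) by (simp add: Hom_def)
    finally show "(q \<cdot> v') \<cdot> f = p" .
    show "(q \<cdot> v') \<cdot> v = q" using H q v(3) by (simp add: Hom_def)
    show "q \<cdot> v' \<in> Hom C (Cod C f) Z" using H q by (simp add: Hom_def)
    fix h assume "h \<in> Hom C (Cod C f) Z \<and> h \<cdot> f = p \<and> h \<cdot> v = q"
    then show "h = q \<cdot> v'" using H v(4) by (auto simp: Hom_def)
  qed
qed (use assms in \<open>simp_all add: Hom_def\<close>)

text \<open>Below, the stage at an index collects what is attached strictly before it. What is attached at a
  last index would therefore be missing from every stage; an additional top element provides the
  stage that contains it.\<close>

lemma Well_order_add_top:
  assumes r: "Well_order r" and t: "t \<notin> Field r"
  defines "r' \<equiv> r \<union> insert t (Field r) \<times> {t}"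
  shows "Well_order r'" "Field r' = insert t (Field r)" "underS r' t = Field r"
    "i \<in> Field r \<Longrightarrow> underS r' i = underS r i"
proof -
  show F: "Field r' = insert t (Field r)" by (auto simp: r'_def Field_def)
  show "underS r' t = Field r" using t by (auto simp: r'_def underS_def Field_def)
  show "underS r' i = underS r i" if "i \<in> Field r"
    using that t by (auto simp: r'_def underS_def)
  have lin: "refl_on (Field r) r" "trans r" "antisym r" "total_on (Field r) r" "wf (r - Id)"
    using r by (auto simp: well_order_on_def linear_order_on_def partial_order_on_def preorder_on_def)
  have "trans r'"
    using lin(2) t by (auto simp: r'_def trans_def Field_def)
  moreover have "refl_on (Field r') r'"
    using lin(1) unfolding F by (auto simp: r'_def refl_on_def Field_def)
  moreover have "antisym r'" using lin(3) t by (auto simp: r'_def antisym_def Field_def)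
  moreover have "total_on (Field r') r'" using lin(4) unfolding F by (auto simp: r'_def total_on_def)
  moreover have "wf (r' - Id)"
  proof -
    have "wf ((r - Id) \<union> Field r \<times> {t})"
    proof (rule wf_Un[OF lin(5)])
      show "wf (Field r \<times> {t})"
      proof (rule wfUNIVI)
        fix P x assume *: "\<forall>x. (\<forall>y. (y, x) \<in> Field r \<times> {t} \<longrightarrow> P y) \<longrightarrow> P x"
        have P: "P y" if "y \<noteq> t" for y using * that by blast
        have "\<forall>y. (y, x) \<in> Field r \<times> {t} \<longrightarrow> P y"
        proof (intro allI impI)
          fix y assume "(y, x) \<in> Field r \<times> {t}"
          then have "y \<noteq> t" using t by auto
          then show "P y" by (rule P)
        qed
        then show "P x" using * by blast
      qed
      show "Domain (r - Id) \<inter> Range (Field r \<times> {t}) = {}" using t by (auto simp: Field_def)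
    qed
    moreover have "r' - Id \<subseteq> (r - Id) \<union> Field r \<times> {t}" by (auto simp: r'_def)
    ultimately show ?thesis by (rule wf_subset)
  qed
  moreover have "r' \<subseteq> Field r' \<times> Field r'" by (auto simp: Field_def)
  ultimately show "Well_order r'"
    by (simp add: well_order_on_def linear_order_on_def partial_order_on_def preorder_on_def)
qed

definition subcomplex_of :: "'u top_map \<Rightarrow> 'u cell_data set \<Rightarrow> bool"
  where "subcomplex_of f Q \<longleftrightarrow> Q \<subseteq> cells f \<and> subcomplex (src f) Q"

definition incl :: "'u top_map \<Rightarrow> 'u cell_data set \<Rightarrow> 'u cell_data set \<Rightarrow> 'u top_map"
  where "incl f Q Q' = Arrow (weak_top (src f) Q) (weak_top (src f) Q') (\<lambda>p \<in> points (src f) Q. p)"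

lemma incl_sel [simp]:
  "src (incl f Q Q') = weak_top (src f) Q" "tgt (incl f Q Q') = weak_top (src f) Q'"
  "p \<in> points (src f) Q \<Longrightarrow> mor (incl f Q Q') p = p"
  by (simp_all add: incl_def)

lemma subcomplex_of_topspace [simp]: "subcomplex_of f Q \<Longrightarrow> topspace (weak_top (src f) Q) = points (src f) Q"
  by (simp add: subcomplex_of_def)

lemma subcomplex_Union: "(\<And>Q. Q \<in> \<Q> \<Longrightarrow> subcomplex X Q) \<Longrightarrow> subcomplex X (\<Union>\<Q>)"
  unfolding subcomplex_def using points_mono[of _ "\<Union>\<Q>" X] by (meson Union_iff Union_upper subsetD)

lemma subcomplex_of_Union: "(\<And>Q. Q \<in> \<Q> \<Longrightarrow> subcomplex_of f Q) \<Longrightarrow> subcomplex_of f (\<Union>\<Q>)"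
  unfolding subcomplex_of_def using subcomplex_Union by blast

lemma subcomplex_of_empty: "subcomplex_of f {}"
  by (simp add: subcomplex_of_def subcomplex_def)

lemma incl_refl: "subcomplex_of f Q \<Longrightarrow> incl f Q Q = Idn Top (weak_top (src f) Q)"
  by (simp add: incl_def)

context universe
begin

lemma small_weak_top:
  assumes "(f :: 'u top_map) \<in> Arr Top" "subcomplex_of f Q"
  shows "small (topspace (weak_top (src f) Q))"
  using small_subset[OF small_cell_space[of f], of "points (src f) Q"] assms points_mono[of Q "cells f"]
  by (simp add: subcomplex_of_def Arr_Top_iff)

lemma incl_Arr:
  assumes f: "(f :: 'u top_map) \<in> Arr Top" and Q: "subcomplex_of f Q" "subcomplex_of f Q'" "Q \<subseteq> Q'"
  shows "incl f Q Q' \<in> Arr Top"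
proof -
  have "continuous_map (weak_top (src f) Q) (weak_top (src f) Q') (\<lambda>p. p)"
    using Q by (intro continuous_weak_topI continuous_base_pt continuous_char_map) (auto simp: subcomplex_of_def)
  from restrict_Arr_Top[OF this small_weak_top[OF f Q(1)] small_weak_top[OF f Q(2)]]
  show ?thesis by (simp add: incl_def Q)
qed

lemma incl_comp:
  assumes f: "(f :: 'u top_map) \<in> Arr Top" and Q: "subcomplex_of f Q" "subcomplex_of f Q'" "subcomplex_of f Q''" "Q \<subseteq> Q'" "Q' \<subseteq> Q''"
  shows "incl f Q' Q'' \<cdot>\<^bsub>Top\<^esub> incl f Q Q' = incl f Q Q''"
proof (rule Top_eqI)
  have "Q \<subseteq> Q''" using Q by blast
  then show "incl f Q' Q'' \<cdot>\<^bsub>Top\<^esub> incl f Q Q' \<in> Arr Top" "incl f Q Q'' \<in> Arr Top"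
    using incl_Arr[OF f] Q by (simp_all add: Top_Arr_comp)
qed (use Q points_mono[OF Q(4), of "src f"] in auto)

lemma continuous_attaching_subcomplex:
  assumes Q: "subcomplex_of f Q" and c: "(n, a, b) \<in> cells (f :: 'u top_map)"
    and a: "\<And>x. x \<in> rim n \<Longrightarrow> a x \<in> points (src f) Q"
  shows "continuous_map (bdry_sphere n) (weak_top (src f) Q) a"
  using weak_top_eq_subtopology[of Q f] Q continuous_attaching[OF c] a
  by (auto simp: subcomplex_of_def rim_def continuous_map_in_subtopology)

lemma subcomplex_of_insert:
  assumes Q: "subcomplex_of f Q" and c: "(n, a, b) \<in> cells (f :: 'u top_map)"
    and a: "\<And>x. x \<in> rim n \<Longrightarrow> a x \<in> points (src f) Q"
  shows "subcomplex_of f (insert (n, a, b) Q)"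
proof -
  have "points (src f) Q \<subseteq> points (src f) (insert (n, a, b) Q)" by (rule points_mono) blast
  then show ?thesis using assms unfolding subcomplex_of_def subcomplex_def by blast
qed

text \<open>The map out of the pushout is defined by cases. The choice of \<open>d\<close> recovers the coordinate of an
  interior point of the new cell, which is unique because \<open>cell_pt\<close> is injective.\<close>

lemma attach_cell_pushout:
  assumes f: "(f :: 'u top_map) \<in> Arr Top" and Q: "subcomplex_of f Q" and c: "(n, a, b) \<in> cells f" "(n, a, b) \<notin> Q"
    and a: "\<And>x. x \<in> rim n \<Longrightarrow> a x \<in> points (src f) Q"
  shows "\<exists>u v. is_pushout Top (sphere_inclusion e n) u v (incl f Q (insert (n, a, b) Q))"
proof -
  let ?Q' = "insert (n, a, b) Q" and ?j = "sphere_inclusion e n"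
  have Q': "subcomplex_of f ?Q'" by (rule subcomplex_of_insert[OF Q c(1) a])
  have j: "?j \<in> Arr Top" using sphere_inclusions_Arr[OF universe_axioms] by (auto simp: sphere_inclusions_def)
  have top: "topspace (src ?j) = e ` rim n" "topspace (tgt ?j) = e ` disk n"
    by (simp_all add: topspace_transport disk_def rim_def)
  define u where "u = Arrow (src ?j) (weak_top (src f) Q) (restrict (a \<circ> inv e) (topspace (src ?j)))"
  define v where "v = Arrow (tgt ?j) (weak_top (src f) ?Q') (restrict (char_map n a b \<circ> inv e) (topspace (tgt ?j)))"
  have ie: "h \<circ> inv e \<circ> e = h" for h :: "point \<Rightarrow> 'u" by (simp add: fun_eq_iff)
  have u: "u \<in> Arr Top" "src u = src ?j" "tgt u = weak_top (src f) Q" "\<And>x. x \<in> rim n \<Longrightarrow> mor u (e x) = a x"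
    and v: "v \<in> Arr Top" "src v = tgt ?j" "tgt v = weak_top (src f) ?Q'" "\<And>x. x \<in> disk n \<Longrightarrow> mor v (e x) = char_map n a b x"
  proof -
    have "continuous_map (src ?j) (weak_top (src f) Q) (a \<circ> inv e)"
      using continuous_attaching_subcomplex[OF Q c(1) a] by (simp add: continuous_transport_iff ie)
    then show "u \<in> Arr Top"
      unfolding u_def using small_disc(2)[of n] small_weak_top[OF f Q] by (intro restrict_Arr_Top) (simp_all only: top)
    have "continuous_map (tgt ?j) (weak_top (src f) ?Q') (char_map n a b \<circ> inv e)"
      using continuous_char_map[of "src f" ?Q' n a b] Q' by (simp add: continuous_transport_iff ie subcomplex_of_def)
    then show "v \<in> Arr Top"
      unfolding v_def using small_disc(1)[of n] small_weak_top[OF f Q'] by (intro restrict_Arr_Top) (simp_all only: top)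
  qed (use top in \<open>simp_all add: u_def v_def char_map_def\<close>)
  have i: "incl f Q ?Q' \<in> Arr Top" by (rule incl_Arr[OF f Q Q']) blast
  have sq: "incl f Q ?Q' \<cdot>\<^bsub>Top\<^esub> u = v \<cdot>\<^bsub>Top\<^esub> ?j"
  proof (rule Top_eqI)
    fix y assume "y \<in> topspace (src (incl f Q ?Q' \<cdot>\<^bsub>Top\<^esub> u))"
    then obtain x where x: "x \<in> rim n" "y = e x" using u(2) top by auto
    then have "y \<in> topspace (src u)" "y \<in> topspace (src ?j)" using u(2) top by auto
    then have "mor (incl f Q ?Q' \<cdot>\<^bsub>Top\<^esub> u) y = mor (incl f Q ?Q') (mor u y)"
      "mor (v \<cdot>\<^bsub>Top\<^esub> ?j) y = mor v (mor ?j y)"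
      by (simp_all only: Top_comp_sel(3))
    then show "mor (incl f Q ?Q' \<cdot>\<^bsub>Top\<^esub> u) y = mor (v \<cdot>\<^bsub>Top\<^esub> ?j) y"
      using x u(4)[of x] v(4)[of x] a[of x] by simp
  qed (use u v i j in \<open>simp_all add: Top_Arr_comp\<close>)
  have "is_pushout Top ?j u v (incl f Q ?Q')"
    unfolding is_pushout_def
  proof (intro conjI ballI impI)
    fix Z p q
    assume Z: "Z \<in> Obj Top" and p': "p \<in> Hom Top (Cod Top u) Z" and q': "q \<in> Hom Top (Cod Top ?j) Z"
      and pq: "p \<cdot>\<^bsub>Top\<^esub> u = q \<cdot>\<^bsub>Top\<^esub> ?j"
    have p: "p \<in> Arr Top" "src p = weak_top (src f) Q" "tgt p = Z" using p' u(3) by (auto simp: Hom_def)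
    have q: "q \<in> Arr Top" "src q = tgt ?j" "tgt q = Z" using q' by (auto simp: Hom_def)
    have pa: "mor p (a x) = mor q (e x)" if x: "x \<in> rim n" for x
    proof -
      have "e x \<in> topspace (src u)" "e x \<in> topspace (src ?j)" using u(2) top x by auto
      then have "mor (p \<cdot>\<^bsub>Top\<^esub> u) (e x) = mor p (mor u (e x))" "mor (q \<cdot>\<^bsub>Top\<^esub> ?j) (e x) = mor q (mor ?j (e x))"
        by (simp_all only: Top_comp_sel(3))
      then show ?thesis using pq x u(4) by simp
    qed
    define k where "k z = (if z \<in> points (src f) Q then mor p z else mor q (e (SOME d. z = cell_pt n a b d)))" for z
    have kQ: "k z = mor p z" if "z \<in> points (src f) Q" for z using that by (simp add: k_def)
    have kc: "k (char_map n a b x) = mor q (e x)" if x: "x \<in> disk n" for x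
      using pa[of x] a[of x] c(2) by (cases "x \<in> rim n") (simp_all add: k_def)
    have cont: "continuous_map (weak_top (src f) ?Q') Z k"
    proof (rule continuous_weak_topI)
      have pc: "continuous_map (weak_top (src f) Q) Z (mor p)" using p by (auto simp: Arr_Top_iff)
      show "continuous_map (src f) Z (\<lambda>x. k (base_pt x))"
        by (rule continuous_map_eq[OF continuous_map_compose[OF continuous_base_pt pc]]) (use Q kQ in \<open>auto simp: subcomplex_of_def\<close>)
      fix m a' b' assume "(m, a', b') \<in> ?Q'"
      then consider "(m, a', b') \<in> Q" | "m = n" "a' = a" "b' = b" by auto
      then show "continuous_map (disc m) Z (\<lambda>x. k (char_map m a' b' x))"
      proof cases
        case 1
        have Qs: "subcomplex (src f) Q" using Q by (simp add: subcomplex_of_def)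
        show ?thesis
          by (rule continuous_map_eq[OF continuous_map_compose[OF continuous_char_map[OF Qs 1] pc]])
            (simp add: kQ char_map_points[OF Qs 1] disk_def[symmetric] del: char_map_rim char_map_int)
      next
        case 2
        have "continuous_map (disc n) Z (mor q \<circ> e)"
          using q by (auto simp: Arr_Top_iff continuous_transport_iff)
        then show ?thesis
          unfolding 2 by (rule continuous_map_eq) (simp add: kc disk_def[symmetric] del: char_map_rim char_map_int)
      qed
    qed (use Q' in \<open>simp add: subcomplex_of_def\<close>)
    let ?h = "Arrow (weak_top (src f) ?Q') Z (restrict k (topspace (weak_top (src f) ?Q')))"
    have h: "?h \<in> Arr Top"
      using cont small_weak_top[OF f Q'] Z by (intro restrict_Arr_Top) simp_all
    have mono: "z \<in> points (src f) ?Q'" if "z \<in> points (src f) Q" for z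
      using that points_mono[of Q ?Q' "src f"] by blast
    have hk: "mor ?h z = k z" if "z \<in> points (src f) ?Q'" for z using that Q' by simp
    have chi': "char_map n a b x \<in> points (src f) ?Q'" if "x \<in> disk n" for x
      using char_map_points[of "src f" ?Q' n a b x] Q' that by (simp add: subcomplex_of_def)
    have comp_i: "mor (h \<cdot>\<^bsub>Top\<^esub> incl f Q ?Q') z = mor h z" if "z \<in> points (src f) Q" for h z
      using that Q by simp
    have comp_v: "mor (h \<cdot>\<^bsub>Top\<^esub> v) (e x) = mor h (char_map n a b x)" if "x \<in> disk n" for h x
    proof -
      have "mor (h \<cdot>\<^bsub>Top\<^esub> v) (e x) = mor h (mor v (e x))"
        by (rule Top_comp_sel(3)) (use v(2) top that in auto)
      then show ?thesis using v(4)[OF that] by simp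
    qed
    show "\<exists>!h. h \<in> Hom Top (Cod Top (incl f Q ?Q')) Z \<and> h \<cdot>\<^bsub>Top\<^esub> incl f Q ?Q' = p \<and> h \<cdot>\<^bsub>Top\<^esub> v = q"
    proof (rule ex1I[of _ ?h], intro conjI)
      show "?h \<in> Hom Top (Cod Top (incl f Q ?Q')) Z" using h by (simp add: Hom_def)
      show "?h \<cdot>\<^bsub>Top\<^esub> incl f Q ?Q' = p"
      proof (rule Top_eqI)
        fix z assume "z \<in> topspace (src (?h \<cdot>\<^bsub>Top\<^esub> incl f Q ?Q'))"
        then have "z \<in> points (src f) Q" using Q by simp
        then show "mor (?h \<cdot>\<^bsub>Top\<^esub> incl f Q ?Q') z = mor p z"
          using comp_i[of z ?h] hk[OF mono] kQ by (simp del: arrow.sel)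
      qed (use h i p in \<open>simp_all add: Top_Arr_comp\<close>)
      show "?h \<cdot>\<^bsub>Top\<^esub> v = q"
      proof (rule Top_eqI)
        fix y assume "y \<in> topspace (src (?h \<cdot>\<^bsub>Top\<^esub> v))"
        then obtain x where x: "x \<in> disk n" "y = e x" using v(2) top by auto
        then show "mor (?h \<cdot>\<^bsub>Top\<^esub> v) y = mor q y"
          using comp_v[of x ?h] hk[OF chi'] kc by (simp del: arrow.sel char_map_rim char_map_int)
      qed (use h v q in \<open>simp_all add: Top_Arr_comp\<close>)
      fix h' assume "h' \<in> Hom Top (Cod Top (incl f Q ?Q')) Z \<and> h' \<cdot>\<^bsub>Top\<^esub> incl f Q ?Q' = p \<and> h' \<cdot>\<^bsub>Top\<^esub> v = q"
      then have h': "h' \<in> Arr Top" "src h' = weak_top (src f) ?Q'" "tgt h' = Z"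
        "h' \<cdot>\<^bsub>Top\<^esub> incl f Q ?Q' = p" "h' \<cdot>\<^bsub>Top\<^esub> v = q" by (auto simp: Hom_def)
      show "h' = ?h"
      proof (rule Top_eqI[OF h'(1) h])
        fix z assume "z \<in> topspace (src h')"
        then have z: "z \<in> points (src f) ?Q'" using h'(2) Q' by simp
        have "mor h' z = k z"
        proof (cases "z \<in> points (src f) Q")
          case True
          then show ?thesis using comp_i[of z h'] h'(4) kQ by simp
        next
          case False
          with z obtain d where "z = cell_pt n a b d" "d \<in> disk n" "d \<notin> rim n"
            by (cases rule: points_cases) auto
          then show ?thesis using comp_v[of d h'] h'(5) kc[of d] by simp
        qed
        then show "mor h' z = mor ?h z" using hk[OF z] by simp
      qed (use h' in simp_all)
    qed
  qed (use u v i j sq in simp_all)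
  then show ?thesis by blast
qed

end

section \<open>Transfinite attachment of cells\<close>

definition attachable :: "((nat \<Rightarrow> real) \<Rightarrow> 'u) \<Rightarrow> 'u top_map \<Rightarrow> 'u cell_data set \<Rightarrow> 'u cell_data set \<Rightarrow> bool"
  where "attachable e f Q Q' \<longleftrightarrow> subcomplex_of f Q' \<and> incl f Q Q' \<in> cell (sphere_inclusions e)"

context universe
begin

text \<open>A union of a chain of subcomplexes carries the final topology of its members, because each of
  its cells lies in one of them. The chain is nonempty, so that the base is covered as well.\<close>

lemma chain_colimit:
  fixes f :: "'u top_map" and stage :: "'i \<Rightarrow> 'u cell_data set"
  assumes f: "f \<in> Arr Top" and K: "K \<noteq> {}" "\<And>i j. i \<in> K \<Longrightarrow> j \<in> K \<Longrightarrow> (i, j) \<in> r \<or> (j, i) \<in> r"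
    and stage: "\<And>i. i \<in> K \<Longrightarrow> subcomplex_of f (stage i)" "\<And>i j. i \<in> K \<Longrightarrow> j \<in> K \<Longrightarrow> (i, j) \<in> r \<Longrightarrow> stage i \<subseteq> stage j"
    and Q: "Q = (\<Union>i\<in>K. stage i)"
  shows "is_colimit Top K r (\<lambda>i. weak_top (src f) (stage i)) (\<lambda>i j. incl f (stage i) (stage j))
    (weak_top (src f) Q) (\<lambda>i. incl f (stage i) Q)"
  unfolding is_colimit_def
proof (intro conjI allI impI)
  have sQ: "subcomplex_of f Q" unfolding Q by (rule subcomplex_of_Union) (use stage in auto)
  then have sQ': "subcomplex (src f) Q" by (simp add: subcomplex_of_def)
  have sub: "stage i \<subseteq> Q" if "i \<in> K" for i using that Q by blast
  have i: "incl f (stage i) Q \<in> Arr Top" if "i \<in> K" for i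
    by (rule incl_Arr[OF f stage(1) sQ sub]) (use that in simp_all)
  show "is_cocone Top K r (\<lambda>i. weak_top (src f) (stage i)) (\<lambda>i j. incl f (stage i) (stage j))
    (weak_top (src f) Q) (\<lambda>i. incl f (stage i) Q)"
    unfolding is_cocone_def using small_weak_top[OF f sQ] i incl_comp[OF f stage(1) stage(1) sQ stage(2) sub]
    by (simp add: Hom_def)
  fix Z u assume co: "is_cocone Top K r (\<lambda>i. weak_top (src f) (stage i)) (\<lambda>i j. incl f (stage i) (stage j)) Z u"
  have Z: "small (topspace Z)" and u: "\<And>i. i \<in> K \<Longrightarrow> u i \<in> Arr Top" "\<And>i. i \<in> K \<Longrightarrow> src (u i) = weak_top (src f) (stage i)"
    "\<And>i. i \<in> K \<Longrightarrow> tgt (u i) = Z"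
    and uu: "\<And>i j. i \<in> K \<Longrightarrow> j \<in> K \<Longrightarrow> (i, j) \<in> r \<Longrightarrow> u j \<cdot>\<^bsub>Top\<^esub> incl f (stage i) (stage j) = u i"
    using co by (auto simp: is_cocone_def Hom_def)
  have uu': "mor (u i) p = mor (u j) p" if "i \<in> K" "j \<in> K" "(i, j) \<in> r" "p \<in> points (src f) (stage i)" for i j p
    using arg_cong[OF uu[OF that(1-3)], of "\<lambda>h. mor h p"] that(4) stage(1)[OF that(1)] by simp
  define k where "k p = mor (u (SOME i. i \<in> K \<and> p \<in> points (src f) (stage i))) p" for p
  have k: "k p = mor (u i) p" if i: "i \<in> K" "p \<in> points (src f) (stage i)" for i p
  proof -
    define j where "j = (SOME i. i \<in> K \<and> p \<in> points (src f) (stage i))"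
    have j: "j \<in> K" "p \<in> points (src f) (stage j)"
      unfolding j_def using someI[of "\<lambda>i. i \<in> K \<and> p \<in> points (src f) (stage i)" i] i by auto
    show ?thesis
      unfolding k_def j_def[symmetric] using K(2)[OF i(1) j(1)] uu' i j by metis
  qed
  have Q_points: "\<exists>i\<in>K. p \<in> points (src f) (stage i)" if "p \<in> points (src f) Q" for p
    using that
  proof (cases rule: points_cases)
    case (1 x)
    then show ?thesis using K(1) by auto
  next
    case (2 n a b d)
    then show ?thesis using Q by auto
  qed
  have cu: "continuous_map (weak_top (src f) (stage i)) Z (mor (u i))" if "i \<in> K" for i
    using u[OF that] by (simp add: Arr_Top_iff)
  have stage': "subcomplex (src f) (stage i)" if "i \<in> K" for i using stage(1)[OF that] by (simp add: subcomplex_of_def)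
  have cont: "continuous_map (weak_top (src f) Q) Z k"
  proof (rule continuous_weak_topI[OF sQ'])
    obtain i where i: "i \<in> K" using K(1) by blast
    show "continuous_map (src f) Z (\<lambda>x. k (base_pt x))"
      by (rule continuous_map_eq[OF continuous_map_compose[OF continuous_base_pt[OF stage'[OF i]] cu[OF i]]])
        (simp add: k[OF i])
    fix n a b assume "(n, a, b) \<in> Q"
    then obtain j where j: "j \<in> K" "(n, a, b) \<in> stage j" unfolding Q by blast
    show "continuous_map (disc n) Z (\<lambda>x. k (char_map n a b x))"
      by (rule continuous_map_eq[OF continuous_map_compose[OF continuous_char_map[OF stage'[OF j(1)] j(2)] cu[OF j(1)]]])
        (simp add: k[OF j(1)] char_map_points[OF stage'[OF j(1)] j(2)] disk_def[symmetric] del: char_map_rim char_map_int)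
  qed
  let ?h = "Arrow (weak_top (src f) Q) Z (restrict k (topspace (weak_top (src f) Q)))"
  have h: "?h \<in> Arr Top"
    using cont small_weak_top[OF f sQ] Z by (intro restrict_Arr_Top) simp_all
  have hk: "mor ?h p = k p" if "p \<in> points (src f) Q" for p using that sQ by simp
  have comp: "mor (h \<cdot>\<^bsub>Top\<^esub> incl f (stage i) Q) p = mor h p" if "i \<in> K" "p \<in> points (src f) (stage i)" for h i p
    using that stage(1) by simp
  show "\<exists>!h. h \<in> Hom Top (weak_top (src f) Q) Z \<and> (\<forall>i\<in>K. h \<cdot>\<^bsub>Top\<^esub> incl f (stage i) Q = u i)"
  proof (rule ex1I[of _ ?h], intro conjI ballI)
    show "?h \<in> Hom Top (weak_top (src f) Q) Z" using h by (simp add: Hom_def)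
    fix j assume j: "j \<in> K"
    show "?h \<cdot>\<^bsub>Top\<^esub> incl f (stage j) Q = u j"
    proof (rule Top_eqI)
      fix p assume "p \<in> topspace (src (?h \<cdot>\<^bsub>Top\<^esub> incl f (stage j) Q))"
      then have p: "p \<in> points (src f) (stage j)" using stage(1)[OF j] by simp
      then have "p \<in> points (src f) Q" using points_mono[OF sub[OF j], of "src f"] by blast
      then show "mor (?h \<cdot>\<^bsub>Top\<^esub> incl f (stage j) Q) p = mor (u j) p"
        using comp[OF j p, of ?h] hk k[OF j p] by (simp del: arrow.sel)
    qed (use h i[OF j] u[OF j] in \<open>simp_all add: Top_Arr_comp\<close>)
  next
    fix h' assume "h' \<in> Hom Top (weak_top (src f) Q) Z \<and> (\<forall>i\<in>K. h' \<cdot>\<^bsub>Top\<^esub> incl f (stage i) Q = u i)"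
    then have h': "h' \<in> Arr Top" "src h' = weak_top (src f) Q" "tgt h' = Z"
      "\<And>i. i \<in> K \<Longrightarrow> h' \<cdot>\<^bsub>Top\<^esub> incl f (stage i) Q = u i" by (auto simp: Hom_def)
    show "h' = ?h"
    proof (rule Top_eqI[OF h'(1) h])
      fix p assume "p \<in> topspace (src h')"
      then have p: "p \<in> points (src f) Q" using h'(2) sQ by simp
      then obtain i where i: "i \<in> K" "p \<in> points (src f) (stage i)" using Q_points by blast
      then show "mor h' p = mor ?h p"
        using comp[OF i, of h'] h'(4)[OF i(1)] k[OF i] hk[OF p] by (simp del: arrow.sel)
    qed (use h' in simp_all)
  qed
qed

lemma tower:
  fixes f :: "'u top_map" and r :: "'u rel"
  assumes f: "f \<in> Arr Top" and r: "Well_order r" "small (Field r)"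
    and stage: "\<And>i. i \<in> Field r \<Longrightarrow> subcomplex_of f (stage i)" "\<And>i j. (i, j) \<in> r \<Longrightarrow> stage i \<subseteq> stage j"
    and lim: "\<And>j. limit_elem r j \<Longrightarrow> stage j = (\<Union>i\<in>underS r j. stage i)"
    and succ: "\<And>i j. immediate_succ r i j \<Longrightarrow> incl f (stage i) (stage j) \<in> cell (sphere_inclusions e)"
    and z: "z \<in> Field r" "\<And>i. i \<in> Field r \<Longrightarrow> (z, i) \<in> r"
  shows "incl f (stage z) (\<Union>i\<in>Field r. stage i) \<in> cell (sphere_inclusions e)"
proof -
  interpret wo: wo_rel r by (rule wo_rel.intro) (rule r(1))
  let ?X = "\<lambda>i. weak_top (src f) (stage i)" and ?x = "\<lambda>i j. incl f (stage i) (stage j)"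
  have diag: "is_diagram Top (Field r) r ?X ?x"
    unfolding is_diagram_def
  proof (intro conjI ballI impI)
    fix i assume i: "i \<in> Field r"
    show "?X i \<in> Obj Top" using small_weak_top[OF f stage(1)[OF i]] by simp
    show "?x i i = Idn Top (?X i)" by (rule incl_refl[OF stage(1)[OF i]])
    fix j assume j: "j \<in> Field r"
    show "?x i j \<in> Hom Top (?X i) (?X j)" if "(i, j) \<in> r"
      using incl_Arr[OF f stage(1)[OF i] stage(1)[OF j] stage(2)[OF that]] by (simp add: Hom_def)
    fix k assume k: "k \<in> Field r"
    show "?x j k \<cdot>\<^bsub>Top\<^esub> ?x i j = ?x i k" if "(i, j) \<in> r" "(j, k) \<in> r"
      by (rule incl_comp[OF f stage(1)[OF i] stage(1)[OF j] stage(1)[OF k] stage(2)[OF that(1)] stage(2)[OF that(2)]])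
  qed
  have tot: "(i, j) \<in> r \<or> (j, i) \<in> r" if "i \<in> Field r" "j \<in> Field r" for i j
    using wo.TOTALS that by blast
  have "is_colimit Top (underS r j) r ?X ?x (?X j) (\<lambda>i. ?x i j)" if j: "limit_elem r j" for j
  proof -
    have "i \<in> Field r" if "i \<in> underS r j" for i using that by (auto simp: underS_def Field_def)
    then show ?thesis
      by (intro chain_colimit[OF f _ _ _ _ lim[OF j]]) (use j tot stage in \<open>auto simp: limit_elem_def\<close>)
  qed
  then have seq: "transfinite_sequence Top r ?X ?x"
    using r(1) z(1) diag unfolding transfinite_sequence_def by blast
  have "is_colimit Top (Field r) r ?X ?x (weak_top (src f) (\<Union>i\<in>Field r. stage i)) (\<lambda>i. incl f (stage i) (\<Union>i\<in>Field r. stage i))"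
    by (rule chain_colimit[OF f _ _ _ _ refl]) (use z(1) tot stage in auto)
  from cell.transfinite[OF r(2) seq succ this z] show ?thesis .
qed

text \<open>The families \<open>G i\<close> are attached in the order \<open>r\<close>, and the step at \<open>i\<close> may use all earlier ones.
  Stage \<open>i\<close> of the tower contains \<open>G j\<close> for \<open>j\<close> strictly below \<open>i\<close>; the top element added to \<open>r\<close>
  indexes the complete union.\<close>

lemma attach_family:
  fixes f :: "'u top_map" and r :: "'u rel"
  assumes f: "f \<in> Arr Top" and r: "Well_order r" "small (Field r)"
    and step: "\<And>i Q. \<lbrakk>i \<in> Field r; subcomplex_of f Q; (\<Union>j\<in>underS r i. G j) \<subseteq> Q\<rbrakk> \<Longrightarrow> attachable e f Q (Q \<union> G i)"
    and Q: "subcomplex_of f Q"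
  shows "attachable e f Q (Q \<union> (\<Union>i\<in>Field r. G i))"
proof -
  obtain t where t: "t \<notin> Field r"
    using r(2) unfolding small_def lesspoll_def by (metis UNIV_eq_I eqpoll_refl)
  define r' where "r' = r \<union> insert t (Field r) \<times> {t}"
  note top = Well_order_add_top[OF r(1) t, folded r'_def]
  interpret wo: wo_rel r' by (rule wo_rel.intro) (rule top(1))
  have tr: "trans r'" and an: "antisym r'" and re: "\<And>i. i \<in> Field r' \<Longrightarrow> (i, i) \<in> r'"
    using wo.TRANS wo.ANTISYM wo.REFL by (auto simp: refl_on_def)
  have tot: "(i, j) \<in> r' \<or> (j, i) \<in> r'" if "i \<in> Field r'" "j \<in> Field r'" for i j
    using wo.TOTALS that by blast
  \<comment> \<open>The strict lower segment makes \<open>stage\<close> continuous at limit elements and gives \<open>stage z = Q\<close> at the least element.\<close>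
  define stage where "stage i = Q \<union> (\<Union>j\<in>underS r' i. G j)" for i
  have underS_mono: "underS r' i \<subseteq> underS r' j" if "(i, j) \<in> r'" for i j
    using that tr an unfolding underS_def trans_def antisym_def by blast
  have under_t: "i = t \<or> i \<in> Field r" if "i \<in> Field r'" for i using that top(2) by auto
  have le_t: "i \<in> Field r" "underS r' i = underS r i" if "(i, j) \<in> r'" "i \<noteq> j" for i j
  proof -
    have "i \<noteq> t" using that t by (auto simp: r'_def Field_def)
    then show "i \<in> Field r" using under_t[of i] that(1) by (auto simp: Field_def)
    then show "underS r' i = underS r i" by (rule top(4))
  qed
  have sub: "subcomplex_of f (stage i)" if "i \<in> Field r'" for i
    using that
  proof (induction i rule: wo.well_order_induct)
    case (1 i)
    \<comment> \<open>A stage is the union of \<open>Q\<close> and of all the results of earlier steps.\<close>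
    have "subcomplex_of f (\<Union> (insert Q ((\<lambda>j. stage j \<union> G j) ` underS r' i)))"
    proof (rule subcomplex_of_Union)
      fix P assume "P \<in> insert Q ((\<lambda>j. stage j \<union> G j) ` underS r' i)"
      then consider "P = Q" | j where "(j, i) \<in> r'" "j \<noteq> i" "P = stage j \<union> G j"
        by (auto simp: underS_def)
      then show "subcomplex_of f P"
      proof cases
        case (2 j)
        have "subcomplex_of f (stage j)" using 1(1) 2 by (auto simp: Field_def)
        then show ?thesis
          using step[of j "stage j"] le_t[OF 2(1,2)] 2(3) by (auto simp: attachable_def stage_def)
      qed (simp add: Q)
    qed
    also have "\<Union> (insert Q ((\<lambda>j. stage j \<union> G j) ` underS r' i)) = stage i"
    proof -
      have "stage j \<subseteq> stage i" if "j \<in> underS r' i" for j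
        using underS_mono[of j i] that by (auto simp: stage_def underS_def)
      then show ?thesis by (auto simp: stage_def)
    qed
    finally show ?case .
  qed
  obtain z where z: "z \<in> Field r'" "\<And>i. i \<in> Field r' \<Longrightarrow> (z, i) \<in> r'"
    using wo.minim_in[OF subset_refl] wo.minim_least[OF subset_refl] top(2) by blast
  have "underS r' z = {}"
    using z an by (auto simp: underS_def antisym_def Field_def)
  then have stage_z: "stage z = Q" by (simp add: stage_def)
  have mono: "stage i \<subseteq> stage j" if "(i, j) \<in> r'" for i j
    using underS_mono[OF that] by (auto simp: stage_def)
  have t': "t \<in> Field r'" "\<And>i. i \<in> Field r' \<Longrightarrow> (i, t) \<in> r'" using top(2) by (auto simp: r'_def)
  have "(\<Union>i\<in>Field r'. stage i) = stage t" using mono t' by blast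
  also have "stage t = Q \<union> (\<Union>i\<in>Field r. G i)" by (simp add: stage_def top(3))
  finally have un: "(\<Union>i\<in>Field r'. stage i) = Q \<union> (\<Union>i\<in>Field r. G i)" .
  have "incl f (stage z) (\<Union>i\<in>Field r'. stage i) \<in> cell (sphere_inclusions e)"
  proof (rule tower[OF f top(1) _ sub mono _ _ z])
    show "small (Field r')"
      unfolding top(2) using small_Un[OF small_finite[of "{t}"] r(2)] by simp
    show "stage j = (\<Union>i\<in>underS r' j. stage i)" if j: "limit_elem r' j" for j
    proof
      show "(\<Union>i\<in>underS r' j. stage i) \<subseteq> stage j" using mono by (auto simp: underS_def)
      obtain i0 where i0: "i0 \<in> underS r' j" using j by (auto simp: limit_elem_def)
      have "G k \<subseteq> (\<Union>i\<in>underS r' j. stage i)" if k: "k \<in> underS r' j" for k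
      proof -
        have kj: "(k, j) \<in> r'" "k \<noteq> j" using k by (auto simp: underS_def)
        have "\<not> immediate_succ r' k j" using j by (auto simp: limit_elem_def)
        \<comment> \<open>The limit element \<open>j\<close> is not the immediate successor of \<open>k\<close>, so some \<open>m\<close> lies strictly between them.\<close>
        then obtain m where m: "(k, m) \<in> r'" "m \<noteq> k" "(j, m) \<notin> r'"
          using kj by (auto simp: immediate_succ_def)
        have "m \<in> Field r'" "j \<in> Field r'" using m(1) kj(1) by (auto simp: Field_def)
        then have "(m, j) \<in> r'" "m \<noteq> j" using tot[of m j] m(3) re by auto
        then have "m \<in> underS r' j" "k \<in> underS r' m" using m by (auto simp: underS_def)
        then show ?thesis by (auto simp: stage_def)
      qed
      moreover have "Q \<subseteq> (\<Union>i\<in>underS r' j. stage i)" using i0 by (auto simp: stage_def)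
      ultimately show "stage j \<subseteq> (\<Union>i\<in>underS r' j. stage i)"
        by (subst stage_def) (intro Un_least UN_least)
    qed
    show "incl f (stage i) (stage j) \<in> cell (sphere_inclusions e)" if ij: "immediate_succ r' i j" for i j
    proof -
      have ij': "(i, j) \<in> r'" "i \<noteq> j" "\<And>k. (i, k) \<in> r' \<Longrightarrow> k \<noteq> i \<Longrightarrow> (j, k) \<in> r'"
        using ij by (auto simp: immediate_succ_def)
      have F: "i \<in> Field r'" "j \<in> Field r'" using ij'(1) by (auto simp: Field_def)
      have "underS r' j = insert i (underS r' i)"
      proof (intro subset_antisym subsetI)
        fix k assume "k \<in> underS r' j"
        then have k: "(k, j) \<in> r'" "k \<noteq> j" by (auto simp: underS_def)
        then have "(k, i) \<in> r'" using tot[of k i] F ij'(3)[of k] an unfolding antisym_def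
          by (metis FieldI1)
        then show "k \<in> insert i (underS r' i)" by (auto simp: underS_def)
      next
        fix k assume "k \<in> insert i (underS r' i)"
        then show "k \<in> underS r' j" using underS_mono[OF ij'(1)] ij' by (auto simp: underS_def)
      qed
      then have "stage j = stage i \<union> G i" by (auto simp: stage_def)
      then show ?thesis
        using step[of i "stage i"] le_t[OF ij'(1,2)] sub[OF F(1)] by (auto simp: attachable_def stage_def)
    qed
  qed
  then show ?thesis
    using sub[OF t'(1)] un \<open>stage t = Q \<union> (\<Union>i\<in>Field r. G i)\<close> by (simp add: attachable_def stage_z)
qed

text \<open>The empty family: identities are relative cell complexes.\<close>

lemma attachable_refl:
  assumes "(f :: 'u top_map) \<in> Arr Top" "subcomplex_of f Q"
  shows "attachable e f Q Q"
proof -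
  have "Well_order ({} :: 'u rel)" "small (Field ({} :: 'u rel))"
    by (auto intro: small_finite simp: Field_def well_order_on_def linear_order_on_def partial_order_on_def
        preorder_on_def refl_on_def trans_def antisym_def total_on_def)
  from attach_family[OF assms(1) this _ assms(2), of "\<lambda>_. {}"] show ?thesis by simp
qed

text \<open>Transfinite sequences are indexed by elements of \<open>'u\<close>, so a cell is represented by its central
  point.\<close>

definition center :: "'u cell_data \<Rightarrow> 'u"
  where "center c = cell_pt (fst c) (fst (snd c)) (snd (snd c)) (\<lambda>_. 0)"

lemma inj_center: "inj center"
  by (auto simp: inj_def center_def)

lemma small_centers:
  assumes "(f :: 'u top_map) \<in> Arr Top" "P \<subseteq> cells f"
  shows "small (center ` P)"
proof (rule small_subset)
  show "small (topspace (cell_space f))" using assms(1) by (intro small_cell_space) (auto simp: Arr_Top_iff)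
  show "center ` P \<subseteq> topspace (cell_space f)" using assms(2) origin by (auto simp: center_def)
qed

text \<open>By induction, each cell of \<open>Q0 \<inter> P\<close> lies in such a family, where \<open>Q0\<close> is the subcomplex into
  which \<open>c\<close> is attached. These families are attached one after the other in any order. The
  boundary of \<open>c\<close> is then present, since it lies in \<open>Q0\<close> and in the subcomplex \<open>P\<close>, and \<open>c\<close> is
  attached last.\<close>

lemma attachable_closure:
  assumes f: "(f :: 'u top_map) \<in> Arr Top" and c: "c \<in> cells f"
  shows "\<forall>P. subcomplex_of f P \<longrightarrow> c \<in> P \<longrightarrow> (\<exists>K. K \<subseteq> P \<and> c \<in> K \<and> (\<forall>Q. subcomplex_of f Q \<longrightarrow> attachable e f Q (Q \<union> K)))"
  using c
proof (induction rule: cells.induct)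
  case (attach Q0 n a b)
  have Q0: "subcomplex_of f Q0" using attach(1,2) by (auto simp: subcomplex_of_def)
  have nab: "(n, a, b) \<in> cells f" by (rule cells.attach[of Q0]) (use attach in auto)
  show ?case
  proof (intro allI impI)
    fix P assume P: "subcomplex_of f P" and cP: "(n, a, b) \<in> P"
    let ?c = "(n, a, b)"
    have "\<exists>K. K \<subseteq> P \<and> c \<in> K \<and> (\<forall>Q. subcomplex_of f Q \<longrightarrow> attachable e f Q (Q \<union> K))" if "c \<in> Q0 \<inter> P" for c
      using attach.IH[of c] P that by blast
    then obtain K where K: "\<And>c. c \<in> Q0 \<inter> P \<Longrightarrow> K c \<subseteq> P" "\<And>c. c \<in> Q0 \<inter> P \<Longrightarrow> c \<in> K c"
      "\<And>c Q. c \<in> Q0 \<inter> P \<Longrightarrow> subcomplex_of f Q \<Longrightarrow> attachable e f Q (Q \<union> K c)"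
      by metis
    show "\<exists>K. K \<subseteq> P \<and> ?c \<in> K \<and> (\<forall>Q. subcomplex_of f Q \<longrightarrow> attachable e f Q (Q \<union> K))"
    proof (cases "?c \<in> Q0")
      case True
      then show ?thesis using K[of ?c] cP by blast
    next
      case False
      obtain r where r: "well_order_on (center ` (Q0 \<inter> P)) r" using well_order_on by blast
      then have F: "Field r = center ` (Q0 \<inter> P)" and wr: "Well_order r"
        using well_order_on_Well_order by blast+
      have t: "center ?c \<notin> Field r" using False inj_center unfolding F by (auto simp: inj_eq)
      define r' where "r' = r \<union> insert (center ?c) (Field r) \<times> {center ?c}"
      note top = Well_order_add_top[OF wr t, folded r'_def]
      define G where "G i = (if i = center ?c then {?c} else K (inv center i))" for i
      have Gc: "G (center ?c) = {?c}" by (simp add: G_def)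
      have GK: "G (center c) = K c" if "c \<in> Q0 \<inter> P" for c
        using that False inj_center by (auto simp: G_def inj_eq)
      have UF: "(\<Union>i\<in>Field r'. G i) = insert ?c (\<Union>c\<in>Q0 \<inter> P. K c)"
        unfolding top(2) F using Gc GK by simp
      have "attachable e f Q (Q \<union> (\<Union>i\<in>Field r'. G i))" if Q: "subcomplex_of f Q" for Q
      proof (rule attach_family[OF f top(1) _ _ Q])
        show "small (Field r')"
          using small_centers[OF f, of "insert ?c (Q0 \<inter> P)"] nab Q0 unfolding top(2) F by (simp add: subcomplex_of_def subset_iff)
        fix i Q assume i: "i \<in> Field r'" and Q: "subcomplex_of f Q" and le: "(\<Union>j\<in>underS r' i. G j) \<subseteq> Q"
        from i consider c where "c \<in> Q0 \<inter> P" "i = center c" | "i = center ?c"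
          unfolding top(2) F by blast
        then show "attachable e f Q (Q \<union> G i)"
        proof cases
          case (1 c)
          then show ?thesis using GK K(3) Q by simp
        next
          case 2
          have "Q0 \<inter> P \<subseteq> Q"
          proof
            fix c assume c: "c \<in> Q0 \<inter> P"
            then have "center c \<in> underS r' i" unfolding 2 top(3) F by blast
            then show "c \<in> Q" using le K(2)[OF c] GK[OF c] by blast
          qed
          then have QP: "points (src f) (Q0 \<inter> P) \<subseteq> points (src f) Q" by (rule points_mono)
          have a: "a x \<in> points (src f) Q" if x: "x \<in> rim n" for x
          proof -
            have "a x \<in> points (src f) P" using P cP x unfolding subcomplex_of_def subcomplex_def by blast
            moreover have "a x \<in> points (src f) Q0"
              using attach(3,2) x by (auto simp: continuous_map_def rim_def)
            \<comment> \<open>The two subcomplexes name the same cell, because a point determines the cell that contains it.\<close>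
            ultimately have "a x \<in> points (src f) (Q0 \<inter> P)"
              by (cases rule: points_cases) auto
            then show ?thesis using QP by blast
          qed
          show ?thesis
          proof (cases "?c \<in> Q")
            case True
            then show ?thesis using attachable_refl[OF f Q] by (simp add: 2 Gc insert_absorb)
          next
            case False
            obtain u v where "is_pushout Top (sphere_inclusion e n) u v (incl f Q (insert ?c Q))"
              using attach_cell_pushout[OF f Q nab False a] by blast
            moreover have "sphere_inclusion e n \<in> cell (sphere_inclusions e)"
              by (rule cell.gen) (simp add: sphere_inclusions_def)
            ultimately have "incl f Q (insert ?c Q) \<in> cell (sphere_inclusions e)"
              by (blast intro: cell.pushout)
            then show ?thesis
              using subcomplex_of_insert[OF Q nab a] by (simp add: 2 Gc attachable_def)
          qed
        qed
      qed
      then show ?thesis unfolding UF using K(1) cP by (intro exI[of _ "insert ?c (\<Union>c\<in>Q0 \<inter> P. K c)"]) blast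
    qed
  qed
qed

lemma subcomplex_cell:
  assumes f: "(f :: 'u top_map) \<in> Arr Top" and P: "subcomplex_of f P"
  shows "incl f {} P \<in> cell (sphere_inclusions e)"
proof -
  have "\<exists>K. K \<subseteq> P \<and> c \<in> K \<and> (\<forall>Q. subcomplex_of f Q \<longrightarrow> attachable e f Q (Q \<union> K))" if "c \<in> P" for c
    using attachable_closure[OF f, of c] P that by (auto simp: subcomplex_of_def)
  then obtain K where K: "\<And>c. c \<in> P \<Longrightarrow> K c \<subseteq> P" "\<And>c. c \<in> P \<Longrightarrow> c \<in> K c"
    "\<And>c Q. c \<in> P \<Longrightarrow> subcomplex_of f Q \<Longrightarrow> attachable e f Q (Q \<union> K c)"
    by metis
  obtain r where r: "well_order_on (center ` P) r" using well_order_on by blast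
  then have F: "Field r = center ` P" and wr: "Well_order r"
    using well_order_on_Well_order by blast+
  have "attachable e f {} ({} \<union> (\<Union>i\<in>Field r. K (inv center i)))"
  proof (rule attach_family[OF f wr _ _ subcomplex_of_empty])
    show "small (Field r)" unfolding F using small_centers[OF f] P by (simp add: subcomplex_of_def)
    fix i Q assume "i \<in> Field r" "subcomplex_of f Q"
    then show "attachable e f Q (Q \<union> K (inv center i))"
      using K(3) inj_center unfolding F by auto
  qed
  moreover have "(\<Union>i\<in>Field r. K (inv center i)) = P"
    unfolding F using K(1,2) inj_center by auto
  ultimately show ?thesis by (simp add: attachable_def)
qed

text \<open>Relative cell complexes are closed under isomorphism because a square with invertible horizontal
  maps is a pushout.\<close>

lemma left_map_cell:
  assumes lm: "left_map_structure Top cell_awfs f \<alpha>"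
  shows "f \<in> cell (sphere_inclusions e)"
proof -
  note LM = left_map_structureD[OF lm]
  obtain Q where Q: "Q \<subseteq> cells f" "subcomplex (src f) Q" and im: "points (src f) Q = mor \<alpha> ` topspace (tgt f)"
    by (rule coalgebra_subcomplex[OF lm])
  have sQ: "subcomplex_of f Q" using Q by (simp add: subcomplex_of_def)
  have f: "f \<in> Arr Top" by (rule LM(1))
  have fc: "continuous_map (src f) (tgt f) (mor f)" using f by (simp add: Arr_Top_iff)
  have \<alpha>_f: "mor \<alpha> (mor f x) = base_pt x" if "x \<in> topspace (src f)" for x
    using arg_cong[OF LM(5), of "\<lambda>h. mor h x"] that by simp
  have proj_\<alpha>: "proj (mor f) (mor \<alpha> y) = y" if "y \<in> topspace (tgt f)" for y
  proof -
    have "mor \<alpha> y \<in> points (src f) (cells f)" using mor_in[OF LM(2), of y] LM(3,4) that by simp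
    then show ?thesis using arg_cong[OF LM(6), of "\<lambda>h. mor h y"] that LM(3) by simp
  qed
  have small: "small (topspace (src f))" "small (topspace (tgt f))" using f by (auto simp: Arr_Top_iff)
  let ?V = "weak_top (src f) {}" and ?W = "weak_top (src f) Q"
  define u where "u = Arrow ?V (src f) (restrict (proj (\<lambda>x. x)) (topspace ?V))"
  define u' where "u' = Arrow (src f) ?V (restrict base_pt (topspace (src f)))"
  define v where "v = Arrow ?W (tgt f) (restrict (proj (mor f)) (topspace ?W))"
  define v' where "v' = Arrow (tgt f) ?W (restrict (mor \<alpha>) (topspace (tgt f)))"
  have T0: "topspace ?V = base_pt ` topspace (src f)"
    using subcomplex_of_topspace[OF subcomplex_of_empty[of f]] by (auto simp: points_def)
  have T: "topspace ?W = points (src f) Q" by (rule subcomplex_of_topspace[OF sQ])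
  have "continuous_map ?V (src f) (proj (\<lambda>x. x))"
    using subcomplex_of_empty[of f] by (intro continuous_weak_topI) (auto simp: subcomplex_of_def)
  then have u: "u \<in> Arr Top" unfolding u_def using small small_weak_top[OF f subcomplex_of_empty] by (intro restrict_Arr_Top)
  have u': "u' \<in> Arr Top" unfolding u'_def using small small_weak_top[OF f subcomplex_of_empty] subcomplex_of_empty[of f]
    by (intro restrict_Arr_Top continuous_base_pt) (auto simp: subcomplex_of_def)
  have v: "v \<in> Arr Top" unfolding v_def using small small_weak_top[OF f sQ] continuous_proj[OF Q fc]
    by (intro restrict_Arr_Top)
  have "continuous_map (tgt f) ?W (mor \<alpha>)"
    using LM(2-4) im unfolding weak_top_eq_subtopology[OF Q] by (auto simp: Arr_Top_iff continuous_map_in_subtopology)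
  then have v': "v' \<in> Arr Top" unfolding v'_def using small small_weak_top[OF f sQ] by (intro restrict_Arr_Top)
  have sel: "src u = ?V" "tgt u = src f" "src u' = src f" "tgt u' = ?V"
    "src v = ?W" "tgt v = tgt f" "src v' = tgt f" "tgt v' = ?W"
    by (simp_all add: u_def u'_def v_def v'_def)
  have mor_uv: "\<And>x. x \<in> topspace (src f) \<Longrightarrow> mor u (base_pt x) = x" "\<And>x. x \<in> topspace (src f) \<Longrightarrow> mor u' x = base_pt x"
    "\<And>p. p \<in> points (src f) Q \<Longrightarrow> mor v p = proj (mor f) p" "\<And>y. y \<in> topspace (tgt f) \<Longrightarrow> mor v' y = mor \<alpha> y"
    using T0 T by (simp_all add: u_def u'_def v_def v'_def)
  have i: "incl f {} Q \<in> Arr Top" by (rule incl_Arr[OF f subcomplex_of_empty sQ]) simp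
  have idn: "Idn Top X \<in> Arr Top" if "small (topspace X)" for X :: "'u topology"
    using category.idn_closed(1)[OF category_Top, of X] that by simp
  have "is_pushout Top (incl f {} Q) u v f"
  proof (rule category.is_pushout_isomorphism[OF category_Top])
    show "u' \<cdot>\<^bsub>Top\<^esub> u = Idn Top ?V"
      by (rule Top_eqI) (use u u' sel mor_uv T0 idn small_weak_top[OF f subcomplex_of_empty] in \<open>auto simp: Top_Arr_comp simp del: Top_sel(4)\<close>, auto)
    show "u \<cdot>\<^bsub>Top\<^esub> u' = Idn Top (src f)"
      by (rule Top_eqI) (use u u' sel mor_uv idn[OF small(1)] in \<open>simp_all add: Top_Arr_comp\<close>)
    show "v' \<cdot>\<^bsub>Top\<^esub> v = Idn Top ?W"
      by (rule Top_eqI) (use v v' sel mor_uv T im proj_\<alpha> idn[OF small_weak_top[OF f sQ]] in \<open>auto simp: Top_Arr_comp\<close>)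
    show "v \<cdot>\<^bsub>Top\<^esub> v' = Idn Top (tgt f)"
      by (rule Top_eqI) (use v v' sel mor_uv im proj_\<alpha> idn[OF small(2)] in \<open>simp_all add: Top_Arr_comp\<close>)
    show "f \<cdot>\<^bsub>Top\<^esub> u = v \<cdot>\<^bsub>Top\<^esub> incl f {} Q"
      by (rule Top_eqI) (use u v f i sel mor_uv T0 subcomplex_of_topspace[OF subcomplex_of_empty[of f]] in \<open>auto simp: Top_Arr_comp\<close>)
  qed (use u u' v v' f i sel in \<open>auto simp: Hom_def\<close>)
  with subcomplex_cell[OF f sQ] show ?thesis by (rule cell.pushout)
qed

end

theorem theorem9p4:
  fixes e :: "(nat \<Rightarrow> real) \<Rightarrow> 'u"
    and A :: "'u top_map awfs_data"
    and f \<alpha> :: "'u top_map"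
  assumes "universe e"
    and "free_awfs Top (discrete_cat (sphere_inclusions e)) (discrete_inclusion (arrow_cat Top)) A"
    and "left_map_structure Top A f \<alpha>"
  shows "f \<in> cell (sphere_inclusions e)"
proof -
  interpret universe e by fact
  have "\<forall>j \<in> sphere_inclusions e. \<exists>\<beta>. left_map_structure Top cell_awfs j \<beta>"
    using sphere_inclusion_left_map by (auto simp: sphere_inclusions_def)
  then obtain \<beta> where "\<And>j. j \<in> sphere_inclusions e \<Longrightarrow> left_map_structure Top cell_awfs j (\<beta> j)"
    by metis
  then obtain \<gamma> where "left_map_structure Top cell_awfs f \<gamma>"
    using free_awfs_left_map[OF category_Top assms(2) awfs_cell_awfs _ assms(3)] by blast
  then show ?thesis by (rule left_map_cell)
qed

end
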